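(* For $n\ge1$ let $\mathbb{M}_n$ be a uniform random labeled map with $n$ edges (genus unconstrained), and let $\mathsf{Diameter}(\mathbb{M}_n)$ be the diameter, for the graph distance, of its underlying graph. There exists a constant $\xi\in(0,1)$ such that $$\lim_{n\to\infty}\mathbb{P}(\mathsf{Diameter}(\mathbb{M}_n)=3)=1-\lim_{n\to\infty}\mathbb{P}(\mathsf{Diameter}(\mathbb{M}_n)=2)=\xi .$$
   Context: A labeled map with $n$ edges (connected, on an oriented surface) is identified with a pair $(\alpha,\phi)$ of permutations of $\{1,\dots,2n\}$, where $\alpha$ is an involution without fixed points and the subgroup generated by $\alpha$ and $\phi$ acts transitively on $\{1,\dots,2n\}$. The elements of $\{1,\dots,2n\}$ are the oriented edges, $\alpha$ reverses oriented edges, the faces are the cycles of $\phi$, and the vertices are the cycles of $\phi\circ\alpha$ (the cycle containing $i$ is the vertex from which the oriented edge $i$ starts). The underlying (multi)graph has the cycles of $\phi\circ\alpha$ as vertices and, for each pair $\{i,\alpha(i)\}$, an edge joining the cycle containing $i$ to the cycle containing $\alpha(i)$. $\mathbb{M}_n$ is uniform over the finite set of all such pairs. *)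

theory Defs
  imports
    "HOL-Probability.Probability_Mass_Function"
    "HOL-Combinatorics.Orbits"
    "HOL-Algebra.Sym_Groups"
    "Graph_Theory.Shortest_Path"
begin

definition labeled_maps :: "nat \<Rightarrow> ((nat \<Rightarrow> nat) \<times> (nat \<Rightarrow> nat)) set" where
  "labeled_maps n = {(\<alpha>, \<phi>).
     \<alpha> permutes {1..2*n} \<and> \<phi> permutes {1..2*n} \<and>
     \<alpha> \<circ> \<alpha> = id \<and> (\<forall>i\<in>{1..2*n}. \<alpha> i \<noteq> i) \<and>
     (\<forall>i\<in>{1..2*n}. \<forall>j\<in>{1..2*n}. \<exists>g\<in>generate (sym_group (2*n)) {\<alpha>, \<phi>}. g i = j)}"

text \<open>
  The underlying multigraph is encoded as a symmetric multidigraph: the edge \<open>{i, \<alpha> i}\<close> is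
  represented by the two mutually reverse arcs \<open>i\<close> and \<open>\<alpha> i\<close>. Vertices are the cycles of
  \<open>\<phi> \<circ> \<alpha>\<close> as sets (a fixed point gives a singleton).
\<close>

definition map_graph ::
    "nat \<Rightarrow> (nat \<Rightarrow> nat) \<times> (nat \<Rightarrow> nat) \<Rightarrow> (nat set, nat) pre_digraph" where
  "map_graph n = (\<lambda>(\<alpha>, \<phi>).
     \<lparr> verts = orbit (\<phi> \<circ> \<alpha>) ` {1..2*n},
       arcs = {1..2*n},
       tail = (\<lambda>i. orbit (\<phi> \<circ> \<alpha>) i),
       head = (\<lambda>i. orbit (\<phi> \<circ> \<alpha>) (\<alpha> i)) \<rparr>)"

definition graph_dist :: "('a, 'b) pre_digraph \<Rightarrow> 'a \<Rightarrow> 'a \<Rightarrow> ereal" where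
  "graph_dist G u v = wf_digraph.\<mu> G (\<lambda>_. 1) u v"

definition graph_diameter :: "('a, 'b) pre_digraph \<Rightarrow> ereal" where
  "graph_diameter G = (SUP u\<in>verts G. SUP v\<in>verts G. graph_dist G u v)"

definition random_map :: "nat \<Rightarrow> ((nat \<Rightarrow> nat) \<times> (nat \<Rightarrow> nat)) pmf" where
  "random_map n = pmf_of_set (labeled_maps n)"

text \<open>
  The next two facts make \<^const>\<open>random_map\<close> the genuine uniform distribution;
  \<^const>\<open>pmf_of_set\<close> is unspecified on empty or infinite sets.
\<close>

lemma finite_labeled_maps: "finite (labeled_maps n)"
proof (rule finite_subset)
  show "labeled_maps n \<subseteq> {p. p permutes {1..2*n}} \<times> {p. p permutes {1..2*n}}"
    by (auto simp: labeled_maps_def)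
  show "finite ({p. p permutes {1..2*n}} \<times> {p. p permutes {1..2*n}})"
    by (intro finite_cartesian_product finite_permutations) auto
qed

lemma labeled_maps_nonempty: "labeled_maps n \<noteq> {}"
proof -
  define \<alpha> where
    "\<alpha> = (\<lambda>i. if i \<in> {1..2*n} then (if odd i then i + 1 else i - 1) else i)"
  define \<phi> where
    "\<phi> = (\<lambda>i. if i \<in> {1..2*n} then (if i = 2*n then 1 else i + 1) else i)"
  let ?G = "generate (sym_group (2*n)) {\<alpha>, \<phi>}"
  have inv: "\<alpha> (\<alpha> i) = i" for i
    unfolding \<alpha>_def by (auto elim!: oddE evenE) presburger
  have \<alpha>: "\<alpha> permutes {1..2*n}"
    unfolding permutes_def
  proof (intro conjI allI impI)
    show "\<alpha> x = x" if "x \<notin> {1..2*n}" for x using that by (auto simp: \<alpha>_def)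
    show "\<exists>!x. \<alpha> x = y" for y using inv by metis
  qed
  have \<phi>: "\<phi> permutes {1..2*n}"
  proof (rule bij_imp_permutes)
    show "bij_betw \<phi> {1..2*n} {1..2*n}"
      by (rule bij_betw_byWitness[where f' = "\<lambda>i. if i = 1 then 2*n else i - 1"])
        (auto simp: \<phi>_def)
  qed (auto simp: \<phi>_def)
  have step: "\<exists>g\<in>?G. g i = \<phi> j" if reach: "\<exists>g\<in>?G. g i = j" for i j
  proof -
    obtain g where g: "g \<in> ?G" "g i = j" using reach by blast
    have "\<phi> \<otimes>\<^bsub>sym_group (2*n)\<^esub> g \<in> ?G"
      by (rule generate.eng[OF generate.incl g(1)]) simp
    then show ?thesis using g by (intro bexI[of _ "\<phi> \<circ> g"]) (auto simp: sym_group_mult)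
  qed
  have up: "\<exists>g\<in>?G. g i = m + d"
    if "1 \<le> m" "\<exists>g\<in>?G. g i = m" "m + d \<le> 2*n" for i m d
    using that(3)
  proof (induction d)
    case 0
    then show ?case using that by simp
  next
    case (Suc d)
    then have "\<exists>g\<in>?G. g i = m + d" by simp
    from step[OF this] show ?case using Suc.prems that(1) by (simp add: \<phi>_def)
  qed
  have "\<exists>g\<in>?G. g i = j" if i: "i \<in> {1..2*n}" and j: "j \<in> {1..2*n}" for i j
  proof -
    have "id \<in> ?G" using generate.one[of "sym_group (2*n)"] by (simp add: sym_group_one)
    then have "\<exists>g\<in>?G. g i = i" by (intro bexI[of _ id]) auto
    from up[OF _ this, of "2*n - i"] i have "\<exists>g\<in>?G. g i = 2*n" by simp
    from step[OF this] i have "\<exists>g\<in>?G. g i = 1" by (simp add: \<phi>_def)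
    from up[OF _ this, of "j - 1"] j show ?thesis by simp
  qed
  moreover have "\<alpha> i \<noteq> i" if "i \<in> {1..2*n}" for i
    using that by (auto simp: \<alpha>_def)
  ultimately have "(\<alpha>, \<phi>) \<in> labeled_maps n"
    using \<alpha> \<phi> inv by (auto simp: labeled_maps_def fun_eq_iff)
  then show ?thesis by blast
qed

lemma wf_digraph_map_graph:
  assumes "M \<in> labeled_maps n"
  shows "wf_digraph (map_graph n M)"
proof -
  obtain \<alpha> \<phi> where M: "M = (\<alpha>, \<phi>)" by (cases M)
  have "\<alpha> permutes {1..2*n}" using assms by (simp add: M labeled_maps_def)
  then have "\<alpha> i \<in> {1..2*n}" if "i \<in> {1..2*n}" for i
    using that permutes_in_image by metis
  then show ?thesis by (unfold_locales) (auto simp: M map_graph_def)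
qed

end

theory Submission
  imports Defs "HOL-Analysis.Harmonic_Numbers" "HOL-Real_Asymp.Real_Asymp"
begin

text \<open>
  Fix the fixed-point-free involution \<open>\<alpha>\<close>; then \<open>\<sigma> = \<phi> \<circ> \<alpha>\<close> is a uniform permutation of the \<open>N = 2n\<close>
  half-edges and everything depends on \<open>\<sigma>\<close> only through its partition into cycles. Two exact
  properties of this random partition drive the proof: choosing some of the cycles amounts to
  choosing their support \<open>U\<close> together with independent permutations of \<open>U\<close> and of its complement,
  and the restriction of the partition to any subset is again the partition of a uniform
  permutation. In particular, the cycle of a point avoids \<open>j\<close> other given points with probability
  \<open>1 / (j + 1)\<close>.

  Call cycles of length at least \<open>N powr (3/4)\<close> hubs. By first moment estimates, with probability
  tending to 1 all hubs are pairwise adjacent and every other vertex is adjacent to a hub, so the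
  diameter is at most 3 and only pairs of non-hubs can be at distance 3. The expected number of such
  pairs with a vertex of degree above \<open>K\<close> is at most the tail beyond \<open>K\<close> of a convergent series.
  For degrees at most \<open>K\<close>, Moebius inversion over sets of small vertices turns the probability that
  no two of them are at distance 3 into an absolutely convergent sum whose terms converge. The limit
  is positive, since with probability of order \<open>1 / K\<close> there is no vertex of degree at most \<open>K\<close>,
  and then pairs at distance 3 are unlikely; it is less than 1 because of leaves attached to
  different vertices. Maps of finite diameter are connected, so conditioning on connectedness
  does not matter in the limit.
\<close>

section \<open>Blocks of uniform permutations\<close>

text \<open>The bounds used in the end are proved for one matching \<open>\<alpha>\<close> and
  depend on it only through \<open>card X\<close>, so averaging over \<open>\<alpha>\<close> is
  free. The series behind distant pairs is \<open>harm k / k^2\<close>: there are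
  \<open>1 / k\<close> cycles of length \<open>k\<close> on average, a given half-edge of another
  vertex misses all neighbours of such a cycle with probability about \<open>1 / k\<close>, and the
  smaller vertex of the pair contributes \<open>harm k\<close>. The obstacle to positivity is that
  the tail of this series beyond \<open>K\<close> has order \<open>ln K / K\<close>, whereas degrees
  at most \<open>K\<close> are absent only with probability of order \<open>1 / K\<close>; a plain
  union bound loses. Distant pairs are therefore estimated jointly with the absence of short cycles
  outside the pair. This supplies a second factor \<open>1 / (K + 1)\<close>, and the tail only has
  to be smaller than a constant. Inclusion-exclusion converges uniformly in \<open>card X\<close>
  because a Moebius term over a set of blocks is at most 2 to the number of blocks, while a set of
  size \<open>s\<close> rarely splits into short cycles only; together they give decay
  \<open>2^(-s)\<close>. The limit is not computed: approximations whose error is the tail beyond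
  \<open>K\<close> make the sequence Cauchy.\<close>

definition blocks :: "('a \<Rightarrow> 'a) \<Rightarrow> 'a set \<Rightarrow> 'a set set" where
  "blocks \<sigma> X = orbit \<sigma> ` X"

lemma self_in_orbit_permutes:
  assumes "\<sigma> permutes X" "finite X"
  shows "x \<in> orbit \<sigma> x"
proof (rule permutation_self_in_orbit)
  show "permutation \<sigma>" unfolding permutation_permutes using assms by (intro exI conjI)
qed

lemma partition_on_blocks:
  assumes "\<sigma> permutes X" "finite X"
  shows "partition_on X (blocks \<sigma> X)"
proof (rule partition_onI)
  show "\<Union> (blocks \<sigma> X) = X"
  proof
    show "\<Union> (blocks \<sigma> X) \<subseteq> X"
      unfolding blocks_def using permutes_orbit_subset[OF assms(1)] by (auto simp: subset_iff)
    show "X \<subseteq> \<Union> (blocks \<sigma> X)"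
    proof
      fix x assume "x \<in> X"
      then show "x \<in> \<Union> (blocks \<sigma> X)"
        unfolding blocks_def using self_in_orbit_permutes[OF assms, of x] by auto
    qed
  qed
  show "{} \<notin> blocks \<sigma> X"
    unfolding blocks_def using orbit_nonempty[of \<sigma>] by (auto simp: image_iff)
  show "disjnt p q" if pq: "p \<in> blocks \<sigma> X" "q \<in> blocks \<sigma> X" "p \<noteq> q" for p q
  proof -
    obtain x y where p: "p = orbit \<sigma> x" and q: "q = orbit \<sigma> y"
      using pq unfolding blocks_def by blast
    have eq: "orbit \<sigma> z = orbit \<sigma> w" if "z \<in> orbit \<sigma> w" for z w
    proof -
      have "w \<in> orbit \<sigma> z" using orbit_swap[OF self_in_orbit_permutes[OF assms] that] .
      then show ?thesis using that orbit_trans[of _ \<sigma>] by (intro subset_antisym subsetI)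
    qed
    show ?thesis
    proof (rule ccontr)
      assume "\<not> disjnt p q"
      then obtain z where "z \<in> orbit \<sigma> x" "z \<in> orbit \<sigma> y" unfolding p q disjnt_def by blast
      then show False using eq[of z x] eq[of z y] pq(3) unfolding p q by simp
    qed
  qed
qed

lemma perm_restrict_closed:
  assumes "\<sigma> permutes X" "finite X" "U \<subseteq> X" "\<sigma> ` U \<subseteq> U"
  shows "perm_restrict \<sigma> U permutes U"
    and "x \<in> U \<Longrightarrow> orbit (perm_restrict \<sigma> U) x = orbit \<sigma> x"
proof -
  have fU: "finite U" using assms finite_subset by blast
  have inj: "inj_on \<sigma> U" using permutes_inj[OF assms(1)] by (rule inj_on_subset) simp
  have "bij_betw \<sigma> U U"
    using endo_inj_surj[OF fU assms(4) inj] inj by (simp add: bij_betw_def)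
  then have "bij_betw (perm_restrict \<sigma> U) U U"
    by (subst bij_betw_cong[of U _ \<sigma>]) (auto simp: perm_restrict_def)
  then show "perm_restrict \<sigma> U permutes U"
    by (rule bij_imp_permutes) (auto simp: perm_restrict_def)
  show "orbit (perm_restrict \<sigma> U) x = orbit \<sigma> x" if "x \<in> U"
    using that assms(4) by (intro orbit_cong0[of x U]) (auto simp: perm_restrict_def)
qed

lemma closed_compl:
  assumes "\<sigma> permutes X" "finite X" "U \<subseteq> X" "\<sigma> ` U \<subseteq> U"
  shows "\<sigma> ` (X - U) \<subseteq> X - U"
proof -
  have inj: "inj \<sigma>" using permutes_inj[OF assms(1)] .
  have "\<sigma> ` U = U"
    by (rule endo_inj_surj[OF finite_subset[OF assms(3,2)] assms(4) inj_on_subset[OF inj subset_UNIV]])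
  then have "\<sigma> ` (X - U) = \<sigma> ` X - U" using inj by (simp add: image_set_diff)
  then show ?thesis using permutes_image[OF assms(1)] by simp
qed

text \<open>A permutation of \<open>X\<close> with a chosen set of cycles is the same as a subset \<open>U\<close> (the support
  of the chosen cycles) with permutations of \<open>U\<close> and of \<open>X - U\<close>.\<close>

lemma sum_split_blocks:
  fixes f :: "'a set set \<Rightarrow> 'a set set \<Rightarrow> real"
  assumes fin: "finite X"
  shows "(\<Sum>\<sigma> | \<sigma> permutes X. \<Sum>T\<in>Pow (blocks \<sigma> X). f T (blocks \<sigma> X - T)) =
    (\<Sum>U\<in>Pow X. \<Sum>\<rho> | \<rho> permutes U. \<Sum>\<tau> | \<tau> permutes (X - U). f (blocks \<rho> U) (blocks \<tau> (X - U)))"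
proof -
  let ?L = "SIGMA \<sigma>:{\<sigma>. \<sigma> permutes X}. Pow (blocks \<sigma> X)"
  let ?R = "SIGMA U:Pow X. {\<rho>. \<rho> permutes U} \<times> {\<tau>. \<tau> permutes (X - U)}"
  have finb: "finite (blocks \<sigma> X)" for \<sigma> using fin by (simp add: blocks_def)
  have "(\<Sum>\<sigma> | \<sigma> permutes X. \<Sum>T\<in>Pow (blocks \<sigma> X). f T (blocks \<sigma> X - T)) =
      (\<Sum>(\<sigma>,T)\<in>?L. f T (blocks \<sigma> X - T))"
    using fin finb by (subst sum.Sigma) (auto simp: finite_permutations)
  also have "\<dots> = (\<Sum>(U,\<rho>,\<tau>)\<in>?R. f (blocks \<rho> U) (blocks \<tau> (X - U)))"
  proof (rule sum.reindex_bij_witness[where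
        i = "\<lambda>(U,\<rho>,\<tau>). (\<rho> \<circ> \<tau>, blocks \<rho> U)" and
        j = "\<lambda>(\<sigma>,T). (\<Union>T, perm_restrict \<sigma> (\<Union>T), perm_restrict \<sigma> (X - \<Union>T))"])
    fix a assume "a \<in> ?L"
    then obtain \<sigma> T where a: "a = (\<sigma>, T)" and s: "\<sigma> permutes X" and T: "T \<subseteq> blocks \<sigma> X" by blast
    let ?U = "\<Union>T"
    have part: "partition_on X (blocks \<sigma> X)" using partition_on_blocks[OF s fin] .
    have UX: "?U \<subseteq> X" using part T unfolding partition_on_def by blast
    have cl: "\<sigma> ` ?U \<subseteq> ?U"
    proof
      fix y assume "y \<in> \<sigma> ` ?U"
      then obtain x A where x: "y = \<sigma> x" "x \<in> A" "A \<in> T" by blast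
      then obtain z where "A = orbit \<sigma> z" using T unfolding blocks_def by blast
      then show "y \<in> ?U" using x orbit.step[of x \<sigma> z] by (intro UnionI[of A]) auto
    qed
    note r1 = perm_restrict_closed[OF s fin UX cl]
    have UX': "X - ?U \<subseteq> X" by blast
    note r2 = perm_restrict_closed[OF s fin UX' closed_compl[OF s fin UX cl]]
    have inT: "orbit \<sigma> x \<in> T \<longleftrightarrow> x \<in> ?U" if "x \<in> X" for x
    proof
      assume "orbit \<sigma> x \<in> T" then show "x \<in> ?U" using self_in_orbit_permutes[OF s fin] by blast
    next
      assume "x \<in> ?U"
      then obtain A where A: "A \<in> T" "x \<in> A" by blast
      have "orbit \<sigma> x \<in> blocks \<sigma> X" "x \<in> orbit \<sigma> x" "A \<in> blocks \<sigma> X"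
        using that self_in_orbit_permutes[OF s fin] A T by (auto simp: blocks_def)
      then have "orbit \<sigma> x = A"
        using part A(2) unfolding partition_on_def by (auto dest: disjointD)
      then show "orbit \<sigma> x \<in> T" using A by simp
    qed
    have b1: "blocks (perm_restrict \<sigma> ?U) ?U = T"
    proof -
      have "blocks (perm_restrict \<sigma> ?U) ?U = orbit \<sigma> ` ?U" unfolding blocks_def using r1(2) by auto
      also have "\<dots> = T"
      proof
        show "orbit \<sigma> ` ?U \<subseteq> T" using inT UX by blast
        show "T \<subseteq> orbit \<sigma> ` ?U"
        proof
          fix A assume A: "A \<in> T"
          then obtain x where "x \<in> X" "A = orbit \<sigma> x" using T unfolding blocks_def by blast
          then show "A \<in> orbit \<sigma> ` ?U" using inT A by blast
        qed
      qed
      finally show ?thesis .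
    qed
    have b2: "blocks (perm_restrict \<sigma> (X - ?U)) (X - ?U) = blocks \<sigma> X - T"
    proof -
      have "blocks (perm_restrict \<sigma> (X - ?U)) (X - ?U) = orbit \<sigma> ` (X - ?U)"
        unfolding blocks_def using r2(2) by auto
      also have "\<dots> = blocks \<sigma> X - T" unfolding blocks_def using inT by blast
      finally show ?thesis .
    qed
    have "perm_restrict \<sigma> ?U \<circ> perm_restrict \<sigma> (X - ?U) = perm_restrict \<sigma> (?U \<union> (X - ?U))"
      by (rule perm_restrict_union) (use r1 r2 in auto)
    also have "\<dots> = \<sigma>" using UX s by (simp add: Un_absorb1)
    finally have comp: "perm_restrict \<sigma> ?U \<circ> perm_restrict \<sigma> (X - ?U) = \<sigma>" .
    let ?j = "\<lambda>(\<sigma>,T). (\<Union>T, perm_restrict \<sigma> (\<Union>T), perm_restrict \<sigma> (X - \<Union>T))"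
    show "(case ?j a of (U,\<rho>,\<tau>) \<Rightarrow> (\<rho> \<circ> \<tau>, blocks \<rho> U)) = a"
      unfolding a using comp b1 by simp
    show "?j a \<in> ?R" unfolding a using r1(1) r2(1) UX by simp
    show "(case ?j a of (U,\<rho>,\<tau>) \<Rightarrow> f (blocks \<rho> U) (blocks \<tau> (X - U))) =
      (case a of (\<sigma>,T) \<Rightarrow> f T (blocks \<sigma> X - T))"
      unfolding a using b1 b2 by simp
  next
    fix b assume "b \<in> ?R"
    then obtain U \<rho> \<tau> where b: "b = (U,\<rho>,\<tau>)" and U: "U \<subseteq> X" and r: "\<rho> permutes U"
      and t: "\<tau> permutes (X - U)" by blast
    have fU: "finite U" using U fin finite_subset by blast
    have on: "(\<rho> \<circ> \<tau>) x = \<rho> x" if "x \<in> U" for x using t that by (simp add: permutes_def)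
    have off: "(\<rho> \<circ> \<tau>) x = \<tau> x" if "x \<in> X - U" for x
      using that r permutes_in_image[OF t, of x] by (auto simp: permutes_def)
    have out: "(\<rho> \<circ> \<tau>) x = x" if "x \<notin> X" for x using that U r t by (auto simp: permutes_def)
    have s: "\<rho> \<circ> \<tau> permutes X"
      using permutes_compose[OF permutes_subset[OF t] permutes_subset[OF r U]] by blast
    have cl: "(\<rho> \<circ> \<tau>) ` U \<subseteq> U" using on permutes_in_image[OF r] by auto
    have e1: "perm_restrict (\<rho> \<circ> \<tau>) U = \<rho>"
      using on r by (auto simp: perm_restrict_def permutes_def fun_eq_iff)
    have e2: "perm_restrict (\<rho> \<circ> \<tau>) (X - U) = \<tau>"
    proof
      fix x show "perm_restrict (\<rho> \<circ> \<tau>) (X - U) x = \<tau> x"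
        using off[of x] t by (cases "x \<in> X - U") (auto simp: perm_restrict_def permutes_def)
    qed
    have Un: "\<Union>(blocks \<rho> U) = U" using partition_on_blocks[OF r fU] by (simp add: partition_on_def)
    have sub: "blocks \<rho> U \<subseteq> blocks (\<rho> \<circ> \<tau>) X"
      using perm_restrict_closed(2)[OF s fin U cl] U unfolding e1 blocks_def by blast
    show "(case (case b of (U,\<rho>,\<tau>) \<Rightarrow> (\<rho> \<circ> \<tau>, blocks \<rho> U)) of
        (\<sigma>,T) \<Rightarrow> (\<Union>T, perm_restrict \<sigma> (\<Union>T), perm_restrict \<sigma> (X - \<Union>T))) = b"
      unfolding b using e1 e2 Un by simp
    show "(case b of (U,\<rho>,\<tau>) \<Rightarrow> (\<rho> \<circ> \<tau>, blocks \<rho> U)) \<in> ?L"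
      unfolding b using s sub by auto
  qed
  also have "\<dots> = (\<Sum>U\<in>Pow X. \<Sum>(\<rho>,\<tau>)\<in>{\<rho>. \<rho> permutes U} \<times> {\<tau>. \<tau> permutes (X - U)}.
      f (blocks \<rho> U) (blocks \<tau> (X - U)))"
    using fin by (subst sum.Sigma) (auto intro!: finite_permutations finite_subset[of _ X])
  also have "\<dots> = (\<Sum>U\<in>Pow X. \<Sum>\<rho> | \<rho> permutes U. \<Sum>\<tau> | \<tau> permutes (X - U).
      f (blocks \<rho> U) (blocks \<tau> (X - U)))"
    by (simp add: sum.cartesian_product)
  finally show ?thesis .
qed

text \<open>Expectation under the cycle partition of a uniform permutation of \<open>X\<close>,
  which is the Ewens law with parameter 1. The ground set is an explicit argument because
  conditioning on some cycles leaves the same law on the complement, so conditional expectations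
  become nested \<open>EP\<close>s.\<close>

definition EP :: "'a set \<Rightarrow> ('a set set \<Rightarrow> real) \<Rightarrow> real" where
  "EP X f = (\<Sum>\<sigma> | \<sigma> permutes X. f (blocks \<sigma> X)) / fact (card X)"

lemma EP_cong:
  assumes "finite X" "\<And>\<pi>. partition_on X \<pi> \<Longrightarrow> f \<pi> = g \<pi>"
  shows "EP X f = EP X g"
  unfolding EP_def using assms partition_on_blocks[OF _ assms(1)]
  by (intro arg_cong2[where f = "(/)"] sum.cong) auto

lemma EP_mono:
  assumes "finite X" "\<And>\<pi>. partition_on X \<pi> \<Longrightarrow> f \<pi> \<le> g \<pi>"
  shows "EP X f \<le> EP X g"
  unfolding EP_def by (intro divide_right_mono sum_mono) (use assms partition_on_blocks in auto)

lemma EP_const: "finite X \<Longrightarrow> EP X (\<lambda>_. c) = c"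
  by (simp add: EP_def card_permutations)

lemma EP_add: "EP X (\<lambda>\<pi>. f \<pi> + g \<pi>) = EP X f + EP X g"
  by (simp add: EP_def sum.distrib add_divide_distrib)

lemma EP_diff: "EP X (\<lambda>\<pi>. f \<pi> - g \<pi>) = EP X f - EP X g"
  by (simp add: EP_def sum_subtractf diff_divide_distrib)

lemma EP_cmult: "EP X (\<lambda>\<pi>. c * f \<pi>) = c * EP X f"
  by (simp add: EP_def sum_distrib_left)

lemma EP_sum: "EP X (\<lambda>\<pi>. \<Sum>i\<in>I. f i \<pi>) = (\<Sum>i\<in>I. EP X (f i))"
  unfolding EP_def by (subst sum.swap) (simp add: sum_divide_distrib)

lemma EP_nonneg:
  assumes "finite X" "\<And>\<pi>. partition_on X \<pi> \<Longrightarrow> 0 \<le> f \<pi>"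
  shows "0 \<le> EP X f"
  using EP_mono[OF assms(1), of "\<lambda>_. 0" f] assms by (simp add: EP_const)

lemma EP_le_const:
  assumes "finite X" "\<And>\<pi>. partition_on X \<pi> \<Longrightarrow> f \<pi> \<le> c"
  shows "EP X f \<le> c"
  using EP_mono[OF assms(1), of f "\<lambda>_. c"] assms by (simp add: EP_const)

lemma EP_abs: "\<bar>EP X f\<bar> \<le> EP X (\<lambda>\<pi>. \<bar>f \<pi>\<bar>)"
  unfolding EP_def by (simp add: abs_divide) (intro divide_right_mono sum_abs, simp)

lemma EP_empty: "EP {} f = f {}"
  by (simp add: EP_def blocks_def)

text \<open>The factor is the reciprocal of \<open>card X choose card U\<close>; it arises from
  normalising the sums over permutations of \<open>U\<close> and of \<open>X - U\<close>
  separately.\<close>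

lemma EP_split:
  assumes fin: "finite X"
  shows "EP X (\<lambda>\<pi>. \<Sum>T\<in>Pow \<pi>. f T (\<pi> - T)) =
    (\<Sum>U\<in>Pow X. fact (card U) * fact (card (X - U)) / fact (card X) * EP U (\<lambda>T. EP (X - U) (f T)))"
  unfolding EP_def sum_split_blocks[OF fin]
  by (simp add: sum_divide_distrib sum_distrib_left)

section \<open>Counting subsets and weighting them as cycles\<close>

lemma card_subsets_between:
  assumes "finite X" "S \<subseteq> X" "T \<subseteq> X" "S \<inter> T = {}" "card S \<le> k"
  shows "card {A \<in> Pow X. S \<subseteq> A \<and> A \<inter> T = {} \<and> card A = k} = (card X - card S - card T) choose (k - card S)"
proof -
  have fin: "finite S" "finite T" using assms(1-3) by (auto intro: finite_subset)
  have "bij_betw (\<lambda>B. B \<union> S) {B. B \<subseteq> X - S - T \<and> card B = k - card S}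
      {A \<in> Pow X. S \<subseteq> A \<and> A \<inter> T = {} \<and> card A = k}"
  proof (rule bij_betw_byWitness[where f' = "\<lambda>A. A - S"])
    show "(\<lambda>B. B \<union> S) ` {B. B \<subseteq> X - S - T \<and> card B = k - card S}
        \<subseteq> {A \<in> Pow X. S \<subseteq> A \<and> A \<inter> T = {} \<and> card A = k}"
    proof (clarify, intro conjI)
      fix B assume B: "B \<subseteq> X - S - T" "card B = k - card S"
      have "finite B" using B(1) assms(1) finite_subset by fastforce
      then show "card (B \<union> S) = k"
        using B fin assms(5) by (subst card_Un_disjoint) auto
    qed (use assms in auto)
    show "(\<lambda>A. A - S) ` {A \<in> Pow X. S \<subseteq> A \<and> A \<inter> T = {} \<and> card A = k}
        \<subseteq> {B. B \<subseteq> X - S - T \<and> card B = k - card S}"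
      using fin by (auto simp: card_Diff_subset)
  qed auto
  then have "card {A \<in> Pow X. S \<subseteq> A \<and> A \<inter> T = {} \<and> card A = k} =
      card {B. B \<subseteq> X - S - T \<and> card B = k - card S}"
    by (simp add: bij_betw_same_card)
  also have "\<dots> = card (X - S - T) choose (k - card S)"
    using assms(1) by (simp add: n_subsets)
  also have "card (X - S - T) = card X - card S - card T"
  proof -
    have "T \<subseteq> X - S" using assms by blast
    then show ?thesis using fin assms(2) by (simp add: card_Diff_subset)
  qed
  finally show ?thesis .
qed

lemma card_subsets_point:
  assumes "finite X" "x \<in> X" "1 \<le> k"
  shows "card {A \<in> Pow X. x \<in> A \<and> card A = k} = (card X - 1) choose (k - 1)"
  using card_subsets_between[OF assms(1), of "{x}" "{}" k] assms(2,3) by simp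

lemma card_subsets_card:
  assumes "finite X"
  shows "card {A \<in> Pow X. card A = k} = card X choose k"
  using card_subsets_between[OF assms(1), of "{}" "{}" k] by simp

lemma sum_by_card:
  fixes h :: "'a set \<Rightarrow> real"
  assumes "finite X"
  shows "(\<Sum>A | A \<in> Pow X \<and> P A. h A) = (\<Sum>k\<le>card X. \<Sum>A | A \<in> Pow X \<and> P A \<and> card A = k. h A)"
proof -
  have "(\<Sum>k\<le>card X. \<Sum>A | A \<in> {A. A \<in> Pow X \<and> P A} \<and> card A = k. h A) = (\<Sum>A | A \<in> Pow X \<and> P A. h A)"
    by (rule sum.group) (use assms in \<open>auto simp: card_mono\<close>)
  then show ?thesis by (simp add: conj_assoc)
qed

text \<open>The probability that \<open>A\<close> is a cycle of a uniform permutation of \<open>X\<close>.\<close>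

definition wt :: "'a set \<Rightarrow> 'a set \<Rightarrow> real" where
  "wt X A = fact (card A - 1) * fact (card (X - A)) / fact (card X)"

lemma wt_pos: "0 < wt X A"
  by (simp add: wt_def)

lemma wt_nonneg: "0 \<le> wt X A"
  using wt_pos[of X A] by simp

lemma wt_eq:
  assumes "finite X" "A \<subseteq> X"
  shows "wt X A = fact (card A - 1) * fact (card X - card A) / fact (card X)"
  using assms by (simp add: wt_def card_Diff_subset finite_subset)

text \<open>The bracket is the probability that a given \<open>k\<close>-set is a cycle. So there
  are \<open>1 / k\<close> cycles of length \<open>k\<close> on average, and the cycle through a
  given point has uniform length.\<close>

lemma binomial_weight:
  assumes "1 \<le> k" "k \<le> N"
  shows "real (N choose k) * (fact (k - 1) * fact (N - k) / fact N) = 1 / real k"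
    and "real ((N - 1) choose (k - 1)) * (fact (k - 1) * fact (N - k) / fact N) = 1 / real N"
proof -
  have k: "fact k = real k * fact (k - 1)" using assms by (simp add: fact_reduce)
  have n: "fact N = real N * fact (N - 1)" using assms by (simp add: fact_reduce)
  show "real (N choose k) * (fact (k - 1) * fact (N - k) / fact N) = 1 / real k"
    using assms by (simp add: binomial_fact k)
  have "real ((N - 1) choose (k - 1)) = fact (N - 1) / (fact (k - 1) * fact (N - k))"
    using assms by (simp add: binomial_fact)
  then show "real ((N - 1) choose (k - 1)) * (fact (k - 1) * fact (N - k) / fact N) = 1 / real N"
    using assms by (simp add: n)
qed

lemma wt_sum_point:
  assumes "finite X" "x \<in> X" "1 \<le> k" "k \<le> card X"
  shows "(\<Sum>A | A \<in> Pow X \<and> x \<in> A \<and> card A = k. wt X A) = 1 / real (card X)"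
proof -
  have "(\<Sum>A | A \<in> Pow X \<and> x \<in> A \<and> card A = k. wt X A) =
     (\<Sum>A | A \<in> Pow X \<and> x \<in> A \<and> card A = k. fact (k - 1) * fact (card X - k) / fact (card X))"
    by (rule sum.cong) (use assms in \<open>auto simp: wt_eq\<close>)
  then show ?thesis
    using binomial_weight(2)[OF assms(3,4)] card_subsets_point[OF assms(1-3)] by simp
qed

lemma wt_sum_card:
  assumes "finite X" "1 \<le> k" "k \<le> card X"
  shows "(\<Sum>A | A \<in> Pow X \<and> card A = k. wt X A) = 1 / real k"
proof -
  have "(\<Sum>A | A \<in> Pow X \<and> card A = k. wt X A) =
     (\<Sum>A | A \<in> Pow X \<and> card A = k. fact (k - 1) * fact (card X - k) / fact (card X))"
    by (rule sum.cong) (use assms in \<open>auto simp: wt_eq\<close>)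
  then show ?thesis
    using binomial_weight(1)[OF assms(2,3)] card_subsets_card[OF assms(1)] by simp
qed

lemma sum_point_wt_by_card:
  assumes "finite X" "x \<in> X"
  shows "(\<Sum>A | A \<in> Pow X \<and> x \<in> A. wt X A * c (card A)) = (\<Sum>k = 1..card X. c k) / real (card X)"
proof -
  have "(\<Sum>A | A \<in> Pow X \<and> x \<in> A. wt X A * c (card A)) =
      (\<Sum>k\<le>card X. \<Sum>A | A \<in> Pow X \<and> x \<in> A \<and> card A = k. wt X A * c (card A))"
    by (rule sum_by_card[OF assms(1)])
  also have "\<dots> = (\<Sum>k\<in>{1..card X}. c k / real (card X))"
  proof (rule sum.mono_neutral_cong_right)
    show "\<forall>k\<in>{..card X} - {1..card X}. (\<Sum>A | A \<in> Pow X \<and> x \<in> A \<and> card A = k. wt X A * c (card A)) = 0"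
    proof
      fix k assume "k \<in> {..card X} - {1..card X}"
      then have k: "k = 0" by auto
      have "{A. A \<in> Pow X \<and> x \<in> A \<and> card A = k} = {}"
        unfolding k using assms(1) by (auto simp: card_eq_0_iff dest: finite_subset)
      then show "(\<Sum>A | A \<in> Pow X \<and> x \<in> A \<and> card A = k. wt X A * c (card A)) = 0"
        by (simp only: sum.empty)
    qed
    fix k assume k: "k \<in> {1..card X}"
    have "(\<Sum>A | A \<in> Pow X \<and> x \<in> A \<and> card A = k. wt X A * c (card A)) =
        (\<Sum>A | A \<in> Pow X \<and> x \<in> A \<and> card A = k. wt X A) * c k"
      unfolding sum_distrib_right by (rule sum.cong) auto
    then show "(\<Sum>A | A \<in> Pow X \<and> x \<in> A \<and> card A = k. wt X A * c (card A)) = c k / real (card X)"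
      using wt_sum_point[OF assms, of k] k by simp
  qed auto
  finally show ?thesis by (simp add: sum_divide_distrib)
qed

section \<open>Revealing a single block\<close>

lemma partition_block_at:
  assumes "partition_on X \<pi>" "x \<in> X"
  obtains A where "A \<in> \<pi>" "x \<in> A" "\<And>B. B \<in> \<pi> \<Longrightarrow> x \<in> B \<Longrightarrow> B = A"
proof -
  obtain A where A: "A \<in> \<pi>" "x \<in> A" using assms by (auto simp: partition_on_def)
  have "B = A" if "B \<in> \<pi>" "x \<in> B" for B
    using disjointD[of \<pi> A B] assms(1) A that by (auto simp: partition_on_def)
  then show thesis using that A by blast
qed

lemma sum_block_at:
  fixes h :: "'a set \<Rightarrow> real"
  assumes "partition_on X \<pi>" "finite X" "A \<in> \<pi>" "x \<in> A"
  shows "(\<Sum>B\<in>\<pi>. if x \<in> B then h B else 0) = h A"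
proof -
  have x: "x \<in> X" using assms by (auto simp: partition_on_def)
  have "x \<in> B \<longleftrightarrow> B = A" if "B \<in> \<pi>" for B
    using partition_block_at[OF assms(1) x] that assms(3,4) by metis
  then have "(\<Sum>B\<in>\<pi>. if x \<in> B then h B else 0) = (\<Sum>B\<in>\<pi>. if B = A then h B else 0)"
    by (intro sum.cong refl) simp
  also have "\<dots> = h A" using assms finite_elements[OF assms(2,1)] by simp
  finally show ?thesis .
qed

text \<open>\<open>EP_split\<close> is applied to \<open>f\<close> extended by zero to collections
  \<open>T\<close> that are not singletons. The probability that \<open>U\<close> is a single cycle
  stays symbolic, because this identity is what determines it next.\<close>

lemma EP_block_sum_aux:
  assumes fin: "finite X"
  shows "EP X (\<lambda>\<pi>. \<Sum>A\<in>\<pi>. f A (\<pi> - {A})) =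
    (\<Sum>U\<in>Pow X. fact (card U) * fact (card (X - U)) / fact (card X) *
       (EP U (\<lambda>T. of_bool (T = {U})) * EP (X - U) (f U)))"
proof -
  define f' where "f' = (\<lambda>T R. if is_singleton T then f (the_elem T) R else 0)"
  have 1: "(\<Sum>A\<in>\<pi>. f A (\<pi> - {A})) = (\<Sum>T\<in>Pow \<pi>. f' T (\<pi> - T))" if "partition_on X \<pi>" for \<pi>
  proof -
    have fp: "finite \<pi>" using finite_elements[OF fin that] .
    have "(\<Sum>T\<in>Pow \<pi>. f' T (\<pi> - T)) = (\<Sum>T\<in>(\<lambda>A. {A}) ` \<pi>. f' T (\<pi> - T))"
      by (rule sum.mono_neutral_right) (use fp in \<open>auto simp: f'_def is_singleton_def\<close>)
    also have "\<dots> = (\<Sum>A\<in>\<pi>. f A (\<pi> - {A}))"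
      by (subst sum.reindex) (auto simp: f'_def inj_on_def)
    finally show ?thesis by simp
  qed
  have 2: "EP U (\<lambda>T. EP (X - U) (f' T)) = EP U (\<lambda>T. of_bool (T = {U})) * EP (X - U) (f U)"
    if "U \<subseteq> X" for U
  proof -
    have fU: "finite U" using that fin finite_subset by blast
    have "EP U (\<lambda>T. EP (X - U) (f' T)) = EP U (\<lambda>T. EP (X - U) (f U) * of_bool (T = {U}))"
    proof (rule EP_cong[OF fU])
      fix T assume T: "partition_on U T"
      show "EP (X - U) (f' T) = EP (X - U) (f U) * of_bool (T = {U})"
      proof (cases "is_singleton T")
        case True
        then obtain A where A: "T = {A}" by (auto simp: is_singleton_def)
        then have "A = U" using T by (auto simp: partition_on_def)
        then show ?thesis using A by (simp add: f'_def)
      next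
        case False
        then have "T \<noteq> {U}" by (auto simp: is_singleton_def)
        then show ?thesis using False fin by (simp add: f'_def EP_const)
      qed
    qed
    then show ?thesis unfolding EP_cmult by (simp only: mult.commute)
  qed
  have "EP X (\<lambda>\<pi>. \<Sum>A\<in>\<pi>. f A (\<pi> - {A})) = EP X (\<lambda>\<pi>. \<Sum>T\<in>Pow \<pi>. f' T (\<pi> - T))"
    by (rule EP_cong[OF fin 1])
  also have "\<dots> = (\<Sum>U\<in>Pow X. fact (card U) * fact (card (X - U)) / fact (card X) *
      EP U (\<lambda>T. EP (X - U) (f' T)))" by (rule EP_split[OF fin])
  also have "\<dots> = (\<Sum>U\<in>Pow X. fact (card U) * fact (card (X - U)) / fact (card X) *
       (EP U (\<lambda>T. of_bool (T = {U})) * EP (X - U) (f U)))"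
    by (rule sum.cong) (use 2 in auto)
  finally show ?thesis .
qed

text \<open>Double counting the block that contains a fixed point determines this probability by
  induction on the size of \<open>U\<close>.\<close>

lemma EP_one_block:
  assumes "finite U" "U \<noteq> {}"
  shows "EP U (\<lambda>T. of_bool (T = {U})) = 1 / real (card U)"
  using assms
proof (induction "card U" arbitrary: U rule: less_induct)
  case less
  obtain x where x: "x \<in> U" using less.prems by blast
  let ?N = "card U"
  let ?c = "\<lambda>A. EP A (\<lambda>T. of_bool (T = {A}))"
  have N: "1 \<le> ?N" using less.prems by (simp add: Suc_leI card_gt_0_iff)
  have "1 = EP U (\<lambda>\<pi>. \<Sum>A\<in>\<pi>. if x \<in> A then 1 else (0::real))"
  proof -
    have "EP U (\<lambda>\<pi>. \<Sum>A\<in>\<pi>. if x \<in> A then 1 else (0::real)) = EP U (\<lambda>_. 1)"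
    proof (rule EP_cong[OF less.prems(1)])
      fix \<pi> assume p: "partition_on U \<pi>"
      obtain A where "A \<in> \<pi>" "x \<in> A" using partition_block_at[OF p x] by metis
      then show "(\<Sum>A\<in>\<pi>. if x \<in> A then 1 else 0) = (1::real)"
        using sum_block_at[OF p less.prems(1), of A x "\<lambda>_. 1"] by simp
    qed
    then show ?thesis using less.prems by (simp add: EP_const)
  qed
  also have "\<dots> = (\<Sum>A\<in>Pow U. fact (card A) * fact (card (U - A)) / fact ?N *
       (?c A * EP (U - A) (\<lambda>R. if x \<in> A then 1 else 0)))"
    by (rule EP_block_sum_aux[OF less.prems(1), of "\<lambda>A R. if x \<in> A then 1 else 0"])
  also have "\<dots> = (\<Sum>A\<in>Pow U. if x \<in> A then fact (card A) * fact (card (U - A)) / fact ?N * ?c A else 0)"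
    by (rule sum.cong) (use less.prems(1) in \<open>auto simp: EP_const\<close>)
  also have "\<dots> = (\<Sum>A | A \<in> Pow U \<and> x \<in> A. fact (card A) * fact (card (U - A)) / fact ?N * ?c A)"
    using less.prems(1) by (simp add: sum.inter_filter[symmetric] Collect_conj_eq)
  also have "\<dots> = ?c U + (\<Sum>A | A \<in> Pow U \<and> x \<in> A \<and> A \<noteq> U. fact (card A) * fact (card (U - A)) / fact ?N * ?c A)"
  proof -
    have e: "{A. A \<in> Pow U \<and> x \<in> A} = insert U {A. A \<in> Pow U \<and> x \<in> A \<and> A \<noteq> U}" using x by auto
    show ?thesis unfolding e by (subst sum.insert) (use less.prems(1) in auto)
  qed
  also have "(\<Sum>A | A \<in> Pow U \<and> x \<in> A \<and> A \<noteq> U. fact (card A) * fact (card (U - A)) / fact ?N * ?c A) =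
      (\<Sum>A | A \<in> Pow U \<and> x \<in> A \<and> A \<noteq> U. wt U A)"
  proof (rule sum.cong)
    fix A assume A: "A \<in> {A. A \<in> Pow U \<and> x \<in> A \<and> A \<noteq> U}"
    then have "card A < ?N" using less.prems(1) by (auto intro: psubset_card_mono)
    moreover have "finite A" using A less.prems(1) finite_subset by blast
    ultimately have "?c A = 1 / real (card A)" using less.hyps[of A] A by auto
    moreover have "fact (card A) = real (card A) * fact (card A - 1)" "card A > 0"
    proof -
      show "card A > 0" using A \<open>finite A\<close> by (auto simp: card_gt_0_iff)
      then show "fact (card A) = real (card A) * fact (card A - 1)" by (simp add: fact_reduce)
    qed
    ultimately show "fact (card A) * fact (card (U - A)) / fact ?N * ?c A = wt U A"
      by (simp add: wt_def)
  qed simp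
  \<comment> \<open>By pure counting the weights \<open>wt U A\<close> of all \<open>A\<close>
    containing \<open>x\<close> sum to 1, and \<open>wt U U\<close> is \<open>1 / card U\<close>. By
    induction the proper subsets already carry their true probability, which forces the value for
    \<open>U\<close>.\<close>
  also have "\<dots> = 1 - 1 / real ?N"
  proof -
    have e: "{A. A \<in> Pow U \<and> x \<in> A} = insert U {A. A \<in> Pow U \<and> x \<in> A \<and> A \<noteq> U}" using x by auto
    have "wt U U + (\<Sum>A | A \<in> Pow U \<and> x \<in> A \<and> A \<noteq> U. wt U A) = (\<Sum>A | A \<in> Pow U \<and> x \<in> A. wt U A)"
      unfolding e by (subst sum.insert) (use less.prems(1) in auto)
    also have "\<dots> = 1"
      using sum_point_wt_by_card[OF less.prems(1) x, of "\<lambda>_. 1"] N by simp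
    finally have s: "wt U U + (\<Sum>A | A \<in> Pow U \<and> x \<in> A \<and> A \<noteq> U. wt U A) = 1" .
    have "(fact ?N :: real) = real ?N * fact (?N - 1)" using N by (simp add: fact_reduce)
    then have "wt U U = 1 / real ?N" by (simp add: wt_def)
    then show ?thesis using s by linarith
  qed
  finally show ?case by simp
qed

text \<open>A Mecke-type formula: given that \<open>A\<close> is a cycle, the other blocks form the
  cycle partition of a uniform permutation of \<open>X - A\<close>. The first moment estimates below
  rest on it.\<close>

lemma EP_block_sum:
  assumes fin: "finite X"
  shows "EP X (\<lambda>\<pi>. \<Sum>A\<in>\<pi>. f A (\<pi> - {A})) = (\<Sum>A\<in>Pow X - {{}}. wt X A * EP (X - A) (f A))"
proof -
  have "EP X (\<lambda>\<pi>. \<Sum>A\<in>\<pi>. f A (\<pi> - {A})) =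
    (\<Sum>U\<in>Pow X. fact (card U) * fact (card (X - U)) / fact (card X) *
       (EP U (\<lambda>T. of_bool (T = {U})) * EP (X - U) (f U)))" by (rule EP_block_sum_aux[OF fin])
  also have "\<dots> = (\<Sum>U\<in>Pow X - {{}}. wt X U * EP (X - U) (f U))"
  proof (rule sum.mono_neutral_cong_right)
    show "\<forall>U\<in>Pow X - (Pow X - {{}}). fact (card U) * fact (card (X - U)) / fact (card X) *
       (EP U (\<lambda>T. of_bool (T = {U})) * EP (X - U) (f U)) = 0" by (auto simp: EP_empty)
    fix U assume "U \<in> Pow X - {{}}"
    then have U: "finite U" "U \<noteq> {}" using fin finite_subset by auto
    then have "card U > 0" by (simp add: card_gt_0_iff)
    then have "fact (card U) = real (card U) * fact (card U - 1)" by (simp add: fact_reduce)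
    then show "fact (card U) * fact (card (X - U)) / fact (card X) *
       (EP U (\<lambda>T. of_bool (T = {U})) * EP (X - U) (f U)) = wt X U * EP (X - U) (f U)"
      using \<open>card U > 0\<close> by (simp add: EP_one_block[OF U] wt_def)
  qed (use fin in auto)
  finally show ?thesis .
qed

text \<open>Specialising the block sum to the unique block through \<open>x\<close> gives a
  recursion on the ground set, which serves as the induction step below.\<close>

lemma EP_point:
  assumes fin: "finite X" and x: "x \<in> X"
  shows "EP X F = (\<Sum>A | A \<in> Pow X \<and> x \<in> A. wt X A * EP (X - A) (\<lambda>R. F (insert A R)))"
proof -
  have "EP X F = EP X (\<lambda>\<pi>. \<Sum>A\<in>\<pi>. if x \<in> A then F (insert A (\<pi> - {A})) else 0)"
  proof (rule EP_cong[OF fin])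
    fix \<pi> assume p: "partition_on X \<pi>"
    obtain A where A: "A \<in> \<pi>" "x \<in> A" using partition_block_at[OF p x] by metis
    then show "F \<pi> = (\<Sum>A\<in>\<pi>. if x \<in> A then F (insert A (\<pi> - {A})) else 0)"
      using sum_block_at[OF p fin A, of "\<lambda>A. F (insert A (\<pi> - {A}))"] by (simp add: insert_absorb)
  qed
  also have "\<dots> = (\<Sum>A\<in>Pow X - {{}}. wt X A * EP (X - A) (\<lambda>R. if x \<in> A then F (insert A R) else 0))"
    by (rule EP_block_sum[OF fin])
  also have "\<dots> = (\<Sum>A | A \<in> Pow X \<and> x \<in> A. wt X A * EP (X - A) (\<lambda>R. F (insert A R)))"
    by (rule sum.mono_neutral_cong_right) (use fin in \<open>auto simp: EP_const\<close>)
  finally show ?thesis .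
qed

lemma sum_nonempty_by_card:
  fixes h :: "'a set \<Rightarrow> real"
  assumes "finite X"
  shows "(\<Sum>A\<in>Pow X - {{}}. h A) = (\<Sum>k = 1..card X. \<Sum>A | A \<in> Pow X \<and> card A = k. h A)"
proof -
  have "(\<Sum>k = 1..card X. \<Sum>A | A \<in> Pow X - {{}} \<and> card A = k. h A) = (\<Sum>A\<in>Pow X - {{}}. h A)"
    by (rule sum.group)
      (use assms in \<open>auto simp: card_mono Suc_le_eq card_gt_0_iff dest: finite_subset\<close>)
  moreover have "{A. A \<in> Pow X - {{}} \<and> card A = k} = {A. A \<in> Pow X \<and> card A = k}" if "1 \<le> k" for k
    using that by auto
  ultimately show ?thesis by simp
qed

lemma sum_wt_by_card:
  assumes "finite X"
  shows "(\<Sum>A\<in>Pow X - {{}}. wt X A * c (card A)) = (\<Sum>k = 1..card X. c k / real k)"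
  unfolding sum_nonempty_by_card[OF assms]
proof (rule sum.cong)
  fix k assume k: "k \<in> {1..card X}"
  have "(\<Sum>A | A \<in> Pow X \<and> card A = k. wt X A * c (card A)) =
      (\<Sum>A | A \<in> Pow X \<and> card A = k. wt X A) * c k"
    unfolding sum_distrib_right by (rule sum.cong) auto
  then show "(\<Sum>A | A \<in> Pow X \<and> card A = k. wt X A * c (card A)) = c k / real k"
    using wt_sum_card[OF assms, of k] k by simp
qed simp

lemma EP_point_le:
  assumes "finite X" "x \<in> X"
    and "\<And>A. A \<subseteq> X \<Longrightarrow> x \<in> A \<Longrightarrow> EP (X - A) (\<lambda>R. F (insert A R)) \<le> c (card A)"
  shows "EP X F \<le> (\<Sum>k = 1..card X. c k) / real (card X)"
  unfolding EP_point[OF assms(1,2)] sum_point_wt_by_card[OF assms(1,2), symmetric]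
  by (intro sum_mono mult_left_mono wt_nonneg) (use assms(3) in auto)

lemma EP_point_ge:
  assumes "finite X" "x \<in> X"
    and "\<And>A. A \<subseteq> X \<Longrightarrow> x \<in> A \<Longrightarrow> c (card A) \<le> EP (X - A) (\<lambda>R. F (insert A R))"
  shows "(\<Sum>k = 1..card X. c k) / real (card X) \<le> EP X F"
  unfolding EP_point[OF assms(1,2)] sum_point_wt_by_card[OF assms(1,2), symmetric]
  by (intro sum_mono mult_left_mono wt_nonneg) (use assms(3) in auto)

lemma EP_block_sum_le:
  assumes "finite X"
    and "\<And>A. A \<subseteq> X \<Longrightarrow> A \<noteq> {} \<Longrightarrow> EP (X - A) (f A) \<le> c (card A)"
  shows "EP X (\<lambda>\<pi>. \<Sum>A\<in>\<pi>. f A (\<pi> - {A})) \<le> (\<Sum>k = 1..card X. c k / real k)"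
  unfolding EP_block_sum[OF assms(1)] sum_wt_by_card[OF assms(1), symmetric]
  by (intro sum_mono mult_left_mono wt_nonneg) (use assms(2) in auto)

lemma EP_of_bool_le_block_sum:
  assumes "finite X" "\<And>A R. 0 \<le> f A R"
    and "\<And>\<pi>. partition_on X \<pi> \<Longrightarrow> P \<pi> \<Longrightarrow> \<exists>A\<in>\<pi>. 1 \<le> f A (\<pi> - {A})"
  shows "EP X (\<lambda>\<pi>. of_bool (P \<pi>)) \<le> EP X (\<lambda>\<pi>. \<Sum>A\<in>\<pi>. f A (\<pi> - {A}))"
proof (rule EP_mono[OF assms(1)])
  fix \<pi> assume p: "partition_on X \<pi>"
  have nn: "0 \<le> (\<Sum>A\<in>\<pi>. f A (\<pi> - {A}))" using assms(2) by (intro sum_nonneg)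
  show "of_bool (P \<pi>) \<le> (\<Sum>A\<in>\<pi>. f A (\<pi> - {A}))"
  proof (cases "P \<pi>")
    case True
    then obtain A where A: "A \<in> \<pi>" "1 \<le> f A (\<pi> - {A})" using assms(3)[OF p] by blast
    have "f A (\<pi> - {A}) \<le> (\<Sum>A\<in>\<pi>. f A (\<pi> - {A}))"
      by (rule member_le_sum[OF A(1)]) (use assms(2) finite_elements[OF assms(1) p] in auto)
    then show ?thesis using A True by simp
  qed (use nn in simp)
qed

lemma EP_cong_dom:
  assumes "finite X" "X = Y" "\<And>\<pi>. partition_on X \<pi> \<Longrightarrow> f \<pi> = g \<pi>"
  shows "EP X f = EP Y g"
  using EP_cong[OF assms(1,3)] assms(2) by simp

section \<open>Consistency under restriction and relabelling\<close>

definition restr :: "'a set \<Rightarrow> 'a set set \<Rightarrow> 'a set set" where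
  "restr B \<pi> = (\<lambda>A. A \<inter> B) ` \<pi> - {{}}"

text \<open>Reveal the block of some \<open>x\<close> in \<open>F\<close>. Its trace
  \<open>A\<close> on \<open>F\<close> comes either from the block \<open>A\<close>, with
  \<open>z\<close> left in the rest and removed there by induction, or from
  \<open>insert z A\<close>, where the rest no longer contains \<open>z\<close>. The two weights add
  up to \<open>wt F A\<close>.\<close>

lemma EP_restr_insert:
  assumes "finite F" "z \<notin> F"
  shows "EP (insert z F) (\<lambda>\<pi>. f (restr F \<pi>)) = EP F f"
  using assms
proof (induction "card F" arbitrary: F f rule: less_induct)
  case less
  show ?case
  proof (cases "F = {}")
    case True
    have "EP {z} (\<lambda>\<pi>. f (restr {} \<pi>)) = EP {z} (\<lambda>_. f {})"
    proof (rule EP_cong)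
      fix \<pi> :: "'a set set"
      have "restr {} \<pi> = {}" by (auto simp: restr_def)
      then show "f (restr {} \<pi>) = f {}" by simp
    qed simp
    then show ?thesis using True by (simp add: EP_const EP_empty)
  next
    case False
    then obtain x where x: "x \<in> F" by blast
    let ?X = "insert z F"
    let ?S = "{A. A \<in> Pow F \<and> x \<in> A}"
    have finS: "finite ?S" using less.prems(1) by simp
    have split: "{A. A \<in> Pow ?X \<and> x \<in> A} = ?S \<union> insert z ` ?S"
    proof
      show "{A. A \<in> Pow ?X \<and> x \<in> A} \<subseteq> ?S \<union> insert z ` ?S"
      proof
        fix A assume A: "A \<in> {A. A \<in> Pow ?X \<and> x \<in> A}"
        show "A \<in> ?S \<union> insert z ` ?S"
        proof (cases "z \<in> A")
          case True
          then have "A = insert z (A - {z})" "A - {z} \<in> ?S" using A x less.prems(2) by auto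
          then show ?thesis by blast
        qed (use A in auto)
      qed
    qed (use x in auto)
    have disj: "?S \<inter> insert z ` ?S = {}" using less.prems(2) by auto
    have inj: "inj_on (insert z) ?S" using less.prems(2) by (auto simp: inj_on_def)
    let ?g = "\<lambda>A. EP (F - A) (\<lambda>R. f (insert A R))"
    have 1: "EP (?X - A) (\<lambda>R. f (restr F (insert A R))) = ?g A" if A: "A \<in> ?S" for A
    proof -
      have eq: "?X - A = insert z (F - A)" using A less.prems(2) by auto
      have "EP (?X - A) (\<lambda>R. f (restr F (insert A R))) = EP (insert z (F - A)) (\<lambda>R. f (insert A (restr (F - A) R)))"
      proof (rule EP_cong_dom[OF _ eq])
        fix R assume R: "partition_on (?X - A) R"
        have "A \<inter> F = A" "A \<noteq> {}" using A by auto
        moreover have "B \<inter> F = B \<inter> (F - A)" if "B \<in> R" for B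
          using R that by (auto simp: partition_on_def)
        ultimately have "restr F (insert A R) = insert A (restr (F - A) R)"
          unfolding restr_def by (auto simp: image_iff)
        then show "f (restr F (insert A R)) = f (insert A (restr (F - A) R))" by simp
      qed (use less.prems in auto)
      also have "\<dots> = EP (F - A) (\<lambda>R. f (insert A R))"
        by (rule less.hyps) (use less.prems A x in \<open>auto intro!: psubset_card_mono\<close>)
      finally show ?thesis .
    qed
    have 2: "EP (?X - insert z A) (\<lambda>R. f (restr F (insert (insert z A) R))) = ?g A" if A: "A \<in> ?S" for A
    proof (rule EP_cong_dom)
      show "?X - insert z A = F - A" using A less.prems(2) by auto
      fix R assume R: "partition_on (?X - insert z A) R"
      have "insert z A \<inter> F = A" "A \<noteq> {}" using A less.prems(2) by auto
      moreover have "B \<inter> F = B" "B \<noteq> {}" if "B \<in> R" for B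
        using R that by (auto simp: partition_on_def)
      ultimately have "restr F (insert (insert z A) R) = insert A R"
        unfolding restr_def by (auto simp: image_iff)
      then show "f (restr F (insert (insert z A) R)) = f (insert A R)" by simp
    qed (use less.prems in auto)
    have w: "wt ?X A + wt ?X (insert z A) = wt F A" if A: "A \<in> ?S" for A
    proof -
      have fA: "finite A" using A less.prems(1) finite_subset by auto
      have zA: "z \<notin> A" using A less.prems(2) by auto
      have "card A > 0" using A fA by (auto simp: card_gt_0_iff)
      then have a: "card A = Suc (card A - 1)" by simp
      have le: "card A \<le> card F" using A less.prems(1) by (auto intro: card_mono)
      \<comment> \<open>With \<open>a' = card A - 1\<close> and \<open>b' = card F - card A\<close>,
        the two numerators add up to \<open>fact a' * fact b'\<close> times
        \<open>(b' + 1) + (a' + 1)\<close>, and this last sum is \<open>card F + 1\<close>.\<close>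
      obtain a' where a': "card A = Suc a'" using a by blast
      obtain b' where b': "card F = Suc a' + b'" using le a' by (metis le_Suc_ex)
      have "wt ?X A = fact a' * fact (Suc b') / fact (Suc (card F))"
        using A less.prems a' b' by (subst wt_eq) (auto simp: fA)
      moreover have "wt ?X (insert z A) = fact (Suc a') * fact b' / fact (Suc (card F))"
        using A less.prems a' b' zA by (subst wt_eq) (auto simp: fA)
      moreover have "wt F A = fact a' * fact b' / fact (card F)"
        using A less.prems a' b' by (subst wt_eq) auto
      moreover have "fact a' * fact (Suc b') + fact (Suc a') * fact b' = real (Suc (card F)) * (fact a' * fact b')"
        unfolding b' by (simp add: algebra_simps)
      moreover have "fact (Suc (card F)) = real (Suc (card F)) * (fact (card F) :: real)"
        by (rule fact_Suc)
      ultimately show ?thesis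
        by (simp only: add_divide_distrib[symmetric]) (simp del: of_nat_Suc)
    qed
    have "EP ?X (\<lambda>\<pi>. f (restr F \<pi>)) =
        (\<Sum>A | A \<in> Pow ?X \<and> x \<in> A. wt ?X A * EP (?X - A) (\<lambda>R. f (restr F (insert A R))))"
      by (rule EP_point) (use x less.prems in auto)
    also have "\<dots> = (\<Sum>A\<in>?S. wt ?X A * EP (?X - A) (\<lambda>R. f (restr F (insert A R)))) +
       (\<Sum>A\<in>insert z ` ?S. wt ?X A * EP (?X - A) (\<lambda>R. f (restr F (insert A R))))"
      unfolding split by (rule sum.union_disjoint) (use finS disj in auto)
    also have "\<dots> = (\<Sum>A\<in>?S. wt ?X A * ?g A) + (\<Sum>A\<in>?S. wt ?X (insert z A) * ?g A)"
      unfolding sum.reindex[OF inj] comp_def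
      by (intro arg_cong2[where f = "(+)"] sum.cong refl arg_cong2[where f = "(*)"] 1 2)
    also have "\<dots> = (\<Sum>A\<in>?S. wt F A * ?g A)"
      by (simp only: sum.distrib[symmetric] distrib_right[symmetric]) (intro sum.cong refl, simp only: w)
    also have "\<dots> = EP F f" by (rule EP_point[symmetric]) (use x less.prems in auto)
    finally show ?thesis .
  qed
qed

lemma EP_restr:
  assumes "finite X" "B \<subseteq> X"
  shows "EP X (\<lambda>\<pi>. f (restr B \<pi>)) = EP B f"
proof -
  have "EP (B \<union> C) (\<lambda>\<pi>. f (restr B \<pi>)) = EP B f" if "finite C" "finite B" "B \<inter> C = {}" for C
    using that
  proof (induction C rule: finite_induct)
    case empty
    have "EP B (\<lambda>\<pi>. f (restr B \<pi>)) = EP B f"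
    proof (rule EP_cong[OF empty(1)])
      fix \<pi> assume p: "partition_on B \<pi>"
      then have "A \<inter> B = A" "A \<noteq> {}" if "A \<in> \<pi>" for A using that by (auto simp: partition_on_def)
      then have "restr B \<pi> = \<pi>" unfolding restr_def by auto
      then show "f (restr B \<pi>) = f \<pi>" by simp
    qed
    then show ?case by simp
  next
    case (insert z C)
    have "EP (B \<union> insert z C) (\<lambda>\<pi>. f (restr B \<pi>)) =
        EP (insert z (B \<union> C)) (\<lambda>\<pi>. f (restr B (restr (B \<union> C) \<pi>)))"
    proof (rule EP_cong_dom)
      fix \<pi>
      have e: "A \<inter> (B \<union> C) \<inter> B = A \<inter> B" for A by blast
      have "restr B (restr (B \<union> C) \<pi>) = restr B \<pi>"
      proof
        show "restr B (restr (B \<union> C) \<pi>) \<subseteq> restr B \<pi>"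
          unfolding restr_def using e by auto
        show "restr B \<pi> \<subseteq> restr B (restr (B \<union> C) \<pi>)"
        proof
          fix S assume "S \<in> restr B \<pi>"
          then obtain A where A: "A \<in> \<pi>" "S = A \<inter> B" "S \<noteq> {}" unfolding restr_def by blast
          then have "A \<inter> (B \<union> C) \<in> restr (B \<union> C) \<pi>" "S = A \<inter> (B \<union> C) \<inter> B"
            unfolding restr_def by auto
          then show "S \<in> restr B (restr (B \<union> C) \<pi>)" unfolding restr_def[of B] using A(3) by blast
        qed
      qed
      then show "f (restr B \<pi>) = f (restr B (restr (B \<union> C) \<pi>))" by simp
    qed (use insert in auto)
    also have "\<dots> = EP (B \<union> C) (\<lambda>\<pi>. f (restr B \<pi>))"
      by (rule EP_restr_insert[of "B \<union> C" z "\<lambda>\<pi>. f (restr B \<pi>)"]) (use insert in auto)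
    finally show ?case using insert by auto
  qed
  from this[of "X - B"] show ?thesis using assms finite_subset[OF assms(2,1)] by (simp add: Un_absorb1)
qed

text \<open>Induction along \<open>EP_point\<close> reduces relabelling to the invariance of
  cardinalities, without conjugating permutations.\<close>

lemma EP_image:
  assumes "finite U" "inj_on g U"
  shows "EP (g ` U) F = EP U (\<lambda>\<pi>. F ((`) g ` \<pi>))"
  using assms
proof (induction "card U" arbitrary: U F rule: less_induct)
  case less
  show ?case
  proof (cases "U = {}")
    case False
    then obtain x where x: "x \<in> U" by blast
    have inj: "inj_on ((`) g) {A. A \<in> Pow U \<and> x \<in> A}"
      using inj_on_image_Pow[OF less.prems(2)] by (rule inj_on_subset) auto
    have im: "{A. A \<in> Pow (g ` U) \<and> g x \<in> A} = (`) g ` {A. A \<in> Pow U \<and> x \<in> A}"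
    proof
      show "{A. A \<in> Pow (g ` U) \<and> g x \<in> A} \<subseteq> (`) g ` {A. A \<in> Pow U \<and> x \<in> A}"
      proof
        fix A assume A: "A \<in> {A. A \<in> Pow (g ` U) \<and> g x \<in> A}"
        then have "A = g ` {u \<in> U. g u \<in> A}" by auto
        then show "A \<in> (`) g ` {A. A \<in> Pow U \<and> x \<in> A}" using A x by blast
      qed
    qed (use x in auto)
    have "EP (g ` U) F = (\<Sum>A | A \<in> Pow (g ` U) \<and> g x \<in> A. wt (g ` U) A * EP (g ` U - A) (\<lambda>R. F (insert A R)))"
      by (rule EP_point) (use x less.prems in auto)
    also have "\<dots> = (\<Sum>A | A \<in> Pow U \<and> x \<in> A. wt (g ` U) (g ` A) * EP (g ` U - g ` A) (\<lambda>R. F (insert (g ` A) R)))"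
      unfolding im by (rule sum.reindex[OF inj, unfolded comp_def])
    also have "\<dots> = (\<Sum>A | A \<in> Pow U \<and> x \<in> A. wt U A * EP (U - A) (\<lambda>R. F ((`) g ` insert A R)))"
    proof (rule sum.cong)
      fix A assume A: "A \<in> {A. A \<in> Pow U \<and> x \<in> A}"
      have d: "g ` U - g ` A = g ` (U - A)"
        using inj_on_image_set_diff[OF less.prems(2), of U A] A by auto
      have iA: "inj_on g A" "inj_on g (U - A)" using less.prems(2) A by (auto intro: inj_on_subset)
      have w: "wt (g ` U) (g ` A) = wt U A"
        unfolding wt_def d using less.prems(2) iA by (simp add: card_image)
      have "EP (g ` (U - A)) (\<lambda>R. F (insert (g ` A) R)) = EP (U - A) (\<lambda>R. F (insert (g ` A) ((`) g ` R)))"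
        by (rule less.hyps) (use less.prems A x iA in \<open>auto intro!: psubset_card_mono\<close>)
      then show "wt (g ` U) (g ` A) * EP (g ` U - g ` A) (\<lambda>R. F (insert (g ` A) R)) =
         wt U A * EP (U - A) (\<lambda>R. F ((`) g ` insert A R))"
        unfolding w d by simp
    qed simp
    also have "\<dots> = EP U (\<lambda>\<pi>. F ((`) g ` \<pi>))"
      by (rule EP_point[symmetric]) (use x less.prems in auto)
    finally show ?thesis .
  qed (simp add: EP_empty)
qed

text \<open>By consistency only the trace on \<open>insert p J\<close> matters. There the event says
  that \<open>p\<close> is a fixed point of a uniform permutation of \<open>card J + 1\<close>
  points.\<close>

lemma EP_block_avoids:
  assumes "finite X" "p \<in> X" "J \<subseteq> X" "p \<notin> J"
  shows "EP X (\<lambda>\<pi>. of_bool (\<forall>A\<in>\<pi>. p \<in> A \<longrightarrow> A \<inter> J = {})) = 1 / (real (card J) + 1)"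
proof -
  let ?B = "insert p J"
  have fJ: "finite J" using assms finite_subset by blast
  have "EP X (\<lambda>\<pi>. of_bool (\<forall>A\<in>\<pi>. p \<in> A \<longrightarrow> A \<inter> J = {})) = EP X (\<lambda>\<pi>. of_bool ({p} \<in> restr ?B \<pi>))"
  proof (rule EP_cong[OF assms(1)])
    fix \<pi> assume p: "partition_on X \<pi>"
    obtain A where A: "A \<in> \<pi>" "p \<in> A" "\<And>B. B \<in> \<pi> \<Longrightarrow> p \<in> B \<Longrightarrow> B = A"
      using partition_block_at[OF p assms(2)] by blast
    have "(\<forall>A\<in>\<pi>. p \<in> A \<longrightarrow> A \<inter> J = {}) \<longleftrightarrow> A \<inter> J = {}" using A by metis
    also have "\<dots> \<longleftrightarrow> A \<inter> ?B = {p}" using A(2) assms(4) by auto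
    also have "\<dots> \<longleftrightarrow> {p} \<in> restr ?B \<pi>"
    proof
      assume "A \<inter> ?B = {p}" then show "{p} \<in> restr ?B \<pi>"
        unfolding restr_def using A(1) by (auto intro!: image_eqI[of _ _ A])
    next
      assume "{p} \<in> restr ?B \<pi>"
      then obtain C where C: "C \<in> \<pi>" "{p} = C \<inter> ?B" unfolding restr_def by blast
      then have "C = A" by (intro A(3)) auto
      then show "A \<inter> ?B = {p}" using C by simp
    qed
    finally show "of_bool (\<forall>A\<in>\<pi>. p \<in> A \<longrightarrow> A \<inter> J = {}) = (of_bool ({p} \<in> restr ?B \<pi>) :: real)" by simp
  qed
  also have "\<dots> = EP ?B (\<lambda>\<pi>. of_bool ({p} \<in> \<pi>))" by (rule EP_restr) (use assms in auto)
  also have "\<dots> = (\<Sum>A | A \<in> Pow ?B \<and> p \<in> A. wt ?B A * EP (?B - A) (\<lambda>R. of_bool ({p} \<in> insert A R)))"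
    by (rule EP_point) (use fJ in auto)
  also have "\<dots> = (\<Sum>A | A \<in> Pow ?B \<and> p \<in> A. if A = {p} then wt ?B A else 0)"
  proof (rule sum.cong)
    fix A assume A: "A \<in> {A. A \<in> Pow ?B \<and> p \<in> A}"
    have "EP (?B - A) (\<lambda>R. of_bool ({p} \<in> insert A R)) = EP (?B - A) (\<lambda>R. of_bool (A = {p}))"
    proof (rule EP_cong)
      fix R assume "partition_on (?B - A) R"
      then have "{p} \<notin> R" using A by (auto simp: partition_on_def)
      then show "of_bool ({p} \<in> insert A R) = (of_bool (A = {p}) :: real)" by auto
    qed (use fJ in auto)
    then show "wt ?B A * EP (?B - A) (\<lambda>R. of_bool ({p} \<in> insert A R)) = (if A = {p} then wt ?B A else 0)"
      using fJ by (simp add: EP_const)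
  qed simp
  also have "\<dots> = wt ?B {p}" using fJ by (simp add: sum.delta)
  also have "\<dots> = 1 / (real (card J) + 1)"
    using fJ assms(4) by (simp add: wt_def)
  finally show ?thesis .
qed

text \<open>The same probability as a sum over the block of \<open>p\<close>, for use when the
  remaining blocks carry a further condition.\<close>

lemma sum_wt_avoids:
  assumes "finite X" "p \<in> X" "J \<subseteq> X" "p \<notin> J"
  shows "(\<Sum>A | A \<in> Pow X \<and> p \<in> A. wt X A * of_bool (A \<inter> J = {})) = 1 / (real (card J) + 1)"
proof -
  have "EP (X - A) (\<lambda>R. of_bool (\<forall>B\<in>insert A R. p \<in> B \<longrightarrow> B \<inter> J = {})) = of_bool (A \<inter> J = {})"
    if "p \<in> A" for A
  proof -
    have "EP (X - A) (\<lambda>R. of_bool (\<forall>B\<in>insert A R. p \<in> B \<longrightarrow> B \<inter> J = {})) = EP (X - A) (\<lambda>R. of_bool (A \<inter> J = {}))"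
      by (rule EP_cong) (use assms(1) that in \<open>auto simp: partition_on_def\<close>)
    then show ?thesis using assms(1) by (simp add: EP_const)
  qed
  then have "(\<Sum>A | A \<in> Pow X \<and> p \<in> A. wt X A * of_bool (A \<inter> J = {})) =
      EP X (\<lambda>\<pi>. of_bool (\<forall>A\<in>\<pi>. p \<in> A \<longrightarrow> A \<inter> J = {}))"
    by (subst EP_point[OF assms(1,2)]) (intro sum.cong refl, simp)
  then show ?thesis by (simp only: EP_block_avoids[OF assms])
qed

section \<open>Permutations with only long or only short cycles\<close>

abbreviation larger :: "nat \<Rightarrow> 'a set set \<Rightarrow> bool" where
  "larger K \<pi> \<equiv> \<forall>A\<in>\<pi>. K < card A"

lemma EP_larger_eq_0:
  assumes "finite X" "X \<noteq> {}" "card X \<le> K"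
  shows "EP X (\<lambda>\<pi>. of_bool (larger K \<pi>)) = 0"
proof -
  have "EP X (\<lambda>\<pi>. of_bool (larger K \<pi>)) = EP X (\<lambda>_. 0)"
  proof (rule EP_cong[OF assms(1)])
    fix \<pi> assume p: "partition_on X \<pi>"
    obtain x where "x \<in> X" using assms by blast
    then obtain A where A: "A \<in> \<pi>" "A \<subseteq> X" using p by (auto simp: partition_on_def)
    then have "card A \<le> K" using assms card_mono[OF assms(1) A(2)] by simp
    then have "\<not> larger K \<pi>" using A(1) by (meson not_less)
    then show "of_bool (larger K \<pi>) = (0::real)" by simp
  qed
  then show ?thesis using assms by (simp add: EP_const)
qed

lemma EP_larger_insert:
  assumes "finite X"
  shows "EP (X - A) (\<lambda>R. of_bool (larger K (insert A R))) = of_bool (K < card A) * EP (X - A) (\<lambda>R. of_bool (larger K R))"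
proof -
  have "EP (X - A) (\<lambda>R. of_bool (larger K (insert A R))) = EP (X - A) (\<lambda>R. of_bool (K < card A) * of_bool (larger K R))"
    by (rule EP_cong) (use assms in auto)
  then show ?thesis by (simp only: EP_cmult)
qed

text \<open>The cycle through \<open>x\<close> has uniform length \<open>k\<close>. Either it
  exhausts \<open>X\<close>, or both \<open>k\<close> and \<open>card X - k\<close> exceed
  \<open>K\<close>; the latter leaves \<open>card X - (2 * K + 1)\<close> lengths, a truncated
  difference that is 0 for small \<open>X\<close>.\<close>

lemma EP_larger_step:
  assumes X: "finite X" "K < card X"
    and IH: "\<And>Y. Y \<subset> X \<Longrightarrow> K < card Y \<Longrightarrow>
      l \<le> EP Y (\<lambda>\<pi>. of_bool (larger K \<pi>)) \<and> EP Y (\<lambda>\<pi>. of_bool (larger K \<pi>)) \<le> u"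
  shows "(1 + real (card X - (2 * K + 1)) * l) / real (card X) \<le> EP X (\<lambda>\<pi>. of_bool (larger K \<pi>))"
    and "EP X (\<lambda>\<pi>. of_bool (larger K \<pi>)) \<le> (1 + real (card X - (2 * K + 1)) * u) / real (card X)"
proof -
  let ?N = "card X"
  let ?c = "\<lambda>t k. if k = ?N then 1 else if K < k \<and> K < ?N - k then t else (0::real)"
  obtain x where x: "x \<in> X" using X(2) by fastforce
  have sum: "(\<Sum>k = 1..?N. ?c t k) = 1 + real (?N - (2 * K + 1)) * t" for t
  proof -
    have "{1..?N} = insert ?N {1..<?N}" using X(2) by auto
    then have "(\<Sum>k = 1..?N. ?c t k) = 1 + (\<Sum>k = 1..<?N. ?c t k)" by simp
    also have "(\<Sum>k = 1..<?N. ?c t k) = (\<Sum>k = K+1..<?N - K. t)"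
      by (rule sum.mono_neutral_cong_right) auto
    finally show ?thesis by (simp add: mult_2)
  qed
  have bound: "?c l (card A) \<le> EP (X - A) (\<lambda>R. of_bool (larger K (insert A R))) \<and>
      EP (X - A) (\<lambda>R. of_bool (larger K (insert A R))) \<le> ?c u (card A)"
    if A: "A \<subseteq> X" "x \<in> A" for A
  proof (cases "A = X")
    case True
    then show ?thesis using X by (simp add: EP_empty)
  next
    case False
    have lt: "card A < ?N" using A False X(1) by (auto intro: psubset_card_mono)
    have fd: "finite (X - A)" and ne: "X - A \<noteq> {}" using A False X(1) by auto
    have cd: "card (X - A) = ?N - card A"
      using A X(1) by (simp add: card_Diff_subset finite_subset)
    show ?thesis
    proof (cases "K < card (X - A)")
      case True
      then show ?thesis
        unfolding EP_larger_insert[OF X(1)] using IH[of "X - A"] A x cd lt by auto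
    next
      case F: False
      then show ?thesis
        unfolding EP_larger_insert[OF X(1)] using EP_larger_eq_0[OF fd ne, of K] cd lt by auto
    qed
  qed
  show "(1 + real (?N - (2 * K + 1)) * l) / real ?N \<le> EP X (\<lambda>\<pi>. of_bool (larger K \<pi>))"
    unfolding sum[symmetric] by (rule EP_point_ge[OF X(1) x]) (use bound in blast)
  show "EP X (\<lambda>\<pi>. of_bool (larger K \<pi>)) \<le> (1 + real (?N - (2 * K + 1)) * u) / real ?N"
    unfolding sum[symmetric] by (rule EP_point_le[OF X(1) x]) (use bound in blast)
qed

text \<open>Both bounds reproduce themselves under the recursion: with the truncated difference
  \<open>r = card X - (2 * K + 1)\<close> one has
  \<open>K + 1 + r \<le> card X \<le> 2 * K + 1 + r\<close>.\<close>

lemma EP_larger_bounds: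
  assumes "finite X" "K < card X"
  shows "1 / (2 * real K + 1) \<le> EP X (\<lambda>\<pi>. of_bool (larger K \<pi>)) \<and>
    EP X (\<lambda>\<pi>. of_bool (larger K \<pi>)) \<le> 1 / (real K + 1)"
  using assms
proof (induction "card X" arbitrary: X rule: less_induct)
  case less
  let ?N = "real (card X)"
  let ?r = "real (card X - (2 * K + 1))"
  have N: "?N \<ge> real K + 1" using less.prems by simp
  have "1 / (2 * real K + 1) \<le> EP Y (\<lambda>\<pi>. of_bool (larger K \<pi>)) \<and>
      EP Y (\<lambda>\<pi>. of_bool (larger K \<pi>)) \<le> 1 / (real K + 1)" if "Y \<subset> X" "K < card Y" for Y
    using that less by (auto intro!: less.hyps psubset_card_mono finite_subset[of Y X])
  note step = EP_larger_step[OF less.prems this]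
  have "1 / (2 * real K + 1) \<le> (1 + ?r * (1 / (2 * real K + 1))) / ?N"
  proof -
    have "?N \<le> 2 * real K + 1 + ?r" by linarith
    then have "?N / (2 * real K + 1) \<le> 1 + ?r * (1 / (2 * real K + 1))" by (simp add: divide_simps)
    then show ?thesis using N by (simp add: le_divide_eq)
  qed
  moreover have "(1 + ?r * (1 / (real K + 1))) / ?N \<le> 1 / (real K + 1)"
  proof -
    have "real K + 1 + ?r \<le> ?N" using N by linarith
    then have "1 + ?r * (1 / (real K + 1)) \<le> ?N / (real K + 1)" by (simp add: divide_simps)
    then show ?thesis using N by (simp add: divide_le_eq)
  qed
  ultimately show ?case using step by linarith
qed

lemma EP_larger_ge:
  assumes "finite X" "K < card X"
  shows "1 / (2 * real K + 1) \<le> EP X (\<lambda>\<pi>. of_bool (larger K \<pi>))"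
  using EP_larger_bounds[OF assms] by blast

lemma EP_larger_le:
  assumes "finite X" "X \<noteq> {}"
  shows "EP X (\<lambda>\<pi>. of_bool (larger K \<pi>)) \<le> 1 / (real K + 1)"
  using EP_larger_bounds[OF assms(1), of K] EP_larger_eq_0[OF assms, of K] by (cases "K < card X") auto

text \<open>When the revealed block \<open>A\<close> of \<open>p\<close> misses \<open>J\<close>,
  the nonempty set \<open>J\<close> stays in the rest, which then has no short cycle with
  probability at most \<open>1 / (K + 1)\<close>, whatever \<open>A\<close> is. Hence the two bounds
  multiply.\<close>

lemma EP_larger_avoids_le:
  assumes "finite X" "p \<in> X" "J \<subseteq> X" "p \<notin> J" "J \<noteq> {}"
  shows "EP X (\<lambda>\<pi>. of_bool (larger K \<pi> \<and> (\<forall>A\<in>\<pi>. p \<in> A \<longrightarrow> A \<inter> J = {})))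
    \<le> 1 / (real K + 1) * (1 / (real (card J) + 1))"
proof -
  have "EP X (\<lambda>\<pi>. of_bool (larger K \<pi> \<and> (\<forall>A\<in>\<pi>. p \<in> A \<longrightarrow> A \<inter> J = {}))) =
     (\<Sum>A | A \<in> Pow X \<and> p \<in> A. wt X A * EP (X - A) (\<lambda>R. of_bool (larger K (insert A R) \<and>
        (\<forall>B\<in>insert A R. p \<in> B \<longrightarrow> B \<inter> J = {}))))"
    by (rule EP_point) (use assms in auto)
  also have "\<dots> \<le> (\<Sum>A | A \<in> Pow X \<and> p \<in> A. wt X A * (1 / (real K + 1) * of_bool (A \<inter> J = {})))"
  proof (intro sum_mono mult_left_mono wt_nonneg)
    fix A assume A: "A \<in> {A. A \<in> Pow X \<and> p \<in> A}"
    show "EP (X - A) (\<lambda>R. of_bool (larger K (insert A R) \<and> (\<forall>B\<in>insert A R. p \<in> B \<longrightarrow> B \<inter> J = {})))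
      \<le> 1 / (real K + 1) * of_bool (A \<inter> J = {})"
    proof (cases "A \<inter> J = {}")
      case True
      have "EP (X - A) (\<lambda>R. of_bool (larger K (insert A R) \<and> (\<forall>B\<in>insert A R. p \<in> B \<longrightarrow> B \<inter> J = {})))
        \<le> EP (X - A) (\<lambda>R. of_bool (larger K R))"
        by (rule EP_mono) (use assms in auto)
      also have "\<dots> \<le> 1 / (real K + 1)"
        by (rule EP_larger_le) (use assms True in auto)
      finally show ?thesis using True by simp
    next
      case False
      have "EP (X - A) (\<lambda>R. of_bool (larger K (insert A R) \<and> (\<forall>B\<in>insert A R. p \<in> B \<longrightarrow> B \<inter> J = {})))
        \<le> 0"
        by (rule EP_le_const) (use assms A False in auto)
      then show ?thesis using False by simp
    qed
  qed
  also have "\<dots> = 1 / (real K + 1) * (\<Sum>A | A \<in> Pow X \<and> p \<in> A. wt X A * of_bool (A \<inter> J = {}))"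
    by (simp add: sum_distrib_left mult_ac)
  also have "\<dots> = 1 / (real K + 1) * (1 / (real (card J) + 1))"
    by (simp only: sum_wt_avoids[OF assms(1-4)])
  finally show ?thesis .
qed

text \<open>Revealing the block of \<open>x\<close>, of size \<open>k \<le> K\<close>, multiplies
  the induction hypothesis by \<open>2 * 2^k / card U\<close>; summed over \<open>k\<close> this is
  at most 1 once \<open>card U\<close> reaches \<open>2^(K + 2)\<close>. Below that size the trivial
  bound \<open>2^(card U)\<close> suffices, and the constant is chosen to dominate
  \<open>4^(card U)\<close> there.\<close>

lemma EP_small_powers_le:
  assumes "finite U"
  shows "EP U (\<lambda>\<pi>. of_bool (\<forall>A\<in>\<pi>. card A \<le> K) * 2 ^ card \<pi>) \<le> 4 ^ 2 ^ (K + 2) / 2 ^ card U"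
  using assms
proof (induction "card U" arbitrary: U rule: less_induct)
  case less
  let ?N = "card U"
  let ?D = "4 ^ 2 ^ (K + 2) :: real"
  have fin: "finite U" by fact
  have ele: "finite \<pi>" if "partition_on U \<pi>" for \<pi> using finite_elements[OF fin that] .
  show ?case
  proof (cases "?N < 2 ^ (K + 2)")
    case True
    have "EP U (\<lambda>\<pi>. of_bool (\<forall>A\<in>\<pi>. card A \<le> K) * 2 ^ card \<pi>) \<le> 2 ^ ?N"
    proof (rule EP_le_const[OF fin])
      fix \<pi> assume p: "partition_on U \<pi>"
      have "card \<pi> = (\<Sum>A\<in>\<pi>. 1)" by simp
      also have "\<dots> \<le> (\<Sum>A\<in>\<pi>. card A)"
      proof (rule sum_mono)
        fix A assume "A \<in> \<pi>"
        then have "A \<noteq> {}" "A \<subseteq> U" using p by (auto simp: partition_on_def)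
        then show "1 \<le> card A" using finite_subset[OF _ fin] by (simp add: Suc_le_eq card_gt_0_iff)
      qed
      also have "\<dots> = card U" using sum.partition[OF fin p, of "\<lambda>_. 1::nat"] by simp
      finally have "card \<pi> \<le> card U" .
      then have "(2::real) ^ card \<pi> \<le> 2 ^ ?N" by (intro power_increasing) auto
      then show "of_bool (\<forall>A\<in>\<pi>. card A \<le> K) * 2 ^ card \<pi> \<le> (2::real) ^ ?N" by auto
    qed
    also have "(2::real) ^ ?N \<le> ?D / 2 ^ ?N"
    proof -
      have "(2::real) ^ ?N * 2 ^ ?N = 4 ^ ?N" by (simp flip: power_mult_distrib)
      also have "\<dots> \<le> ?D" using True by (intro power_increasing) auto
      finally show ?thesis by (simp add: field_simps)
    qed
    finally show ?thesis .
  next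
    case False
    then have "U \<noteq> {}" by auto
    then obtain x where x: "x \<in> U" by blast
    let ?c = "\<lambda>k. if k \<le> K then 2 * (?D / 2 ^ (?N - k)) else 0"
    have bound: "EP U (\<lambda>\<pi>. of_bool (\<forall>A\<in>\<pi>. card A \<le> K) * 2 ^ card \<pi>) \<le> (\<Sum>k = 1..?N. ?c k) / real ?N"
    proof (rule EP_point_le[OF fin x])
      fix A assume A: "A \<subseteq> U" "x \<in> A"
      have fA: "finite A" using A fin finite_subset by blast
      have cd: "card (U - A) = ?N - card A" using A fA by (simp add: card_Diff_subset)
      have lt: "card (U - A) < ?N" using A x fin by (intro psubset_card_mono) auto
      have "EP (U - A) (\<lambda>R. of_bool (\<forall>B\<in>insert A R. card B \<le> K) * 2 ^ card (insert A R)) =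
         EP (U - A) (\<lambda>R. (of_bool (card A \<le> K) * 2) * (of_bool (\<forall>B\<in>R. card B \<le> K) * 2 ^ card R))"
      proof (rule EP_cong)
        fix R assume R: "partition_on (U - A) R"
        have "A \<notin> R" using R A by (auto simp: partition_on_def)
        moreover have "finite R" using R fin finite_elements by blast
        ultimately show "of_bool (\<forall>B\<in>insert A R. card B \<le> K) * 2 ^ card (insert A R) =
          (of_bool (card A \<le> K) * 2) * (of_bool (\<forall>B\<in>R. card B \<le> K) * (2::real) ^ card R)" by auto
      qed (use fin in auto)
      also have "\<dots> = (of_bool (card A \<le> K) * 2) * EP (U - A) (\<lambda>R. of_bool (\<forall>B\<in>R. card B \<le> K) * 2 ^ card R)"
        by (rule EP_cmult)
      also have "\<dots> \<le> (of_bool (card A \<le> K) * 2) * (?D / 2 ^ card (U - A))"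
        by (intro mult_left_mono less.hyps lt) (use fin in auto)
      also have "\<dots> \<le> ?c (card A)" using cd by simp
      finally show "EP (U - A) (\<lambda>R. of_bool (\<forall>B\<in>insert A R. card B \<le> K) * 2 ^ card (insert A R)) \<le> ?c (card A)" .
    qed
    have "(\<Sum>k = 1..?N. ?c k) \<le> (\<Sum>k \<le> K. 2 * ?D / 2 ^ ?N * 2 ^ k)"
    proof -
      have "(\<Sum>k = 1..?N. ?c k) \<le> (\<Sum>k = 1..?N. if k \<in> {..K} then 2 * ?D / 2 ^ ?N * 2 ^ k else 0)"
        by (intro sum_mono) (auto simp: power_diff)
      also have "\<dots> = (\<Sum>k\<in>{1..?N} \<inter> {..K}. 2 * ?D / 2 ^ ?N * 2 ^ k)"
        by (rule sum.inter_restrict[symmetric]) simp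
      also have "\<dots> \<le> (\<Sum>k \<le> K. 2 * ?D / 2 ^ ?N * 2 ^ k)"
        by (rule sum_mono2) auto
      finally show ?thesis .
    qed
    also have "\<dots> = 2 * ?D / 2 ^ ?N * (2 ^ (K + 1) - 1)"
    proof -
      have "(\<Sum>k \<le> K. (2::real) ^ k) = 2 ^ (K + 1) - 1" by (induction K) auto
      then show ?thesis by (simp only: sum_distrib_left[symmetric])
    qed
    also have "\<dots> \<le> 2 * ?D / 2 ^ ?N * 2 ^ (K + 1)" by (intro mult_left_mono) auto
    also have "\<dots> = ?D / 2 ^ ?N * 2 ^ (K + 2)" by simp
    also have "\<dots> \<le> ?D / 2 ^ ?N * real ?N"
    proof (intro mult_left_mono)
      have "real (2 ^ (K + 2)) \<le> real ?N" using False by (intro of_nat_mono) simp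
      then show "(2::real) ^ (K + 2) \<le> real ?N" by simp
    qed simp
    finally have "(\<Sum>k = 1..?N. ?c k) / real ?N \<le> ?D / 2 ^ ?N * real ?N / real ?N"
      by (intro divide_right_mono) auto
    also have "\<dots> = ?D / 2 ^ ?N" using x fin by auto
    finally show ?thesis using bound by linarith
  qed
qed

section \<open>Pairings and broken pairs\<close>

definition adj :: "('a \<Rightarrow> 'a) \<Rightarrow> 'a set \<Rightarrow> 'a set \<Rightarrow> bool" where
  "adj \<alpha> u v \<longleftrightarrow> (\<exists>x\<in>u. \<alpha> x \<in> v)"

text \<open>For a vertex this is the degree without loops. Once the block \<open>U\<close> is
  revealed, its partners are \<open>brk \<alpha> U\<close> points of the complement, and another
  block is adjacent to \<open>U\<close> exactly when it meets this set.\<close>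

definition brk :: "('a \<Rightarrow> 'a) \<Rightarrow> 'a set \<Rightarrow> nat" where
  "brk \<alpha> U = card {x \<in> U. \<alpha> x \<notin> U}"

text \<open>Distance at least three in the graph with vertex set \<open>\<pi>\<close>.\<close>

definition far :: "('a \<Rightarrow> 'a) \<Rightarrow> 'a set set \<Rightarrow> 'a set \<Rightarrow> 'a set \<Rightarrow> bool" where
  "far \<alpha> \<pi> u v \<longleftrightarrow> u \<noteq> v \<and> \<not> adj \<alpha> u v \<and> (\<forall>w\<in>\<pi>. \<not> (adj \<alpha> u w \<and> adj \<alpha> w v))"

text \<open>The ratio is the probability that a uniform \<open>k\<close>-subset of \<open>N\<close>
  points contains one given point and misses another.\<close>

lemma binomial_ratio2:
  assumes "1 \<le> k" "k < N"
  shows "real ((N - 2) choose (k - 1)) = real (N choose k) * (real k * (real N - real k) / (real N * (real N - 1)))"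
proof -
  obtain a where a: "k = Suc a" using assms by (metis Suc_le_D One_nat_def)
  obtain b where b: "N = a + b + 2" using assms a by (metis add_2_eq_Suc' add_Suc less_iff_Suc_add add.commute)
  have s: "N - 2 = a + b" "k - 1 = a" using a b by auto
  have pos: "(fact a :: real) > 0" "(fact b :: real) > 0" by simp_all
  have 1: "real ((N - 2) choose (k - 1)) = fact (a + b) / (fact a * fact b)"
    unfolding s by (simp add: binomial_fact)
  have "real (N choose k) = fact N / (fact k * fact (N - k))"
    using assms by (simp add: binomial_fact)
  also have "fact N = (real a + real b + 2) * (real a + real b + 1) * fact (a + b)"
    unfolding b by (simp add: algebra_simps)
  also have "(fact k :: real) = (real a + 1) * fact a" unfolding a by simp
  also have "(fact (N - k) :: real) = (real b + 1) * fact b"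
  proof -
    have "N - k = Suc b" using a b by simp
    then show ?thesis by simp
  qed
  finally have 2: "real (N choose k) =
    (real a + real b + 2) * (real a + real b + 1) * fact (a + b) / ((real a + 1) * fact a * ((real b + 1) * fact b))" .
  have 3: "real N - real k = real b + 1" "real k = real a + 1" "real N = real a + real b + 2" "real N - 1 = real a + real b + 1"
    using a b by auto
  have nz: "real a + 1 \<noteq> 0" "real b + 1 \<noteq> 0" "real a + real b + 1 \<noteq> 0" "real a + real b + 2 \<noteq> 0" by linarith+
  show ?thesis unfolding 1 2 unfolding 3 using nz pos by (simp add: divide_simps)
qed

text \<open>Here two given points lie inside and two others outside; the two-point ratio is applied
  twice.\<close>

lemma binomial_ratio4:
  assumes "2 \<le> k" "k + 2 \<le> N"
  shows "real ((N - 4) choose (k - 2)) = real (N choose k) *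
    (real k * (real k - 1) * (real N - real k) * (real N - real k - 1) / (real N * (real N - 1) * (real N - 2) * (real N - 3)))"
proof -
  have "real ((N - 4) choose (k - 2)) = real (((N - 2) - 2) choose ((k - 1) - 1))"
    by (simp add: numeral_eq_Suc)
  also have "\<dots> = real ((N - 2) choose (k - 1)) *
      (real (k - 1) * (real (N - 2) - real (k - 1)) / (real (N - 2) * (real (N - 2) - 1)))"
    by (rule binomial_ratio2) (use assms in auto)
  also have "real (k - 1) = real k - 1" using assms by auto
  also have "real (N - 2) = real N - 2" using assms by auto
  also have "real ((N - 2) choose (k - 1)) = real (N choose k) * (real k * (real N - real k) / (real N * (real N - 1)))"
    by (rule binomial_ratio2) (use assms in auto)
  finally show ?thesis by (simp add: algebra_simps)
qed

locale pairing =
  fixes X :: "'a set" and \<alpha> :: "'a \<Rightarrow> 'a"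
  assumes fin: "finite X" and inv: "\<alpha> (\<alpha> x) = x" and closed: "x \<in> X \<Longrightarrow> \<alpha> x \<in> X"
    and fpf: "x \<in> X \<Longrightarrow> \<alpha> x \<noteq> x"
begin

lemma inj_alpha: "inj_on \<alpha> A"
  using inv by (metis inj_onI)

lemma adj_sym: "adj \<alpha> u v \<longleftrightarrow> adj \<alpha> v u"
  unfolding adj_def using inv by metis

lemma brk_le: "finite U \<Longrightarrow> brk \<alpha> U \<le> card U"
  unfolding brk_def by (auto intro: card_mono)

lemma brk_compl:
  assumes "A \<subseteq> X"
  shows "card {y \<in> X - A. \<alpha> y \<in> A} = brk \<alpha> A"
proof -
  have "{y \<in> X - A. \<alpha> y \<in> A} = \<alpha> ` {x \<in> A. \<alpha> x \<notin> A}"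
    using assms closed inv by (auto simp: image_iff) metis
  then show ?thesis unfolding brk_def using card_image[OF inj_alpha] by metis
qed

lemma adj_iff:
  assumes "A \<subseteq> X" "v \<subseteq> X - A"
  shows "adj \<alpha> A v \<longleftrightarrow> v \<inter> {y \<in> X - A. \<alpha> y \<in> A} \<noteq> {}"
proof
  assume "adj \<alpha> A v"
  then obtain x where "x \<in> A" "\<alpha> x \<in> v" unfolding adj_def by blast
  then have "\<alpha> x \<in> v \<inter> {y \<in> X - A. \<alpha> y \<in> A}" using assms inv by auto
  then show "v \<inter> {y \<in> X - A. \<alpha> y \<in> A} \<noteq> {}" by blast
next
  assume "v \<inter> {y \<in> X - A. \<alpha> y \<in> A} \<noteq> {}"
  then obtain y where "y \<in> v" "\<alpha> y \<in> A" by blast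
  then show "adj \<alpha> A v" unfolding adj_def using inv by metis
qed

lemma brk_as_sum:
  assumes "U \<subseteq> X"
  shows "real (brk \<alpha> U) = (\<Sum>x\<in>X. of_bool (x \<in> U \<and> \<alpha> x \<notin> U))"
proof -
  have "{x \<in> U. \<alpha> x \<notin> U} = {x \<in> X. x \<in> U \<and> \<alpha> x \<notin> U}" using assms by blast
  then show ?thesis unfolding brk_def using fin by (simp add: sum.If_cases of_bool_def Int_def)
qed

text \<open>After exchanging the sums, each half-edge is counted for the
  \<open>(card X - 2) choose (k - 1)\<close> sets that contain it and miss its partner.\<close>

lemma sum_brk:
  assumes "1 \<le> k" "k < card X"
  shows "(\<Sum>U | U \<in> Pow X \<and> card U = k. real (brk \<alpha> U)) =
    real (card X choose k) * (real k * (real (card X) - real k) / (real (card X) - 1))"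
proof -
  let ?N = "card X"
  have "(\<Sum>U | U \<in> Pow X \<and> card U = k. real (brk \<alpha> U)) =
     (\<Sum>U | U \<in> Pow X \<and> card U = k. \<Sum>x\<in>X. of_bool (x \<in> U \<and> \<alpha> x \<notin> U))"
    by (rule sum.cong) (auto simp: brk_as_sum)
  also have "\<dots> = (\<Sum>x\<in>X. \<Sum>U | U \<in> Pow X \<and> card U = k. of_bool (x \<in> U \<and> \<alpha> x \<notin> U))"
    by (rule sum.swap)
  also have "\<dots> = (\<Sum>x\<in>X. real ((?N - 2) choose (k - 1)))"
  proof (rule sum.cong)
    fix x assume x: "x \<in> X"
    have "(\<Sum>U | U \<in> Pow X \<and> card U = k. of_bool (x \<in> U \<and> \<alpha> x \<notin> U)) =
        real (card {U \<in> Pow X. {x} \<subseteq> U \<and> U \<inter> {\<alpha> x} = {} \<and> card U = k})"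
    proof -
      have "{U. U \<in> Pow X \<and> card U = k} \<inter> {U. x \<in> U \<and> \<alpha> x \<notin> U} =
         {U \<in> Pow X. {x} \<subseteq> U \<and> U \<inter> {\<alpha> x} = {} \<and> card U = k}" by auto
      then show ?thesis using fin by (subst sum_of_bool_eq) auto
    qed
    also have "\<dots> = real ((?N - 2) choose (k - 1))"
      by (subst card_subsets_between) (use x closed fpf[OF x] fin assms in \<open>auto simp: numeral_2_eq_2\<close>)
    finally show "(\<Sum>U | U \<in> Pow X \<and> card U = k. of_bool (x \<in> U \<and> \<alpha> x \<notin> U)) = real ((?N - 2) choose (k - 1))" .
  qed simp
  also have "\<dots> = real ?N * real ((?N - 2) choose (k - 1))" by simp
  also have "\<dots> = real (?N choose k) * (real k * (real ?N - real k) / (real ?N - 1))"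
    unfolding binomial_ratio2[OF assms] using assms by (simp add: divide_simps)
  finally show ?thesis .
qed

text \<open>Among ordered pairs \<open>(x, y)\<close>, the choice \<open>y = x\<close> reproduces
  the first moment, \<open>y = \<alpha> x\<close> never counts, and each of the other
  \<open>card X - 2\<close> choices of \<open>y\<close> prescribes four distinct points, two inside
  \<open>U\<close> and two outside.\<close>

lemma sum_brk_square:
  assumes "1 \<le> k" "k < card X" "4 \<le> card X"
  shows "(\<Sum>U | U \<in> Pow X \<and> card U = k. (real (brk \<alpha> U))\<^sup>2) =
    real (card X choose k) * (real k * (real (card X) - real k) / (real (card X) - 1)) *
      (1 + (real k - 1) * (real (card X) - real k - 1) / (real (card X) - 3))"
proof -
  let ?N = "card X"
  let ?P = "\<lambda>x y U. x \<in> U \<and> \<alpha> x \<notin> U \<and> y \<in> U \<and> \<alpha> y \<notin> U"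
  \<comment> \<open>For \<open>k = 1\<close> the truncated \<open>k - 2\<close> would make the
    binomial coefficient 1, although no 1-subset contains two points.\<close>
  let ?b = "if 2 \<le> k then real ((?N - 4) choose (k - 2)) else 0"
  have cnt: "(\<Sum>U | U \<in> Pow X \<and> card U = k. of_bool (?P x y U)) = ?b"
    if x: "x \<in> X" and y: "y \<in> X - {x, \<alpha> x}" for x y
  proof -
    have ne: "x \<noteq> y" "\<alpha> x \<noteq> y" "x \<noteq> \<alpha> y" "\<alpha> x \<noteq> \<alpha> y" "\<alpha> x \<noteq> x" "\<alpha> y \<noteq> y"
      using x y fpf inv by (auto, metis+)
    have "{U \<in> {U. U \<in> Pow X \<and> card U = k}. ?P x y U} =
         {U \<in> Pow X. {x,y} \<subseteq> U \<and> U \<inter> {\<alpha> x, \<alpha> y} = {} \<and> card U = k}" by auto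
    then have "(\<Sum>U | U \<in> Pow X \<and> card U = k. of_bool (?P x y U)) =
        real (card {U \<in> Pow X. {x,y} \<subseteq> U \<and> U \<inter> {\<alpha> x, \<alpha> y} = {} \<and> card U = k})"
      using fin by (simp add: sum.If_cases of_bool_def Int_def conj_ac)
    also have "\<dots> = ?b"
    proof (cases "2 \<le> k")
      case True
      have "card {U \<in> Pow X. {x,y} \<subseteq> U \<and> U \<inter> {\<alpha> x, \<alpha> y} = {} \<and> card U = k} =
        (?N - card {x,y} - card {\<alpha> x, \<alpha> y}) choose (k - card {x,y})"
        by (rule card_subsets_between) (use x y ne closed fin True in auto)
      then show ?thesis using True ne by (simp add: numeral_eq_Suc)
    next
      case False
      have "{U \<in> Pow X. {x,y} \<subseteq> U \<and> U \<inter> {\<alpha> x, \<alpha> y} = {} \<and> card U = k} = {}"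
      proof (rule ccontr)
        assume "{U \<in> Pow X. {x,y} \<subseteq> U \<and> U \<inter> {\<alpha> x, \<alpha> y} = {} \<and> card U = k} \<noteq> {}"
        then obtain U where U: "U \<subseteq> X" "{x,y} \<subseteq> U" "card U = k" by blast
        have "card {x,y} \<le> card U" using U finite_subset[OF U(1) fin] by (intro card_mono)
        then show False using ne U False by simp
      qed
      then show ?thesis unfolding if_not_P[OF False] by (simp only: card.empty of_nat_0)
    qed
    finally show ?thesis .
  qed
  have "(\<Sum>U | U \<in> Pow X \<and> card U = k. (real (brk \<alpha> U))\<^sup>2) =
     (\<Sum>U | U \<in> Pow X \<and> card U = k. \<Sum>x\<in>X. \<Sum>y\<in>X. of_bool (?P x y U))"
    by (rule sum.cong) (auto simp: brk_as_sum power2_eq_square sum_product of_bool_conj[symmetric] conj_ac intro!: sum.cong)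
  also have "\<dots> = (\<Sum>x\<in>X. \<Sum>U | U \<in> Pow X \<and> card U = k. \<Sum>y\<in>X. of_bool (?P x y U))"
    by (rule sum.swap)
  also have "\<dots> = (\<Sum>x\<in>X. \<Sum>U | U \<in> Pow X \<and> card U = k. of_bool (x \<in> U \<and> \<alpha> x \<notin> U) + (\<Sum>y\<in>X - {x, \<alpha> x}. of_bool (?P x y U)))"
  proof (intro sum.cong refl)
    fix x U assume x: "x \<in> X"
    have "X = insert x (insert (\<alpha> x) (X - {x, \<alpha> x}))" using x closed by auto
    then have "(\<Sum>y\<in>X. of_bool (?P x y U)) = (\<Sum>y\<in>insert x (insert (\<alpha> x) (X - {x, \<alpha> x})). (of_bool (?P x y U)::real))" by simp
    also have "\<dots> = of_bool (?P x x U) + (of_bool (?P x (\<alpha> x) U) + (\<Sum>y\<in>X - {x, \<alpha> x}. of_bool (?P x y U)))"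
      using fin fpf[OF x] by (subst sum.insert; simp) 
    finally show "(\<Sum>y\<in>X. of_bool (?P x y U)) = of_bool (x \<in> U \<and> \<alpha> x \<notin> U) + (\<Sum>y\<in>X - {x, \<alpha> x}. (of_bool (?P x y U)::real))"
      by auto
  qed
  also have "\<dots> = (\<Sum>x\<in>X. \<Sum>U | U \<in> Pow X \<and> card U = k. of_bool (x \<in> U \<and> \<alpha> x \<notin> U)) +
     (\<Sum>x\<in>X. \<Sum>U | U \<in> Pow X \<and> card U = k. \<Sum>y\<in>X - {x, \<alpha> x}. of_bool (?P x y U))"
    by (simp only: sum.distrib)
  also have "(\<Sum>x\<in>X. \<Sum>U | U \<in> Pow X \<and> card U = k. of_bool (x \<in> U \<and> \<alpha> x \<notin> U)) =
     (\<Sum>U | U \<in> Pow X \<and> card U = k. real (brk \<alpha> U))"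
    by (subst sum.swap) (rule sum.cong, auto simp: brk_as_sum)
  also have "(\<Sum>x\<in>X. \<Sum>U | U \<in> Pow X \<and> card U = k. \<Sum>y\<in>X - {x, \<alpha> x}. of_bool (?P x y U)) =
     (\<Sum>x\<in>X. (real ?N - 2) * ?b)"
  proof (rule sum.cong)
    fix x assume x: "x \<in> X"
    have "(\<Sum>U | U \<in> Pow X \<and> card U = k. \<Sum>y\<in>X - {x, \<alpha> x}. of_bool (?P x y U)) =
      (\<Sum>y\<in>X - {x, \<alpha> x}. \<Sum>U | U \<in> Pow X \<and> card U = k. of_bool (?P x y U))" by (rule sum.swap)
    also have "\<dots> = (\<Sum>y\<in>X - {x, \<alpha> x}. ?b)" by (rule sum.cong[OF refl]) (rule cnt[OF x])
    also have "\<dots> = real (card (X - {x, \<alpha> x})) * ?b" by simp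
    also have "card (X - {x, \<alpha> x}) = ?N - 2"
      using fin x closed[OF x] fpf[OF x] by (subst card_Diff_subset) (auto simp: numeral_2_eq_2)
    also have "real (?N - 2) = real ?N - 2" using assms by auto
    finally show "(\<Sum>U | U \<in> Pow X \<and> card U = k. \<Sum>y\<in>X - {x, \<alpha> x}. of_bool (?P x y U)) = (real ?N - 2) * ?b" .
  qed simp
  also have "(\<Sum>x\<in>X. (real ?N - 2) * ?b) = real ?N * (real ?N - 2) * ?b" by simp
  also have "real ?N * (real ?N - 2) * ?b = real (?N choose k) * (real k * (real ?N - real k) / (real ?N - 1)) *
      ((real k - 1) * (real ?N - real k - 1) / (real ?N - 3))"
  proof (cases "2 \<le> k \<and> k + 2 \<le> ?N")
    case True
    then have b: "?b = real ((?N - 4) choose (k - 2))" by simp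
    have "real ?N \<ge> 4" using assms(3) by simp
    then show ?thesis unfolding b using True by (subst binomial_ratio4) (auto simp: divide_simps)
  next
    case False
    then consider "k = 1" | "Suc k = ?N" "2 \<le> k" using assms by linarith
    then show ?thesis
    proof cases
      case 2
      then have "?N - 4 < k - 2" using assms by linarith
      then have "?b = 0" by (simp add: binomial_eq_0)
      moreover have "real ?N - real k - 1 = 0" using 2 by linarith
      ultimately show ?thesis by simp
    qed simp
  qed
  finally show ?thesis unfolding sum_brk[OF assms(1,2)] by (simp only: distrib_left mult_1_right)
qed

text \<open>Chebyshev: the mean \<open>\<mu>\<close> of \<open>brk\<close> over \<open>k\<close>-subsets dominates its variance, and
  \<open>1 / (j + 1)\<close> is at most \<open>2 / \<mu>\<close> unless \<open>j\<close> deviates from \<open>\<mu>\<close> by at least \<open>\<mu> / 2\<close>.\<close>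

lemma sum_inverse_brk:
  assumes "1 \<le> k" "k < card X" "4 \<le> card X"
  shows "(\<Sum>U | U \<in> Pow X \<and> card U = k. 1 / (real (brk \<alpha> U) + 1)) \<le>
    real (card X choose k) * (6 * (real (card X) - 1) / (real k * (real (card X) - real k)))"
proof -
  let ?N = "real (card X)"
  let ?C = "real (card X choose k)"
  let ?S = "{U. U \<in> Pow X \<and> card U = k}"
  define \<mu> where "\<mu> = real k * (?N - real k) / (?N - 1)"
  have N: "?N \<ge> 4" using assms(3) by simp
  have kN: "1 \<le> real k" "real k \<le> ?N - 1" using assms by auto
  have mu: "\<mu> > 0" unfolding \<mu>_def using kN N by simp
  have cS: "(\<Sum>U\<in>?S. c) = ?C * c" for c :: real
    by (simp only: sum_constant card_subsets_card[OF fin])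
  have le: "(real k - 1) * (?N - real k - 1) / (?N - 3) \<le> \<mu>"
  proof -
    \<comment> \<open>After clearing denominators, the comparison of variance and mean amounts to
      \<open>2 * k * (N - k) \<le> (N - 1)^2\<close>, which follows from the AM-GM
      inequality.\<close>
    have "4 * (real k * (?N - real k)) \<le> ?N\<^sup>2"
      using zero_le_power2[of "?N - 2 * real k"] by (simp add: power2_eq_square algebra_simps)
    moreover have "?N\<^sup>2 \<le> 2 * (?N - 1)\<^sup>2"
    proof -
      have "0 \<le> (?N - 4) * ?N + 2" using N by (intro add_nonneg_nonneg mult_nonneg_nonneg) auto
      then show ?thesis by (simp add: power2_eq_square algebra_simps)
    qed
    ultimately have "2 * (real k * (?N - real k)) \<le> (?N - 1)\<^sup>2" by linarith
    then have "(real k - 1) * (?N - real k - 1) * (?N - 1) \<le> real k * (?N - real k) * (?N - 3)"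
      by (simp add: power2_eq_square algebra_simps)
    then show ?thesis unfolding \<mu>_def using N by (simp add: divide_simps)
  qed
  have "(\<Sum>U\<in>?S. (real (brk \<alpha> U) - \<mu>)\<^sup>2) =
     (\<Sum>U\<in>?S. (real (brk \<alpha> U))\<^sup>2) - 2 * \<mu> * (\<Sum>U\<in>?S. real (brk \<alpha> U)) + (\<Sum>U\<in>?S. \<mu>\<^sup>2)"
    by (simp add: power2_diff sum.distrib sum_subtractf sum_distrib_left mult_ac)
  also have "\<dots> = ?C * \<mu> * (1 + (real k - 1) * (?N - real k - 1) / (?N - 3)) - 2 * \<mu> * (?C * \<mu>) + ?C * \<mu>\<^sup>2"
    unfolding cS sum_brk[OF assms(1,2)] sum_brk_square[OF assms] \<mu>_def ..
  also have "\<dots> = ?C * \<mu> * (1 + ((real k - 1) * (?N - real k - 1) / (?N - 3) - \<mu>))"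
    by (simp add: power2_eq_square algebra_simps)
  also have "\<dots> \<le> ?C * \<mu> * 1"
    by (intro mult_left_mono) (use le mu in auto)
  finally have var: "(\<Sum>U\<in>?S. (real (brk \<alpha> U) - \<mu>)\<^sup>2) \<le> ?C * \<mu>" by simp
  have "1 / (real j + 1) \<le> 2 / \<mu> + 4 / \<mu>\<^sup>2 * (real j - \<mu>)\<^sup>2" for j
  proof (cases "real j \<ge> \<mu> / 2")
    case True
    then have "1 / (real j + 1) \<le> 1 / (\<mu> / 2)" using mu by (intro divide_left_mono) auto
    then show ?thesis using mu by (simp add: add_increasing2)
  next
    case False
    then have "(\<mu> / 2)\<^sup>2 \<le> (\<mu> - real j)\<^sup>2" using mu by (intro power_mono) auto
    then have "\<mu>\<^sup>2 \<le> 4 * (real j - \<mu>)\<^sup>2" by (simp add: power2_commute power_divide)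
    then have "1 \<le> 4 / \<mu>\<^sup>2 * (real j - \<mu>)\<^sup>2" using mu by (simp add: divide_simps)
    moreover have "1 / (real j + 1) \<le> 1" by simp
    moreover have "0 \<le> 2 / \<mu>" using mu by simp
    ultimately show ?thesis by linarith
  qed
  then have "(\<Sum>U\<in>?S. 1 / (real (brk \<alpha> U) + 1)) \<le> (\<Sum>U\<in>?S. 2 / \<mu> + 4 / \<mu>\<^sup>2 * (real (brk \<alpha> U) - \<mu>)\<^sup>2)"
    by (intro sum_mono) auto
  also have "\<dots> = ?C * (2 / \<mu>) + 4 / \<mu>\<^sup>2 * (\<Sum>U\<in>?S. (real (brk \<alpha> U) - \<mu>)\<^sup>2)"
    by (simp only: sum.distrib cS sum_distrib_left)
  also have "\<dots> \<le> ?C * (2 / \<mu>) + 4 / \<mu>\<^sup>2 * (?C * \<mu>)"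
    using var by (intro add_left_mono mult_left_mono) auto
  also have "\<dots> = ?C * (6 / \<mu>)" using mu by (simp add: power2_eq_square field_simps)
  also have "6 / \<mu> = 6 * (?N - 1) / (real k * (?N - real k))" unfolding \<mu>_def by simp
  finally show ?thesis .
qed

lemma wt_card:
  assumes "A \<subseteq> X" "card A = k" "1 \<le> k"
  shows "wt X A = 1 / (real k * real (card X choose k))"
proof -
  have kN: "k \<le> card X" using assms fin card_mono by blast
  have "wt X A = real (card X choose k) * wt X A / real (card X choose k)" using kN by simp
  also have "real (card X choose k) * wt X A = 1 / real k"
    using binomial_weight(1)[OF assms(3) kN] wt_eq[OF fin assms(1)] assms(2) by simp
  finally show ?thesis by simp
qed

text \<open>The weights contribute the mean number \<open>1 / k\<close> of cycles of length
  \<open>k\<close>, and such a cycle typically has \<open>brk\<close> of order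
  \<open>k * (N - k) / N\<close> with \<open>N = card X\<close>. For \<open>k\<close> up to
  \<open>N / 2\<close> the bound has order \<open>1 / k^2\<close>, which makes sums over degrees
  converge.\<close>

lemma sum_wt_inverse_brk:
  assumes "1 \<le> k" "k < card X" "4 \<le> card X"
  shows "(\<Sum>U | U \<in> Pow X \<and> card U = k. wt X U * (1 / (real (brk \<alpha> U) + 1))) \<le>
    6 * (real (card X) - 1) / (real k * real k * (real (card X) - real k))"
proof -
  have pos: "real (card X choose k) > 0" using assms by simp
  have "(\<Sum>U | U \<in> Pow X \<and> card U = k. wt X U * (1 / (real (brk \<alpha> U) + 1))) =
    1 / (real k * real (card X choose k)) * (\<Sum>U | U \<in> Pow X \<and> card U = k. 1 / (real (brk \<alpha> U) + 1))"
    unfolding sum_distrib_left by (rule sum.cong) (use assms(1) in \<open>auto simp: wt_card\<close>)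
  also have "\<dots> \<le> 1 / (real k * real (card X choose k)) *
     (real (card X choose k) * (6 * (real (card X) - 1) / (real k * (real (card X) - real k))))"
    by (intro mult_left_mono sum_inverse_brk assms) simp
  also have "\<dots> = 6 * (real (card X) - 1) / (real k * real k * (real (card X) - real k))"
    using pos by simp
  finally show ?thesis .
qed

text \<open>\<open>k - brk \<alpha> U\<close> counts the half-edges of \<open>U\<close> whose
  partner is in \<open>U\<close>. It bounds the indicator that some edge lies inside
  \<open>U\<close> and, divided by \<open>k\<close>, the indicator that no edge leaves
  \<open>U\<close>; both uses occur below.\<close>

lemma sum_loops:
  assumes "1 \<le> k" "k \<le> card X" "2 \<le> card X"
  shows "(\<Sum>U | U \<in> Pow X \<and> card U = k. real k - real (brk \<alpha> U)) =
    real (card X choose k) * (real k * (real k - 1) / (real (card X) - 1))"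
proof (cases "k = card X")
  case True
  have e: "{U. U \<in> Pow X \<and> card U = k} = {X}"
    unfolding True using fin card_subset_eq by blast
  have "brk \<alpha> X = 0" unfolding brk_def using closed by (simp add: card_eq_0_iff)
  then show ?thesis unfolding e using True assms by (simp add: divide_simps)
next
  case False
  then have k: "k < card X" using assms by simp
  have cS: "(\<Sum>U | U \<in> Pow X \<and> card U = k. c) = real (card X choose k) * c" for c :: real
    by (simp only: sum_constant card_subsets_card[OF fin])
  show ?thesis
    unfolding sum_subtractf cS sum_brk[OF assms(1) k] using assms k by (simp add: divide_simps algebra_simps)
qed

lemma sum_wt_loops:
  assumes "1 \<le> k" "k \<le> card X" "2 \<le> card X"
  shows "(\<Sum>U | U \<in> Pow X \<and> card U = k. wt X U * (real k - real (brk \<alpha> U))) =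
    (real k - 1) / (real (card X) - 1)"
proof -
  have pos: "real (card X choose k) > 0" using assms by simp
  have "(\<Sum>U | U \<in> Pow X \<and> card U = k. wt X U * (real k - real (brk \<alpha> U))) =
    1 / (real k * real (card X choose k)) * (\<Sum>U | U \<in> Pow X \<and> card U = k. real k - real (brk \<alpha> U))"
    unfolding sum_distrib_left by (rule sum.cong) (use assms(1) in \<open>auto simp: wt_card\<close>)
  then show ?thesis unfolding sum_loops[OF assms] using pos assms by simp
qed

end

section \<open>First moment estimates for hubs and distant pairs\<close>

lemma sum_wt_le:
  assumes "finite X"
    and "\<And>k. 1 \<le> k \<Longrightarrow> k \<le> card X \<Longrightarrow> (\<Sum>A | A \<in> Pow X \<and> card A = k. wt X A * h A) \<le> m k"
  shows "(\<Sum>A\<in>Pow X - {{}}. wt X A * h A) \<le> (\<Sum>k = 1..card X. m k)"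
  unfolding sum_nonempty_by_card[OF assms(1)] by (rule sum_mono) (use assms(2) in auto)

lemma sum_of_bool_less_le:
  assumes "0 \<le> L"
  shows "(\<Sum>k = 1..n. of_bool (real k < L)) \<le> L"
proof -
  have "(\<Sum>k = 1..n. of_bool (real k < L)) = (\<Sum>k = 1..n. if k \<in> {k. real k < L} then 1 else 0 :: real)"
    by (rule sum.cong) auto
  also have "\<dots> = (\<Sum>k \<in> {1..n} \<inter> {k. real k < L}. 1 :: real)"
    by (rule sum.inter_restrict[symmetric]) simp
  also have "\<dots> = real (card ({1..n} \<inter> {k. real k < L}))" by simp
  also have "card ({1..n} \<inter> {k. real k < L}) \<le> card {1..nat \<lfloor>L\<rfloor>}"
    using assms by (intro card_mono) (auto simp: le_nat_floor)
  also have "real (card {1..nat \<lfloor>L\<rfloor>}) \<le> L" using assms by simp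
  finally show ?thesis by simp
qed

text \<open>The cycle of \<open>p\<close> has uniform length on \<open>1..card Y\<close>, and at
  most \<open>L\<close> of these lengths are below \<open>L\<close>.\<close>

lemma EP_block_size_less:
  assumes "finite Y" "p \<in> Y" "0 \<le> L"
  shows "EP Y (\<lambda>\<pi>. of_bool (\<forall>A\<in>\<pi>. p \<in> A \<longrightarrow> real (card A) < L)) \<le> L / real (card Y)"
proof -
  let ?c = "\<lambda>k. of_bool (real k < L) :: real"
  have "EP Y (\<lambda>\<pi>. of_bool (\<forall>A\<in>\<pi>. p \<in> A \<longrightarrow> real (card A) < L)) \<le> (\<Sum>k = 1..card Y. ?c k) / real (card Y)"
    by (rule EP_point_le[OF assms(1,2)], rule EP_le_const) (use assms in auto)
  also have "(\<Sum>k = 1..card Y. ?c k) \<le> L" by (rule sum_of_bool_less_le[OF assms(3)])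
  finally show ?thesis by (simp add: divide_right_mono)
qed

definition hubs_adj :: "('a \<Rightarrow> 'a) \<Rightarrow> real \<Rightarrow> 'a set set \<Rightarrow> bool" where
  "hubs_adj \<alpha> L \<pi> \<longleftrightarrow> (\<forall>u\<in>\<pi>. \<forall>v\<in>\<pi>. u \<noteq> v \<longrightarrow> L \<le> real (card u) \<longrightarrow> L \<le> real (card v) \<longrightarrow> adj \<alpha> u v)"

definition hubs_dominate :: "('a \<Rightarrow> 'a) \<Rightarrow> real \<Rightarrow> 'a set set \<Rightarrow> bool" where
  "hubs_dominate \<alpha> L \<pi> \<longleftrightarrow> (\<forall>u\<in>\<pi>. real (card u) < L \<longrightarrow> (\<exists>v\<in>\<pi>. L \<le> real (card v) \<and> adj \<alpha> u v))"

context pairing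
begin

text \<open>The common form of the two estimates in which missing the partners of \<open>A\<close>
  costs \<open>1 / (brk \<alpha> A + 1)\<close>. The condition \<open>g (card X) = 0\<close>
  discards \<open>A = X\<close>, where \<open>brk\<close> vanishes and the denominator on the right
  degenerates.\<close>

lemma EP_block_sum_brk_le:
  assumes "4 \<le> card X"
    and "\<And>A. A \<subseteq> X \<Longrightarrow> A \<noteq> {} \<Longrightarrow> EP (X - A) (f A) \<le> g (card A) / (real (brk \<alpha> A) + 1)"
    and "\<And>k. 0 \<le> g k" and "g (card X) = 0"
  shows "EP X (\<lambda>\<pi>. \<Sum>A\<in>\<pi>. f A (\<pi> - {A})) \<le>
    (\<Sum>k = 1..<card X. g k * (6 * (real (card X) - 1) / (real k * real k * (real (card X) - real k))))"
proof -
  let ?m = "\<lambda>k. g k * (6 * (real (card X) - 1) / (real k * real k * (real (card X) - real k)))"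
  have "EP X (\<lambda>\<pi>. \<Sum>A\<in>\<pi>. f A (\<pi> - {A})) = (\<Sum>A\<in>Pow X - {{}}. wt X A * EP (X - A) (f A))"
    by (rule EP_block_sum[OF fin])
  also have "\<dots> \<le> (\<Sum>A\<in>Pow X - {{}}. wt X A * (g (card A) / (real (brk \<alpha> A) + 1)))"
    by (intro sum_mono mult_left_mono wt_nonneg) (use assms(2) in auto)
  also have "\<dots> \<le> (\<Sum>k = 1..card X. ?m k)"
  proof (rule sum_wt_le[OF fin])
    fix k assume k: "1 \<le> k" "k \<le> card X"
    have "(\<Sum>A | A \<in> Pow X \<and> card A = k. wt X A * (g (card A) / (real (brk \<alpha> A) + 1))) =
       g k * (\<Sum>A | A \<in> Pow X \<and> card A = k. wt X A * (1 / (real (brk \<alpha> A) + 1)))"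
      unfolding sum_distrib_left by (rule sum.cong) auto
    also have "\<dots> \<le> ?m k"
    proof (cases "k = card X")
      case True
      then show ?thesis using assms(4) by simp
    next
      case False
      then show ?thesis using k assms(1,3) by (intro mult_left_mono sum_wt_inverse_brk) auto
    qed
    finally show "(\<Sum>A | A \<in> Pow X \<and> card A = k. wt X A * (g (card A) / (real (brk \<alpha> A) + 1))) \<le> ?m k" .
  qed
  also have "\<dots> = (\<Sum>k = 1..<card X. ?m k)"
    by (rule sum.mono_neutral_right) (use assms(4) in \<open>auto simp: not_less\<close>)
  finally show ?thesis .
qed

text \<open>Given a block \<open>A\<close>, a block of size at least \<open>L\<close> not adjacent to \<open>A\<close> contains at least \<open>L\<close>
  points whose blocks avoid the \<open>brk \<alpha> A\<close> partners of \<open>A\<close>; each point outside has this property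
  with probability \<open>1 / (brk \<alpha> A + 1)\<close>.\<close>

lemma EP_not_hubs_adj:
  assumes L: "0 < L" "2 * L \<le> real (card X)" and N4: "4 \<le> card X"
  shows "EP X (\<lambda>\<pi>. of_bool (\<not> hubs_adj \<alpha> L \<pi>)) \<le> 12 * (real (card X))\<^sup>2 / L ^ 3"
proof -
  let ?N = "real (card X)"
  define f where "f = (\<lambda>A R. of_bool (L \<le> card A \<and> (\<exists>v\<in>R. L \<le> card v \<and> \<not> adj \<alpha> A v)) :: real)"
  \<comment> \<open>If \<open>k > card X - L\<close>, there is no room for a second block of size
    \<open>L\<close>. The factor \<open>?N / L\<close> arises because a bad block has at least
    \<open>L\<close> points, each counted with weight \<open>1 / L\<close>, among at most
    \<open>card X\<close> points.\<close>
  define g where "g = (\<lambda>k. of_bool (L \<le> real k \<and> real k \<le> ?N - L) * (?N / L))"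
  have "EP X (\<lambda>\<pi>. of_bool (\<not> hubs_adj \<alpha> L \<pi>)) \<le> EP X (\<lambda>\<pi>. \<Sum>A\<in>\<pi>. f A (\<pi> - {A}))"
  proof (rule EP_of_bool_le_block_sum[OF fin])
    fix \<pi> assume "\<not> hubs_adj \<alpha> L \<pi>"
    then obtain u v where uv: "u \<in> \<pi>" "v \<in> \<pi>" "u \<noteq> v" "L \<le> card u" "L \<le> card v" "\<not> adj \<alpha> u v"
      unfolding hubs_adj_def by blast
    then have "\<exists>v\<in>\<pi> - {u}. L \<le> card v \<and> \<not> adj \<alpha> u v" by (intro bexI[of _ v]) auto
    then show "\<exists>A\<in>\<pi>. 1 \<le> f A (\<pi> - {A})" unfolding f_def using uv by (intro bexI[of _ u]) auto
  qed (simp add: f_def)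
  also have "\<dots> \<le> (\<Sum>k = 1..<card X. g k * (6 * (?N - 1) / (real k * real k * (?N - real k))))"
  proof (rule EP_block_sum_brk_le[OF N4])
    fix A assume A: "A \<subseteq> X" "A \<noteq> {}"
    let ?Y = "X - A"
    let ?J = "{y \<in> X - A. \<alpha> y \<in> A}"
    have fY: "finite ?Y" using fin by simp
    have cY: "real (card ?Y) = ?N - real (card A)"
      using A fin card_mono[OF fin A(1)] by (simp add: card_Diff_subset finite_subset of_nat_diff)
    show "EP ?Y (f A) \<le> g (card A) / (real (brk \<alpha> A) + 1)"
    proof (cases "L \<le> real (card A) \<and> real (card A) \<le> ?N - L")
      case False
      have "f A R \<le> 0" if R: "partition_on ?Y R" for R
      proof (rule ccontr)
        assume "\<not> f A R \<le> 0"
        then obtain v where v: "L \<le> real (card A)" "v \<in> R" "L \<le> real (card v)" unfolding f_def by (auto simp: not_le)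
        have "v \<subseteq> ?Y" using R v by (auto simp: partition_on_def)
        then have "card v \<le> card ?Y" using fY by (rule card_mono[rotated])
        then show False using v cY False by linarith
      qed
      then have "EP ?Y (f A) \<le> 0" by (rule EP_le_const[OF fY])
      then show ?thesis using False by (auto simp: g_def)
    next
      case True
      have "EP ?Y (f A) \<le> EP ?Y (\<lambda>R. \<Sum>q\<in>?Y - ?J. 1 / L * of_bool (\<forall>B\<in>R. q \<in> B \<longrightarrow> B \<inter> ?J = {}))"
      proof (rule EP_mono[OF fY])
        fix R assume R: "partition_on ?Y R"
        let ?ok = "\<lambda>q. \<forall>B\<in>R. q \<in> B \<longrightarrow> B \<inter> ?J = {}"
        show "f A R \<le> (\<Sum>q\<in>?Y - ?J. 1 / L * of_bool (?ok q))"
        proof (cases "\<exists>v\<in>R. L \<le> card v \<and> \<not> adj \<alpha> A v")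
          case False
          then show ?thesis using L by (auto simp: f_def intro!: sum_nonneg)
        next
          case True
          then obtain v where v: "v \<in> R" "L \<le> card v" "\<not> adj \<alpha> A v" by blast
          have vY: "v \<subseteq> ?Y" using R v by (auto simp: partition_on_def)
          have vJ: "v \<inter> ?J = {}" using adj_iff[OF A(1) vY] v by blast
          have ok: "?ok q" if "q \<in> v" for q
          proof (intro ballI impI)
            fix B assume "B \<in> R" "q \<in> B"
            then have "B = v" using disjointD[of R B v] R v(1) that by (auto simp: partition_on_def)
            then show "B \<inter> ?J = {}" using vJ by simp
          qed
          have "f A R \<le> 1 / L * L" using L by (simp add: f_def)
          also have "\<dots> \<le> 1 / L * real (card v)" using v L by (intro mult_left_mono) auto
          also have "\<dots> = (\<Sum>q\<in>v. 1 / L * of_bool (?ok q))" using ok by simp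
          also have "\<dots> \<le> (\<Sum>q\<in>?Y - ?J. 1 / L * of_bool (?ok q))"
            by (rule sum_mono2) (use fY vY vJ L in auto)
          finally show ?thesis .
        qed
      qed
      also have "\<dots> = (\<Sum>q\<in>?Y - ?J. 1 / L * EP ?Y (\<lambda>R. of_bool (\<forall>B\<in>R. q \<in> B \<longrightarrow> B \<inter> ?J = {})))"
        by (simp only: EP_sum EP_cmult)
      also have "\<dots> = (\<Sum>q\<in>?Y - ?J. 1 / L * (1 / (real (brk \<alpha> A) + 1)))"
      proof (rule sum.cong)
        fix q assume q: "q \<in> ?Y - ?J"
        have "EP ?Y (\<lambda>R. of_bool (\<forall>B\<in>R. q \<in> B \<longrightarrow> B \<inter> ?J = {})) = 1 / (real (card ?J) + 1)"
          by (rule EP_block_avoids) (use q fY in auto)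
        then show "1 / L * EP ?Y (\<lambda>R. of_bool (\<forall>B\<in>R. q \<in> B \<longrightarrow> B \<inter> ?J = {})) = 1 / L * (1 / (real (brk \<alpha> A) + 1))"
          by (simp only: brk_compl[OF A(1)])
      qed simp
      also have "\<dots> = real (card (?Y - ?J)) * (1 / L * (1 / (real (brk \<alpha> A) + 1)))"
        by (simp only: sum_constant)
      also have "\<dots> \<le> ?N * (1 / L * (1 / (real (brk \<alpha> A) + 1)))"
      proof (rule mult_right_mono)
        have "card (?Y - ?J) \<le> card X" using fin by (intro card_mono) auto
        then show "real (card (?Y - ?J)) \<le> ?N" by simp
      qed (use L in simp)
      finally show ?thesis using True by (simp add: g_def)
    qed
  next
    show "0 \<le> g k" for k using L by (simp add: g_def)
    show "g (card X) = 0" using L by (simp add: g_def)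
  qed
  also have "\<dots> \<le> (\<Sum>k = 1..<card X. 12 * ?N / L ^ 3)"
  proof (rule sum_mono)
    fix k assume k: "k \<in> {1..<card X}"
    show "g k * (6 * (?N - 1) / (real k * real k * (?N - real k))) \<le> 12 * ?N / L ^ 3"
    proof (cases "L \<le> real k \<and> real k \<le> ?N - L")
      case True
      \<comment> \<open>One of \<open>k\<close> and \<open>?N - k\<close> is at least
        \<open>?N / 2\<close>, the other at least \<open>L\<close>.\<close>
      have "L * (?N / 2) \<le> real k * (?N - real k)"
      proof (cases "real k \<le> ?N / 2")
        case True1: True
        have "L * (?N / 2) \<le> real k * (?N - real k)" by (rule mult_mono) (use True True1 L in auto)
        then show ?thesis .
      next
        case False
        have "(?N / 2) * L \<le> real k * (?N - real k)" using True False L by (intro mult_mono) auto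
        then show ?thesis by (simp add: mult.commute)
      qed
      then have "L * (L * (?N / 2)) \<le> real k * (real k * (?N - real k))"
        using True L by (intro mult_mono[of L "real k" "L * (?N / 2)"]) auto
      then have *: "L * L * ?N / 2 \<le> real k * real k * (?N - real k)" by (simp add: mult_ac)
      have "6 * (?N - 1) / (real k * real k * (?N - real k)) \<le> 6 * ?N / (L * L * ?N / 2)"
        using * L N4 by (intro frac_le) auto
      also have "\<dots> = 12 / (L * L)" using N4 L by (simp add: field_simps)
      finally have "g k * (6 * (?N - 1) / (real k * real k * (?N - real k))) \<le> ?N / L * (12 / (L * L))"
        using True L by (simp only: g_def of_bool_eq) (rule mult_mono, auto)
      then show ?thesis by (simp add: power3_eq_cube mult_ac)
    next
      case False
      then show ?thesis using L by (auto simp: g_def)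
    qed
  qed
  also have "\<dots> = real (card X - 1) * (12 * ?N / L ^ 3)" by simp
  also have "\<dots> \<le> ?N * (12 * ?N / L ^ 3)"
    using L by (intro mult_right_mono) auto
  finally show ?thesis by (simp add: power2_eq_square mult_ac)
qed

text \<open>First moment over non-hubs \<open>A\<close> of size \<open>k\<close>. If no edge leaves
  \<open>A\<close>, the indicator is bounded by \<open>(k - brk \<alpha> A) / k\<close>; averaging
  this over the fewer than or equal to \<open>L\<close> possible sizes gives the first term.
  Otherwise a single partner \<open>p\<close> outside \<open>A\<close> must lie in a cycle shorter
  than \<open>L\<close>, which has probability at most \<open>2 * L / card X\<close>, and the mean
  numbers \<open>1 / k\<close> of cycles add up to \<open>harm\<close>.\<close>

lemma EP_not_hubs_dominate:
  assumes L: "0 < L" "2 * L \<le> real (card X)" and N4: "4 \<le> card X"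
  shows "EP X (\<lambda>\<pi>. of_bool (\<not> hubs_dominate \<alpha> L \<pi>)) \<le>
    L / (real (card X) - 1) + 2 * L / real (card X) * harm (card X)"
proof -
  let ?N = "real (card X)"
  define f where "f = (\<lambda>A R. of_bool (card A < L \<and> (\<forall>v\<in>R. L \<le> card v \<longrightarrow> \<not> adj \<alpha> A v)) :: real)"
  have "EP X (\<lambda>\<pi>. of_bool (\<not> hubs_dominate \<alpha> L \<pi>)) \<le> EP X (\<lambda>\<pi>. \<Sum>A\<in>\<pi>. f A (\<pi> - {A}))"
  proof (rule EP_of_bool_le_block_sum[OF fin])
    fix \<pi> assume "\<not> hubs_dominate \<alpha> L \<pi>"
    then obtain u where "u \<in> \<pi>" "card u < L" "\<forall>v\<in>\<pi>. L \<le> card v \<longrightarrow> \<not> adj \<alpha> u v"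
      unfolding hubs_dominate_def by blast
    then show "\<exists>A\<in>\<pi>. 1 \<le> f A (\<pi> - {A})" unfolding f_def by (intro bexI[of _ u]) auto
  qed (simp add: f_def)
  also have "\<dots> = (\<Sum>A\<in>Pow X - {{}}. wt X A * EP (X - A) (f A))" by (rule EP_block_sum[OF fin])
  also have "\<dots> \<le> (\<Sum>k = 1..card X. of_bool (real k < L) * (1 / (?N - 1)) + 2 * L / ?N * (1 / real k))"
  proof (rule sum_wt_le[OF fin])
    fix k assume k: "1 \<le> k" "k \<le> card X"
    have "EP (X - A) (f A) \<le> of_bool (real k < L) * (1 / real k * (real k - real (brk \<alpha> A))) + 2 * L / ?N"
      if A: "A \<subseteq> X" "card A = k" for A
    proof -
      let ?Y = "X - A"
      have fY: "finite ?Y" using fin by simp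
      have fA: "finite A" using A fin finite_subset by blast
      have bk: "real (brk \<alpha> A) \<le> real k" using brk_le[OF fA] A by simp
      show ?thesis
      proof (cases "k < L")
        case False
        have "EP ?Y (f A) \<le> 0" by (rule EP_le_const[OF fY]) (use False A in \<open>auto simp: f_def\<close>)
        moreover have "0 \<le> 2 * L / ?N" using L by simp
        ultimately show ?thesis using False by simp
      next
        case kL: True
        show ?thesis
        proof (cases "brk \<alpha> A = 0")
          case True
          have "EP ?Y (f A) \<le> 1" by (rule EP_le_const[OF fY]) (auto simp: f_def)
          moreover have "1 / real k * (real k - real (brk \<alpha> A)) = 1" using True k by simp
          moreover have "0 \<le> 2 * L / ?N" using L by simp
          ultimately have "EP ?Y (f A) \<le> 1 * (1 / real k * (real k - real (brk \<alpha> A))) + 2 * L / ?N" by linarith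
          then show ?thesis using kL by (simp only: of_bool_eq)
        next
          case False
          then have "{y \<in> X - A. \<alpha> y \<in> A} \<noteq> {}"
            unfolding brk_compl[OF A(1), symmetric] by (metis card.empty)
          then obtain p where pp: "p \<in> ?Y" "\<alpha> p \<in> A" by blast
          have "EP ?Y (f A) \<le> EP ?Y (\<lambda>R. of_bool (\<forall>B\<in>R. p \<in> B \<longrightarrow> real (card B) < L))"
          proof (rule EP_mono[OF fY])
            fix R
            have "adj \<alpha> A B" if "p \<in> B" for B unfolding adj_def using pp that inv by metis
            then show "f A R \<le> of_bool (\<forall>B\<in>R. p \<in> B \<longrightarrow> real (card B) < L)"
              unfolding f_def by (auto simp: not_le)
          qed
          also have "\<dots> \<le> L / real (card ?Y)" by (rule EP_block_size_less) (use fY pp L in auto)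
          also have "\<dots> \<le> L / (?N / 2)"
          proof (rule divide_left_mono)
            have "real (card ?Y) = ?N - real k" using A fA k by (simp add: card_Diff_subset of_nat_diff)
            then show "?N / 2 \<le> real (card ?Y)" using kL L by linarith
            then show "0 < real (card ?Y) * (?N / 2)" using N4 by (intro mult_pos_pos) linarith+
          qed (use L in simp)
          also have "\<dots> = 2 * L / ?N" by simp
          finally have "EP ?Y (f A) \<le> 2 * L / ?N" .
          moreover have "0 \<le> of_bool (real k < L) * (1 / real k * (real k - real (brk \<alpha> A)))"
            using bk by simp
          ultimately show ?thesis by linarith
        qed
      qed
    qed
    then have "(\<Sum>A | A \<in> Pow X \<and> card A = k. wt X A * EP (X - A) (f A)) \<le>
      (\<Sum>A | A \<in> Pow X \<and> card A = k. wt X A * (of_bool (real k < L) * (1 / real k * (real k - real (brk \<alpha> A))) + 2 * L / ?N))"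
      by (intro sum_mono mult_left_mono wt_nonneg) auto
    also have "\<dots> = of_bool (real k < L) * (1 / real k) * (\<Sum>A | A \<in> Pow X \<and> card A = k. wt X A * (real k - real (brk \<alpha> A)))
       + 2 * L / ?N * (\<Sum>A | A \<in> Pow X \<and> card A = k. wt X A)"
      by (simp only: distrib_left sum.distrib sum_distrib_left mult_ac)
    also have "\<dots> = of_bool (real k < L) * (1 / real k * ((real k - 1) / (?N - 1))) + 2 * L / ?N * (1 / real k)"
      using k N4 by (subst sum_wt_loops; (subst wt_sum_card[OF fin])?; simp)
    also have "\<dots> \<le> of_bool (real k < L) * (1 / (?N - 1)) + 2 * L / ?N * (1 / real k)"
    proof (intro add_mono mult_left_mono)
      have "1 / real k * ((real k - 1) / (?N - 1)) = (real k - 1) / real k * (1 / (?N - 1))" by simp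
      also have "\<dots> \<le> 1 * (1 / (?N - 1))" using k N4 by (intro mult_right_mono) auto
      finally show "1 / real k * ((real k - 1) / (?N - 1)) \<le> 1 / (?N - 1)" by simp
    qed (use L in auto)
    finally show "(\<Sum>A | A \<in> Pow X \<and> card A = k. wt X A * EP (X - A) (f A)) \<le>
      of_bool (real k < L) * (1 / (?N - 1)) + 2 * L / ?N * (1 / real k)" .
  qed
  also have "\<dots> = (\<Sum>k = 1..card X. of_bool (real k < L)) * (1 / (?N - 1)) + 2 * L / ?N * harm (card X)"
    by (simp add: sum.distrib sum_distrib_left sum_distrib_right harm_def divide_inverse mult_ac)
  also have "\<dots> \<le> L * (1 / (?N - 1)) + 2 * L / ?N * harm (card X)"
  proof (intro add_mono mult_right_mono)
    show "(\<Sum>k = 1..card X. of_bool (real k < L)) \<le> L"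
      using L by (intro sum_of_bool_less_le) simp
  qed (use N4 in \<open>auto simp: harm_nonneg\<close>)
  finally show ?thesis by simp
qed

text \<open>The configuration responsible for a distant pair with a degree above \<open>K\<close>
  when the hub properties hold; \<open>v\<close> is the larger vertex. The separate threshold
  \<open>K0\<close> is taken as 0 when approximating the probability of diameter at most 2, and as
  \<open>K\<close> when bounding it from below.\<close>

definition far_pair :: "nat \<Rightarrow> nat \<Rightarrow> real \<Rightarrow> 'a set set \<Rightarrow> bool" where
  "far_pair K0 K L \<pi> \<longleftrightarrow> larger K0 \<pi> \<and> (\<exists>u\<in>\<pi>. \<exists>v\<in>\<pi>. far \<alpha> \<pi> u v \<and> card u \<le> card v \<and>
     K < card v \<and> real (card v) < L \<and> 0 < brk \<alpha> u \<and> 0 < brk \<alpha> v)"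

text \<open>Choose one half-edge of \<open>B\<close> that leaves \<open>B\<close>. Its partner lies
  outside \<open>A\<close>, and the block of this partner is a neighbour of \<open>B\<close>, so it
  must miss all partners of \<open>A\<close>. These lie outside \<open>B\<close> as well, so
  \<open>EP_larger_avoids_le\<close> applies.\<close>

lemma EP_far_rest:
  assumes A: "A \<subseteq> X" "0 < brk \<alpha> A" and B: "B \<subseteq> X - A" "0 < brk \<alpha> B" "\<not> adj \<alpha> B A"
  shows "EP (X - A - B) (\<lambda>R. of_bool (larger K0 R \<and> (\<forall>w\<in>R. \<not> (adj \<alpha> B w \<and> adj \<alpha> w A)))) \<le>
    1 / (real K0 + 1) * (1 / (real (brk \<alpha> A) + 1))"
proof -
  let ?Z = "X - A - B"
  let ?J = "{y \<in> X - A. \<alpha> y \<in> A}"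
  have fZ: "finite ?Z" using fin by simp
  have cJ: "card ?J = brk \<alpha> A" by (rule brk_compl[OF A(1)])
  have "{x \<in> B. \<alpha> x \<notin> B} \<noteq> {}" using B(2) unfolding brk_def by (metis card.empty less_irrefl)
  then obtain x where x: "x \<in> B" "\<alpha> x \<notin> B" by blast
  let ?p = "\<alpha> x"
  have pA: "?p \<notin> A" using B(3) x unfolding adj_def by blast
  have pZ: "?p \<in> ?Z" using x pA B(1) closed by auto
  have "\<alpha> ?p = x" by (rule inv)
  then have pJ: "?p \<notin> ?J" using x B(1) by auto
  have JZ: "?J \<subseteq> ?Z" using B(3) unfolding adj_def by auto
  have Jne: "?J \<noteq> {}" using A(2) cJ by (metis card.empty less_irrefl)
  have "EP ?Z (\<lambda>R. of_bool (larger K0 R \<and> (\<forall>w\<in>R. \<not> (adj \<alpha> B w \<and> adj \<alpha> w A)))) \<le>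
    EP ?Z (\<lambda>R. of_bool (larger K0 R \<and> (\<forall>w\<in>R. ?p \<in> w \<longrightarrow> w \<inter> ?J = {})))"
  proof (rule EP_mono[OF fZ])
    fix R
    have "w \<inter> ?J = {}" if w: "\<not> (adj \<alpha> B w \<and> adj \<alpha> w A)" "?p \<in> w" for w
    proof -
      have "adj \<alpha> B w" unfolding adj_def using x w by blast
      then show ?thesis using w unfolding adj_def by auto
    qed
    then show "of_bool (larger K0 R \<and> (\<forall>w\<in>R. \<not> (adj \<alpha> B w \<and> adj \<alpha> w A))) \<le>
      (of_bool (larger K0 R \<and> (\<forall>w\<in>R. ?p \<in> w \<longrightarrow> w \<inter> ?J = {})) :: real)"
      by auto
  qed
  also have "\<dots> \<le> 1 / (real K0 + 1) * (1 / (real (card ?J) + 1))"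
    by (rule EP_larger_avoids_le[OF fZ pZ JZ pJ Jne])
  finally show ?thesis by (simp only: cJ)
qed

text \<open>The larger vertex \<open>A\<close>, of size \<open>k\<close>, is revealed first and its
  \<open>brk\<close> supplies the factor from \<open>EP_far_rest\<close>. The smaller one has size
  \<open>j \<le> k\<close> with mean number \<open>1 / j\<close>, which sums to
  \<open>harm k\<close>. Since \<open>k < L\<close> is at most half of \<open>card X\<close>, the
  constant 6 of \<open>sum_wt_inverse_brk\<close> doubles to 12.\<close>

lemma EP_far_pair:
  assumes L: "0 < L" "2 * L \<le> real (card X)" and N4: "4 \<le> card X"
  shows "EP X (\<lambda>\<pi>. of_bool (far_pair K0 K L \<pi>)) \<le>
    1 / (real K0 + 1) * (\<Sum>k \<in> {K<..<card X}. 12 * harm k / (real k)\<^sup>2)"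
proof -
  let ?N = "real (card X)"
  define f2 where "f2 = (\<lambda>A B R. of_bool (\<not> adj \<alpha> B A \<and> 0 < brk \<alpha> B \<and> card B \<le> card A \<and>
      larger K0 R \<and> (\<forall>w\<in>R. \<not> (adj \<alpha> B w \<and> adj \<alpha> w A))) :: real)"
  define f where "f = (\<lambda>A R. of_bool (K < card A \<and> card A < L \<and> 0 < brk \<alpha> A) * (\<Sum>B\<in>R. f2 A B (R - {B})))"
  define g where "g = (\<lambda>k. of_bool (K < k \<and> real k < L) * (1 / (real K0 + 1) * harm k))"
  have "EP X (\<lambda>\<pi>. of_bool (far_pair K0 K L \<pi>)) \<le> EP X (\<lambda>\<pi>. \<Sum>A\<in>\<pi>. f A (\<pi> - {A}))"
  proof (rule EP_of_bool_le_block_sum[OF fin])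
    show "0 \<le> f A R" for A R unfolding f_def f2_def by (intro mult_nonneg_nonneg sum_nonneg) auto
    fix \<pi> assume p: "partition_on X \<pi>" and "far_pair K0 K L \<pi>"
    then obtain u v where uv: "larger K0 \<pi>" "u \<in> \<pi>" "v \<in> \<pi>" "far \<alpha> \<pi> u v" "card u \<le> card v"
      "K < card v" "card v < L" "0 < brk \<alpha> u" "0 < brk \<alpha> v"
      unfolding far_pair_def by blast
    have "1 = f2 v u (\<pi> - {v} - {u})" using uv unfolding f2_def far_def by auto
    also have "\<dots> \<le> (\<Sum>B\<in>\<pi> - {v}. f2 v B (\<pi> - {v} - {B}))"
      by (rule member_le_sum) (use uv finite_elements[OF fin p] in \<open>auto simp: f2_def far_def\<close>)
    finally show "\<exists>A\<in>\<pi>. 1 \<le> f A (\<pi> - {A})" using uv unfolding f_def by (intro bexI[of _ v]) auto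
  qed
  also have "\<dots> \<le> (\<Sum>k = 1..<card X. g k * (6 * (?N - 1) / (real k * real k * (?N - real k))))"
  proof (rule EP_block_sum_brk_le[OF N4])
    fix A assume A: "A \<subseteq> X" "A \<noteq> {}"
    let ?Y = "X - A"
    let ?P = "K < card A \<and> card A < L \<and> 0 < brk \<alpha> A"
    have fY: "finite ?Y" using fin by simp
    have "EP ?Y (f A) = of_bool ?P * EP ?Y (\<lambda>R. \<Sum>B\<in>R. f2 A B (R - {B}))"
      unfolding f_def by (rule EP_cmult)
    also have "\<dots> \<le> g (card A) / (real (brk \<alpha> A) + 1)"
    proof (cases ?P)
      case True
      let ?t = "1 / (real K0 + 1) * (1 / (real (brk \<alpha> A) + 1))"
      let ?c = "\<lambda>k. of_bool (k \<le> card A) * ?t"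
      have "EP ?Y (\<lambda>R. \<Sum>B\<in>R. f2 A B (R - {B})) \<le> (\<Sum>k = 1..card ?Y. ?c k / real k)"
      proof (rule EP_block_sum_le[OF fY])
        fix B assume B: "B \<subseteq> ?Y" "B \<noteq> {}"
        have fZ: "finite (?Y - B)" using fY by simp
        show "EP (?Y - B) (f2 A B) \<le> ?c (card B)"
        proof (cases "\<not> adj \<alpha> B A \<and> 0 < brk \<alpha> B \<and> card B \<le> card A")
          case False
          have "EP (?Y - B) (f2 A B) \<le> 0"
            by (rule EP_le_const[OF fZ]) (use False in \<open>auto simp: f2_def\<close>)
          then show ?thesis by (rule order_trans) simp
        next
          case True2: True
          have "EP (?Y - B) (f2 A B) \<le> ?t"
            using EP_far_rest[OF A(1) _ B(1), of K0] True True2 by (simp add: f2_def)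
          then show ?thesis using True2 by simp
        qed
      qed
      also have "\<dots> = (\<Sum>k\<in>{1..card ?Y} \<inter> {..card A}. ?t * (1 / real k))"
        by (subst sum.inter_restrict) (auto intro!: sum.cong)
      also have "\<dots> \<le> (\<Sum>k = 1..card A. ?t * (1 / real k))"
        by (rule sum_mono2) auto
      also have "\<dots> = ?t * harm (card A)"
        by (simp only: harm_def sum_distrib_left inverse_eq_divide)
      finally show ?thesis using True by (simp add: g_def)
    qed (auto simp: g_def harm_nonneg)
    finally show "EP ?Y (f A) \<le> g (card A) / (real (brk \<alpha> A) + 1)" .
  next
    show "0 \<le> g k" for k by (simp add: g_def harm_nonneg)
    show "g (card X) = 0" using L by (simp add: g_def)
  qed
  also have "\<dots> \<le> (\<Sum>k = 1..<card X. if k \<in> {K<..<card X} then 1 / (real K0 + 1) * (12 * harm k / (real k)\<^sup>2) else 0)"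
  proof (rule sum_mono)
    fix k assume k: "k \<in> {1..<card X}"
    show "g k * (6 * (?N - 1) / (real k * real k * (?N - real k))) \<le>
      (if k \<in> {K<..<card X} then 1 / (real K0 + 1) * (12 * harm k / (real k)\<^sup>2) else 0)"
    proof (cases "K < k \<and> real k < L")
      case True
      have "(?N - 1) / (?N - real k) \<le> 2"
      proof -
        have "?N - real k > 0" "?N - 1 \<le> 2 * (?N - real k)" using True L k by auto
        then show ?thesis by (simp add: divide_le_eq)
      qed
      then have "6 * ((?N - 1) / (?N - real k)) / (real k)\<^sup>2 \<le> 12 / (real k)\<^sup>2"
        by (intro divide_right_mono) (linarith, rule zero_le_power2)
      then have "6 * (?N - 1) / (real k * real k * (?N - real k)) \<le> 12 / (real k)\<^sup>2"
        by (simp add: power2_eq_square mult_ac)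
      then have "g k * (6 * (?N - 1) / (real k * real k * (?N - real k))) \<le> g k * (12 / (real k)\<^sup>2)"
        by (rule mult_left_mono) (simp add: g_def harm_nonneg)
      then show ?thesis using True k by (simp add: g_def mult_ac)
    next
      case False
      then have "g k = 0" by (auto simp: g_def)
      then show ?thesis by (simp add: harm_nonneg)
    qed
  qed
  also have "\<dots> = (\<Sum>k \<in> {1..<card X} \<inter> {K<..<card X}. 1 / (real K0 + 1) * (12 * harm k / (real k)\<^sup>2))"
    by (rule sum.inter_restrict[symmetric]) simp
  also have "{1..<card X} \<inter> {K<..<card X} = {K<..<card X}" by auto
  finally show ?thesis by (simp only: sum_distrib_left)
qed

end

section \<open>Limit law of the small vertices\<close>

text \<open>Moebius transform on the lattice of subsets. The sign
  \<open>(-1)^(card T - card S)\<close> is split into two factors to match the symmetric form of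
  inclusion-exclusion.\<close>

definition mobius :: "('b set \<Rightarrow> real) \<Rightarrow> 'b set \<Rightarrow> real" where
  "mobius h T = (-1) ^ card T * (\<Sum>S\<in>Pow T. (-1) ^ card S * h S)"

lemma sum_mobius:
  assumes "finite S"
  shows "(\<Sum>T\<in>Pow S. mobius h T) = h S"
  unfolding mobius_def
  by (rule inclusion_exclusion_symmetric[OF _ assms, symmetric]) simp

lemma mobius_cong:
  assumes "\<And>S. S \<subseteq> T \<Longrightarrow> h S = h' S"
  shows "mobius h T = mobius h' T"
  unfolding mobius_def using assms by (auto intro!: sum.cong)

lemma mobius_image:
  assumes "inj_on g T"
  shows "mobius h (g ` T) = mobius (\<lambda>S. h (g ` S)) T"
proof -
  have "(\<Sum>S\<in>Pow (g ` T). (-1) ^ card S * h S) = (\<Sum>S\<in>Pow T. (-1) ^ card (g ` S) * h (g ` S))"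
    unfolding image_Pow_surj[OF refl, symmetric]
    by (subst sum.reindex[OF inj_on_image_Pow[OF assms]]) simp
  also have "\<dots> = (\<Sum>S\<in>Pow T. (-1) ^ card S * h (g ` S))"
    by (intro sum.cong refl) (use assms in \<open>auto simp: card_image inj_on_subset\<close>)
  finally show ?thesis unfolding mobius_def using assms by (simp add: card_image)
qed

lemma abs_mobius_le:
  assumes "finite T" "\<And>S. \<bar>h S\<bar> \<le> 1"
  shows "\<bar>mobius h T\<bar> \<le> 2 ^ card T"
proof -
  have "\<bar>mobius h T\<bar> = \<bar>\<Sum>S\<in>Pow T. (-1) ^ card S * h S\<bar>"
    by (simp add: mobius_def abs_mult power_abs)
  also have "\<dots> \<le> (\<Sum>S\<in>Pow T. 1)"
    by (rule order_trans[OF sum_abs]) (intro sum_mono, simp add: abs_mult power_abs assms(2))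
  also have "\<dots> = 2 ^ card T" by (simp add: card_Pow assms(1))
  finally show ?thesis .
qed

text \<open>The limiting model: the half-edges of the small vertices form \<open>U\<close>, the partition \<open>T\<close> of \<open>U\<close>
  records the small vertices themselves and \<open>\<tau>\<close> records which half-edges lead to the same large
  vertex.\<close>

definition separated :: "'a set set \<Rightarrow> 'a set \<Rightarrow> 'a set \<Rightarrow> bool" where
  "separated \<tau> u v \<longleftrightarrow> u \<noteq> v \<and> (\<forall>w\<in>\<tau>. u \<inter> w = {} \<or> v \<inter> w = {})"

definition limit_weight :: "nat \<Rightarrow> 'a set set \<Rightarrow> 'a set set \<Rightarrow> real" where
  "limit_weight K \<tau> T = of_bool (\<forall>A\<in>T. card A \<le> K) *
     mobius (\<lambda>S. of_bool (\<forall>u\<in>S. \<forall>v\<in>S. \<not> separated \<tau> u v)) T"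

text \<open>\<open>T\<close> and \<open>\<tau>\<close> are independent: the small vertices partition
  \<open>U\<close>, while the remaining cycles partition the partners of \<open>U\<close>, and this
  second partition is carried back to \<open>U\<close> by \<open>\<alpha>\<close>.\<close>

definition limit_coeff :: "nat \<Rightarrow> 'a set \<Rightarrow> real" where
  "limit_coeff K U = EP U (\<lambda>T. EP U (\<lambda>\<tau>. limit_weight K \<tau> T))"

lemma separated_image:
  assumes "inj_on g U" "u \<subseteq> U" "v \<subseteq> U" "\<And>w. w \<in> \<tau> \<Longrightarrow> w \<subseteq> U"
  shows "separated ((`) g ` \<tau>) (g ` u) (g ` v) \<longleftrightarrow> separated \<tau> u v"
proof -
  have "g ` u = g ` v \<longleftrightarrow> u = v" using inj_on_image_eq_iff[OF assms(1-3)] .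
  moreover have "g ` a \<inter> g ` w = {} \<longleftrightarrow> a \<inter> w = {}" if "a \<subseteq> U" "w \<in> \<tau>" for a w
    using inj_on_image_Int[OF assms(1) that(1) assms(4)[OF that(2)]] by (metis image_is_empty)
  ultimately show ?thesis unfolding separated_def using assms(2,3) by auto
qed

lemma limit_weight_image:
  assumes g: "inj_on g U" and T: "partition_on U T" and t: "partition_on U \<tau>"
  shows "limit_weight K ((`) g ` \<tau>) ((`) g ` T) = limit_weight K \<tau> T"
proof -
  have sub: "A \<subseteq> U" if "A \<in> T" for A using T that by (auto simp: partition_on_def)
  have subt: "w \<subseteq> U" if "w \<in> \<tau>" for w using t that by (auto simp: partition_on_def)
  have inj: "inj_on ((`) g) T"
    using inj_on_image_Pow[OF g] by (rule inj_on_subset) (use sub in auto)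
  have cd: "card (g ` A) = card A" if "A \<in> T" for A
    using that sub g by (auto intro!: card_image intro: inj_on_subset)
  have "mobius (\<lambda>S. of_bool (\<forall>u\<in>S. \<forall>v\<in>S. \<not> separated ((`) g ` \<tau>) u v)) ((`) g ` T) =
     mobius (\<lambda>S. of_bool (\<forall>u\<in>S. \<forall>v\<in>S. \<not> separated \<tau> u v)) T"
    unfolding mobius_image[OF inj]
  proof (rule mobius_cong)
    fix S assume S: "S \<subseteq> T"
    have "separated ((`) g ` \<tau>) (g ` u) (g ` v) \<longleftrightarrow> separated \<tau> u v" if "u \<in> S" "v \<in> S" for u v
      using that S sub subt by (intro separated_image[OF g]) auto
    then show "of_bool (\<forall>u\<in>(`) g ` S. \<forall>v\<in>(`) g ` S. \<not> separated ((`) g ` \<tau>) u v) =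
      (of_bool (\<forall>u\<in>S. \<forall>v\<in>S. \<not> separated \<tau> u v) :: real)" by simp
  qed
  then show ?thesis unfolding limit_weight_def using cd by simp
qed

lemma limit_coeff_image:
  assumes "finite U" "inj_on g U"
  shows "limit_coeff K (g ` U) = limit_coeff K U"
proof -
  have "limit_coeff K (g ` U) = EP U (\<lambda>T. EP (g ` U) (\<lambda>\<tau>. limit_weight K \<tau> ((`) g ` T)))"
    unfolding limit_coeff_def by (rule EP_image[OF assms])
  also have "\<dots> = EP U (\<lambda>T. EP U (\<lambda>\<tau>. limit_weight K ((`) g ` \<tau>) ((`) g ` T)))"
    by (simp only: EP_image[OF assms])
  also have "\<dots> = limit_coeff K U"
    unfolding limit_coeff_def
    by (intro EP_cong assms(1) limit_weight_image[OF assms(2)])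
  finally show ?thesis .
qed

lemma limit_coeff_card:
  assumes "finite U"
  shows "limit_coeff K U = limit_coeff K {..<card U}"
proof -
  obtain g where "bij_betw g {..<card U} U"
    using ex_bij_betw_nat_finite[OF assms] by (auto simp: atLeast0LessThan)
  then show ?thesis using limit_coeff_image[of "{..<card U}" g K] by (simp add: bij_betw_def)
qed

lemma abs_EP_small_le:
  assumes "finite U" "\<And>T. partition_on U T \<Longrightarrow> \<bar>q T\<bar> \<le> of_bool (\<forall>A\<in>T. card A \<le> K) * 2 ^ card T"
  shows "\<bar>EP U q\<bar> \<le> 4 ^ 2 ^ (K + 2) / 2 ^ card U"
  by (rule order_trans[OF EP_abs order_trans[OF EP_mono[OF assms] EP_small_powers_le[OF assms(1)]]])

lemma abs_limit_coeff_le: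
  assumes "finite U"
  shows "\<bar>limit_coeff K U\<bar> \<le> 4 ^ 2 ^ (K + 2) / 2 ^ card U"
  unfolding limit_coeff_def
proof (rule abs_EP_small_le[OF assms])
  fix T assume T: "partition_on U T"
  have fT: "finite T" using finite_elements[OF assms T] .
  have "\<bar>limit_weight K \<tau> T\<bar> \<le> of_bool (\<forall>A\<in>T. card A \<le> K) * 2 ^ card T" for \<tau>
    unfolding limit_weight_def abs_mult
    by (intro mult_mono abs_mobius_le[OF fT]) auto
  then show "\<bar>EP U (\<lambda>\<tau>. limit_weight K \<tau> T)\<bar> \<le> of_bool (\<forall>A\<in>T. card A \<le> K) * 2 ^ card T"
    by (intro order_trans[OF EP_abs] EP_le_const[OF assms])
qed

text \<open>The full series has sum 6; writing out the remainder makes the identity provable by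
  induction.\<close>

lemma sum_squares_powers: "(\<Sum>s\<le>n. (real s)\<^sup>2 / 2 ^ s) \<le> 6"
proof -
  have "(\<Sum>s\<le>n. (real s)\<^sup>2 / 2 ^ s) = 6 - ((real n)\<^sup>2 + 4 * real n + 6) / 2 ^ n"
    by (induction n) (simp_all add: field_simps power2_eq_square)
  then show ?thesis by simp
qed

section \<open>Inclusion-exclusion over sets of small vertices\<close>

context pairing
begin

definition small_close :: "nat \<Rightarrow> 'a set set \<Rightarrow> bool" where
  "small_close K \<pi> \<longleftrightarrow> (\<forall>u\<in>\<pi>. \<forall>v\<in>\<pi>. card u \<le> K \<longrightarrow> card v \<le> K \<longrightarrow> \<not> far \<alpha> \<pi> u v)"

text \<open>When no edge lies inside \<open>U\<close>, blocks of \<open>T\<close> are adjacent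
  neither to each other nor to themselves. A common neighbour must be a block of \<open>R\<close>,
  and adjacency to it is visible on the trace of \<open>R\<close> on the partners of
  \<open>U\<close>.\<close>

lemma far_generic:
  assumes gen: "\<And>x. x \<in> U \<Longrightarrow> \<alpha> x \<notin> U" and T: "partition_on U T"
    and u: "u \<in> T" and v: "v \<in> T"
  shows "far \<alpha> (T \<union> R) u v \<longleftrightarrow> separated (restr (\<alpha> ` U) R) (\<alpha> ` u) (\<alpha> ` v)"
proof -
  have sub: "A \<subseteq> U" if "A \<in> T" for A using T that by (auto simp: partition_on_def)
  have no: "\<not> adj \<alpha> a b" if "a \<in> T" "b \<in> T" for a b
    unfolding adj_def using gen sub that by blast
  have e: "adj \<alpha> a w \<longleftrightarrow> \<alpha> ` a \<inter> (w \<inter> \<alpha> ` U) \<noteq> {}" if "a \<in> T" for a w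
    unfolding adj_def using sub[OF that] by blast
  have eq: "\<alpha> ` u = \<alpha> ` v \<longleftrightarrow> u = v" using inj_on_image_eq_iff[OF inj_alpha[of UNIV]] by blast
  have "far \<alpha> (T \<union> R) u v \<longleftrightarrow> u \<noteq> v \<and> (\<forall>w\<in>R. \<not> (adj \<alpha> u w \<and> adj \<alpha> v w))"
    unfolding far_def using no u v adj_sym by blast
  also have "\<dots> \<longleftrightarrow> u \<noteq> v \<and> (\<forall>w\<in>R. \<alpha> ` u \<inter> (w \<inter> \<alpha> ` U) = {} \<or> \<alpha> ` v \<inter> (w \<inter> \<alpha> ` U) = {})"
    by (simp only: e[OF u] e[OF v] de_Morgan_conj not_not)
  also have "\<dots> \<longleftrightarrow> u \<noteq> v \<and> (\<forall>w\<in>restr (\<alpha> ` U) R. \<alpha> ` u \<inter> w = {} \<or> \<alpha> ` v \<inter> w = {})"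
  proof -
    have "(\<forall>w\<in>restr B R. P w) \<longleftrightarrow> (\<forall>w\<in>R. P (w \<inter> B))" if "P {}" for P and B :: "'a set"
      unfolding restr_def using that by auto
    from this[of "\<lambda>w. \<alpha> ` u \<inter> w = {} \<or> \<alpha> ` v \<inter> w = {}" "\<alpha> ` U"] show ?thesis by simp
  qed
  also have "\<dots> \<longleftrightarrow> separated (restr (\<alpha> ` U) R) (\<alpha> ` u) (\<alpha> ` v)"
    unfolding separated_def eq ..
  finally show ?thesis .
qed

text \<open>The counterpart of \<open>limit_weight\<close> in the actual graph
  \<open>T \<union> R\<close>, with arguments arranged for \<open>EP_split\<close>.\<close>

definition split_weight :: "nat \<Rightarrow> 'a set set \<Rightarrow> 'a set set \<Rightarrow> real" where
  "split_weight K T R = of_bool (\<forall>A\<in>T. card A \<le> K) *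
     mobius (\<lambda>S. of_bool (\<forall>u\<in>S. \<forall>v\<in>S. \<not> far \<alpha> (T \<union> R) u v)) T"

text \<open>The trace of the remaining cycles on the partners of \<open>U\<close> again has the law
  of a uniform permutation, and \<open>\<alpha>\<close> relabels it to \<open>U\<close>. The
  equality is exact for finite \<open>X\<close>, so only sets \<open>U\<close> with internal edges
  cause an error.\<close>

lemma EP_split_weight_generic:
  assumes U: "U \<subseteq> X" and gen: "\<And>x. x \<in> U \<Longrightarrow> \<alpha> x \<notin> U"
  shows "EP U (\<lambda>T. EP (X - U) (split_weight K T)) = limit_coeff K U"
proof -
  have fU: "finite U" using U fin finite_subset by blast
  have sub: "\<alpha> ` U \<subseteq> X - U" using gen U closed by auto
  let ?G = "\<lambda>T \<tau>. of_bool (\<forall>A\<in>T. card A \<le> K) *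
     mobius (\<lambda>S. of_bool (\<forall>u\<in>S. \<forall>v\<in>S. \<not> separated \<tau> (\<alpha> ` u) (\<alpha> ` v))) T"
  have "EP (X - U) (split_weight K T) = EP U (\<lambda>\<tau>. limit_weight K \<tau> T)" if T: "partition_on U T" for T
  proof -
    have subT: "A \<subseteq> U" if "A \<in> T" for A using T that by (auto simp: partition_on_def)
    have "split_weight K T R = ?G T (restr (\<alpha> ` U) R)" for R
      unfolding split_weight_def
      by (intro arg_cong2[where f = "(*)"] refl mobius_cong arg_cong[where f = of_bool] ball_cong
          arg_cong[where f = Not] far_generic[OF gen T]) auto
    then have "EP (X - U) (split_weight K T) = EP (X - U) (\<lambda>R. ?G T (restr (\<alpha> ` U) R))"
      by (intro arg_cong[where f = "EP (X - U)"] ext)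
    also have "\<dots> = EP (\<alpha> ` U) (?G T)" by (rule EP_restr) (use fin sub in auto)
    also have "\<dots> = EP U (\<lambda>\<tau>. ?G T ((`) \<alpha> ` \<tau>))" by (rule EP_image[OF fU inj_alpha])
    also have "\<dots> = EP U (\<lambda>\<tau>. limit_weight K \<tau> T)"
    proof (rule EP_cong[OF fU])
      fix \<tau> assume t: "partition_on U \<tau>"
      have subt: "w \<subseteq> U" if "w \<in> \<tau>" for w using t that by (auto simp: partition_on_def)
      show "?G T ((`) \<alpha> ` \<tau>) = limit_weight K \<tau> T"
        unfolding limit_weight_def
        by (intro arg_cong2[where f = "(*)"] refl mobius_cong arg_cong[where f = of_bool] ball_cong
            arg_cong[where f = Not] separated_image[OF inj_alpha[of U]]) (use subT subt in auto)
    qed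
    finally show ?thesis .
  qed
  then show ?thesis unfolding limit_coeff_def by (intro EP_cong[OF fU])
qed

lemma abs_EP_split_weight_le:
  assumes "U \<subseteq> X"
  shows "\<bar>EP U (\<lambda>T. EP (X - U) (split_weight K T))\<bar> \<le> 4 ^ 2 ^ (K + 2) / 2 ^ card U"
proof (rule abs_EP_small_le)
  show fU: "finite U" using assms fin finite_subset by blast
  fix T assume T: "partition_on U T"
  have fT: "finite T" using finite_elements[OF fU T] .
  have "\<bar>split_weight K T R\<bar> \<le> of_bool (\<forall>A\<in>T. card A \<le> K) * 2 ^ card T" for R
    unfolding split_weight_def abs_mult
    by (intro mult_mono abs_mobius_le[OF fT]) auto
  then show "\<bar>EP (X - U) (split_weight K T)\<bar> \<le> of_bool (\<forall>A\<in>T. card A \<le> K) * 2 ^ card T"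
    by (intro order_trans[OF EP_abs] EP_le_const) (use fin in auto)
qed

text \<open>The Moebius terms over all subsets of the set of small vertices sum to the indicator
  that no two of them are far apart; \<open>split_weight\<close> vanishes on every \<open>T\<close>
  with a large block. \<open>EP_split\<close> then separates \<open>T\<close> from the rest.\<close>

lemma EP_small_close_eq:
  "EP X (\<lambda>\<pi>. of_bool (small_close K \<pi>)) =
    (\<Sum>U\<in>Pow X. 1 / real (card X choose card U) * EP U (\<lambda>T. EP (X - U) (split_weight K T)))"
proof -
  have "EP X (\<lambda>\<pi>. of_bool (small_close K \<pi>)) = EP X (\<lambda>\<pi>. \<Sum>T\<in>Pow \<pi>. split_weight K T (\<pi> - T))"
  proof (rule EP_cong[OF fin])
    fix \<pi> assume p: "partition_on X \<pi>"
    have fp: "finite \<pi>" using finite_elements[OF fin p] .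
    let ?S = "{A \<in> \<pi>. card A \<le> K}"
    let ?h = "\<lambda>S. of_bool (\<forall>u\<in>S. \<forall>v\<in>S. \<not> far \<alpha> \<pi> u v) :: real"
    have "(\<Sum>T\<in>Pow \<pi>. split_weight K T (\<pi> - T)) = (\<Sum>T\<in>Pow ?S. mobius ?h T)"
    proof (rule sum.mono_neutral_cong_right)
      show "\<forall>T\<in>Pow \<pi> - Pow ?S. split_weight K T (\<pi> - T) = 0" unfolding split_weight_def by auto
      fix T assume T: "T \<in> Pow ?S"
      then have "T \<union> (\<pi> - T) = \<pi>" "\<forall>A\<in>T. card A \<le> K" by auto
      then show "split_weight K T (\<pi> - T) = mobius ?h T" unfolding split_weight_def by simp
    qed (use fp in auto)
    also have "\<dots> = ?h ?S" by (rule sum_mobius) (use fp in simp)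
    also have "\<dots> = of_bool (small_close K \<pi>)" unfolding small_close_def by auto
    finally show "of_bool (small_close K \<pi>) = (\<Sum>T\<in>Pow \<pi>. split_weight K T (\<pi> - T))" by simp
  qed
  also have "\<dots> = (\<Sum>U\<in>Pow X. fact (card U) * fact (card (X - U)) / fact (card X) *
      EP U (\<lambda>T. EP (X - U) (split_weight K T)))" by (rule EP_split[OF fin])
  also have "\<dots> = (\<Sum>U\<in>Pow X. 1 / real (card X choose card U) * EP U (\<lambda>T. EP (X - U) (split_weight K T)))"
  proof (rule sum.cong)
    fix U assume U: "U \<in> Pow X"
    have "card U \<le> card X" using U fin by (auto intro: card_mono)
    moreover have "card (X - U) = card X - card U" using U fin by (auto simp: card_Diff_subset finite_subset)
    ultimately show "fact (card U) * fact (card (X - U)) / fact (card X) * EP U (\<lambda>T. EP (X - U) (split_weight K T)) =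
      1 / real (card X choose card U) * EP U (\<lambda>T. EP (X - U) (split_weight K T))"
      by (simp add: binomial_fact)
  qed simp
  finally show ?thesis .
qed

text \<open>Only sets \<open>U\<close> of size \<open>s\<close> with an internal edge deviate, each
  by at most \<open>2 * 4^2^(K + 2) / 2^s\<close>. Their indicator is bounded by
  \<open>s - brk \<alpha> U\<close>, whose mean over \<open>s\<close>-subsets is
  \<open>s * (s - 1) / (card X - 1)\<close>; the sum of \<open>s^2 / 2^s\<close> contributes the
  factor 6.\<close>

lemma EP_small_close_approx:
  assumes N2: "2 \<le> card X"
  shows "\<bar>EP X (\<lambda>\<pi>. of_bool (small_close K \<pi>)) - (\<Sum>s\<le>card X. limit_coeff K {..<s})\<bar> \<le>
    12 * 4 ^ 2 ^ (K + 2) / (real (card X) - 1)"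
proof -
  let ?N = "card X"
  let ?D = "4 ^ 2 ^ (K + 2) :: real"
  let ?q = "\<lambda>U. EP U (\<lambda>T. EP (X - U) (split_weight K T))"
  let ?c = "\<lambda>s. limit_coeff K {..<s}"
  let ?S = "\<lambda>s. {U. U \<in> Pow X \<and> card U = s}"
  have cS: "(\<Sum>U\<in>?S s. c) = real (?N choose s) * c" for c :: real and s
    by (simp only: sum_constant card_subsets_card[OF fin])
  have 1: "EP X (\<lambda>\<pi>. of_bool (small_close K \<pi>)) = (\<Sum>s\<le>?N. 1 / real (?N choose s) * (\<Sum>U\<in>?S s. ?q U))"
  proof -
    have "EP X (\<lambda>\<pi>. of_bool (small_close K \<pi>)) = (\<Sum>U | U \<in> Pow X \<and> True. 1 / real (?N choose card U) * ?q U)"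
      unfolding EP_small_close_eq by (rule sum.cong) auto
    also have "\<dots> = (\<Sum>s\<le>?N. \<Sum>U | U \<in> Pow X \<and> True \<and> card U = s. 1 / real (?N choose card U) * ?q U)"
      by (rule sum_by_card[OF fin])
    also have "\<dots> = (\<Sum>s\<le>?N. 1 / real (?N choose s) * (\<Sum>U\<in>?S s. ?q U))"
      unfolding sum_distrib_left by (intro sum.cong) auto
    finally show ?thesis .
  qed
  have 2: "\<bar>1 / real (?N choose s) * (\<Sum>U\<in>?S s. ?q U) - ?c s\<bar> \<le> 2 * ?D / (real ?N - 1) * ((real s)\<^sup>2 / 2 ^ s)"
    if s: "s \<le> ?N" for s
  proof -
    have pos: "real (?N choose s) > 0" using s by simp
    have dev: "\<bar>?q U - ?c s\<bar> \<le> 2 * ?D / 2 ^ s * (real s - real (brk \<alpha> U))" if U: "U \<in> ?S s" for U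
    proof -
      have fU: "finite U" using U fin finite_subset by auto
      have c: "?c s = limit_coeff K U" using limit_coeff_card[OF fU] U by simp
      have bl: "brk \<alpha> U \<le> s" using brk_le[OF fU] U by simp
      show ?thesis
      proof (cases "brk \<alpha> U = s")
        case True
        then have "{x \<in> U. \<alpha> x \<notin> U} = U"
          using U fU by (intro card_subset_eq) (auto simp: brk_def)
        then have "?q U = limit_coeff K U"
          by (intro EP_split_weight_generic) (use U in auto)
        then show ?thesis using c True by simp
      next
        case False
        have "\<bar>?q U - ?c s\<bar> \<le> \<bar>?q U\<bar> + \<bar>limit_coeff K U\<bar>" unfolding c by linarith
        also have "\<dots> \<le> ?D / 2 ^ s + ?D / 2 ^ s"
          using abs_EP_split_weight_le[of U K] abs_limit_coeff_le[OF fU, of K] U by (intro add_mono) auto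
        also have "\<dots> = 2 * ?D / 2 ^ s * 1" by simp
        also have "\<dots> \<le> 2 * ?D / 2 ^ s * (real s - real (brk \<alpha> U))"
          using False bl by (intro mult_left_mono) auto
        finally show ?thesis .
      qed
    qed
    have "1 / real (?N choose s) * (\<Sum>U\<in>?S s. ?q U) - ?c s = 1 / real (?N choose s) * (\<Sum>U\<in>?S s. ?q U - ?c s)"
      unfolding sum_subtractf cS using pos by (simp add: right_diff_distrib)
    then have "\<bar>1 / real (?N choose s) * (\<Sum>U\<in>?S s. ?q U) - ?c s\<bar> =
        1 / real (?N choose s) * \<bar>\<Sum>U\<in>?S s. ?q U - ?c s\<bar>"
      by (simp only: abs_mult) simp
    also have "\<dots> \<le> 1 / real (?N choose s) * (\<Sum>U\<in>?S s. 2 * ?D / 2 ^ s * (real s - real (brk \<alpha> U)))"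
      by (intro mult_left_mono order_trans[OF sum_abs] sum_mono dev) auto
    also have "\<dots> = 1 / real (?N choose s) * (2 * ?D / 2 ^ s * (\<Sum>U\<in>?S s. real s - real (brk \<alpha> U)))"
      by (simp only: sum_distrib_left)
    also have "\<dots> \<le> 2 * ?D / (real ?N - 1) * ((real s)\<^sup>2 / 2 ^ s)"
    proof (cases "s = 0")
      case True
      have "(\<Sum>U\<in>?S s. real s - real (brk \<alpha> U)) \<le> 0" using True by (intro sum_nonpos) simp
      then have "1 / real (?N choose s) * (2 * ?D / 2 ^ s * (\<Sum>U\<in>?S s. real s - real (brk \<alpha> U))) \<le> 0"
        by (intro mult_nonneg_nonpos) auto
      then show ?thesis using True by simp
    next
      case False
      have "1 / real (?N choose s) * (2 * ?D / 2 ^ s * (\<Sum>U\<in>?S s. real s - real (brk \<alpha> U))) =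
        2 * ?D / 2 ^ s * (real s * (real s - 1) / (real ?N - 1))"
        using pos False by (subst sum_loops[OF _ s N2]) auto
      also have "\<dots> \<le> 2 * ?D / 2 ^ s * (real s * real s / (real ?N - 1))"
        using N2 by (intro mult_left_mono divide_right_mono) auto
      finally show ?thesis by (simp add: power2_eq_square mult_ac)
    qed
    finally show ?thesis .
  qed
  have "\<bar>EP X (\<lambda>\<pi>. of_bool (small_close K \<pi>)) - (\<Sum>s\<le>?N. ?c s)\<bar> \<le>
      (\<Sum>s\<le>?N. \<bar>1 / real (?N choose s) * (\<Sum>U\<in>?S s. ?q U) - ?c s\<bar>)"
    unfolding 1 sum_subtractf[symmetric] by (rule sum_abs)
  also have "\<dots> \<le> (\<Sum>s\<le>?N. 2 * ?D / (real ?N - 1) * ((real s)\<^sup>2 / 2 ^ s))"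
    by (rule sum_mono) (use 2 in auto)
  also have "\<dots> = 2 * ?D / (real ?N - 1) * (\<Sum>s\<le>?N. (real s)\<^sup>2 / 2 ^ s)"
    by (simp only: sum_distrib_left)
  also have "\<dots> \<le> 2 * ?D / (real ?N - 1) * 6"
    using N2 by (intro mult_left_mono sum_squares_powers) auto
  finally show ?thesis by simp
qed

end

section \<open>Complete graphs and pairs of distant leaves\<close>

lemma wt_singleton:
  assumes "finite X" "a \<in> X"
  shows "wt X {a} = 1 / real (card X)"
proof -
  have "card X > 0" using assms by (auto simp: card_gt_0_iff)
  then have "(fact (card X) :: real) = real (card X) * fact (card X - 1)" by (simp add: fact_reduce)
  then show ?thesis using assms by (simp add: wt_def)
qed

text \<open>The cycle \<open>D\<close> of \<open>p\<close> misses \<open>q\<close> with probability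
  \<open>1 / 2\<close>. The lengths 1 and \<open>card Z - 1\<close> are excluded at a cost of
  \<open>1 / card Z\<close> each, so that the complement has at least two points; it then has no
  fixed point with probability at least \<open>1 / 3\<close>, by \<open>EP_larger_ge\<close> for
  \<open>K = 1\<close>.\<close>

lemma EP_larger_separated_ge:
  assumes Z: "finite Z" and pq: "p \<in> Z" "q \<in> Z" "p \<noteq> q"
  shows "1 / 3 * (1 / 2 - 2 / real (card Z)) \<le> EP Z (\<lambda>R. of_bool (larger 1 R \<and> (\<forall>w\<in>R. \<not> (p \<in> w \<and> q \<in> w))))"
proof -
  let ?M = "card Z"
  let ?e = "\<lambda>R. of_bool (larger 1 R \<and> (\<forall>w\<in>R. \<not> (p \<in> w \<and> q \<in> w))) :: real"
  let ?S = "{D. D \<in> Pow Z \<and> p \<in> D}"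
  have one: "(\<Sum>D\<in>?S. wt Z D * of_bool (card D = j)) \<le> 1 / real ?M" for j
  proof -
    have "(\<Sum>D\<in>?S. wt Z D * of_bool (card D = j)) = (\<Sum>k = 1..?M. of_bool (k = j)) / real ?M"
      by (rule sum_point_wt_by_card[OF Z pq(1)])
    also have "(\<Sum>k = 1..?M. of_bool (k = j)) \<le> (1 :: real)"
      by (simp add: of_bool_def sum.delta)
    finally show ?thesis by (simp add: divide_right_mono)
  qed
  have "1 / 3 * (1 / 2 - 2 / real ?M) = 1 / 3 * (1 / (real (card {q}) + 1) - 1 / real ?M - 1 / real ?M)"
    by simp
  also have "\<dots> \<le> 1 / 3 * ((\<Sum>D\<in>?S. wt Z D * of_bool (D \<inter> {q} = {})) -
      (\<Sum>D\<in>?S. wt Z D * of_bool (card D = 1)) - (\<Sum>D\<in>?S. wt Z D * of_bool (card D = ?M - 1)))"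
    using one[of 1] one[of "?M - 1"] sum_wt_avoids[OF Z pq(1), of "{q}"] pq by simp
  also have "\<dots> = (\<Sum>D\<in>?S. wt Z D * (1 / 3 * (of_bool (D \<inter> {q} = {}) - of_bool (card D = 1) - of_bool (card D = ?M - 1))))"
    by (simp add: sum_subtractf[symmetric] sum_distrib_left algebra_simps del: of_bool_eq_iff)
  also have "\<dots> \<le> (\<Sum>D\<in>?S. wt Z D * EP (Z - D) (\<lambda>R. ?e (insert D R)))"
  proof (intro sum_mono mult_left_mono wt_nonneg)
    fix D assume D: "D \<in> ?S"
    have fD: "finite D" using D Z finite_subset by auto
    have fZD: "finite (Z - D)" using Z by simp
    have nn: "0 \<le> EP (Z - D) (\<lambda>R. ?e (insert D R))" by (rule EP_nonneg[OF fZD]) simp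
    show "1 / 3 * (of_bool (D \<inter> {q} = {}) - of_bool (card D = 1) - of_bool (card D = ?M - 1))
      \<le> EP (Z - D) (\<lambda>R. ?e (insert D R))"
    proof (cases "q \<notin> D \<and> card D \<noteq> 1 \<and> card D \<noteq> ?M - 1")
      case False
      then have "1 / 3 * (of_bool (D \<inter> {q} = {}) - of_bool (card D = 1) - of_bool (card D = ?M - 1)) \<le> (0::real)"
        by auto
      then show ?thesis using nn by linarith
    next
      case True
      have c0: "card D \<noteq> 0" using D fD by auto
      have cZD: "card (Z - D) = ?M - card D" using D fD by (simp add: card_Diff_subset)
      have "q \<in> Z - D" using True pq by simp
      then have "card (Z - D) > 0" using fZD card_gt_0_iff by blast
      then have c1: "1 < card (Z - D)" using True cZD by linarith
      have "1 / 3 \<le> EP (Z - D) (\<lambda>R. of_bool (larger 1 R))"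
        using EP_larger_ge[OF fZD c1] by simp
      also have "\<dots> \<le> EP (Z - D) (\<lambda>R. ?e (insert D R))"
      proof (rule EP_mono[OF fZD])
        fix R assume R: "partition_on (Z - D) R"
        have "p \<notin> w" if "w \<in> R" for w using R D that by (auto simp: partition_on_def)
        then show "of_bool (larger 1 R) \<le> ?e (insert D R)" using True c0 by auto
      qed
      finally show ?thesis using True by simp
    qed
  qed
  also have "\<dots> = EP Z ?e" by (rule EP_point[OF Z pq(1), symmetric])
  finally show ?thesis .
qed

context pairing
begin

text \<open>If some degree is at most \<open>K\<close>, the vertex \<open>u\<close> having it is
  either the only such vertex or adjacent to another one. In the second case one of the at most
  \<open>K\<close> partners of \<open>u\<close> lies in a cycle of length at most \<open>K\<close>,
  which is unlikely for large \<open>card X\<close>. The mean numbers \<open>1 / k\<close> of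
  candidates for \<open>u\<close> add up to \<open>harm K\<close>.\<close>

lemma EP_complete_le:
  assumes K: "K < card X"
  shows "EP X (\<lambda>\<pi>. of_bool (\<forall>u\<in>\<pi>. \<forall>v\<in>\<pi>. u = v \<or> adj \<alpha> u v)) \<le>
    1 / (real K + 1) + (1 / (real K + 1) + real K * ((real K + 1) / (real (card X) - real K))) * harm K"
proof -
  let ?N = "real (card X)"
  let ?t = "1 / (real K + 1) + real K * ((real K + 1) / (?N - real K))"
  define f where "f = (\<lambda>A R. of_bool (card A \<le> K) *
     (of_bool (larger K R) + of_bool (\<exists>v\<in>R. card v \<le> K \<and> adj \<alpha> A v)) :: real)"
  have t0: "0 \<le> ?t" using K by simp
  have "EP X (\<lambda>\<pi>. of_bool (\<forall>u\<in>\<pi>. \<forall>v\<in>\<pi>. u = v \<or> adj \<alpha> u v)) \<le>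
    EP X (\<lambda>\<pi>. of_bool (larger K \<pi>) +
      of_bool (\<not> larger K \<pi> \<and> (\<forall>u\<in>\<pi>. \<forall>v\<in>\<pi>. u = v \<or> adj \<alpha> u v)))"
    by (rule EP_mono[OF fin]) auto
  also have "\<dots> \<le> EP X (\<lambda>\<pi>. of_bool (larger K \<pi>)) + EP X (\<lambda>\<pi>. \<Sum>A\<in>\<pi>. f A (\<pi> - {A}))"
    unfolding EP_add
  proof (intro add_left_mono EP_of_bool_le_block_sum fin)
    show "0 \<le> f A R" for A R by (simp add: f_def)
    fix \<pi> assume c: "\<not> larger K \<pi> \<and> (\<forall>u\<in>\<pi>. \<forall>v\<in>\<pi>. u = v \<or> adj \<alpha> u v)"
    then obtain u where u: "u \<in> \<pi>" "card u \<le> K" by (auto simp: not_less)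
    have "1 \<le> f u (\<pi> - {u})"
    proof (cases "larger K (\<pi> - {u})")
      case True
      then show ?thesis using u by (simp add: f_def)
    next
      case False
      then obtain v where "v \<in> \<pi> - {u}" "card v \<le> K" by (auto simp: not_less)
      then have "\<exists>v\<in>\<pi> - {u}. card v \<le> K \<and> adj \<alpha> u v" using c u by blast
      then show ?thesis using u by (simp add: f_def)
    qed
    then show "\<exists>A\<in>\<pi>. 1 \<le> f A (\<pi> - {A})" using u by blast
  qed
  also have "\<dots> \<le> 1 / (real K + 1) + ?t * harm K"
  proof (rule add_mono)
    show "EP X (\<lambda>\<pi>. of_bool (larger K \<pi>)) \<le> 1 / (real K + 1)"
      by (rule EP_larger_le) (use K fin in auto)
    have "EP X (\<lambda>\<pi>. \<Sum>A\<in>\<pi>. f A (\<pi> - {A})) \<le> (\<Sum>k = 1..card X. of_bool (k \<le> K) * ?t / real k)"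
    proof (rule EP_block_sum_le[OF fin])
      fix A assume A: "A \<subseteq> X" "A \<noteq> {}"
      let ?Y = "X - A"
      let ?J = "{y \<in> X - A. \<alpha> y \<in> A}"
      have fA: "finite A" using A fin finite_subset by blast
      have fY: "finite ?Y" using fin by simp
      have cY: "card ?Y = card X - card A" using A fA by (simp add: card_Diff_subset)
      show "EP ?Y (f A) \<le> of_bool (card A \<le> K) * ?t"
      proof (cases "card A \<le> K")
        case False
        have "EP ?Y (f A) \<le> 0" by (rule EP_le_const[OF fY]) (use False in \<open>auto simp: f_def\<close>)
        then show ?thesis using False by simp
      next
        case True
        have Yne: "?Y \<noteq> {}" using cY True K by (metis card.empty diff_is_0_eq not_le le_trans)
        have YK: "?N - real K \<le> real (card ?Y)" "?N - real K > 0" using cY True K by auto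
        have "EP ?Y (f A) \<le> EP ?Y (\<lambda>R. of_bool (larger K R) +
            (\<Sum>q\<in>?J. of_bool (\<forall>B\<in>R. q \<in> B \<longrightarrow> real (card B) < real K + 1)))"
        proof (rule EP_mono[OF fY])
          fix R assume R: "partition_on ?Y R"
          let ?o = "\<lambda>q. of_bool (\<forall>B\<in>R. q \<in> B \<longrightarrow> real (card B) < real K + 1) :: real"
          have "of_bool (\<exists>v\<in>R. card v \<le> K \<and> adj \<alpha> A v) \<le> (\<Sum>q\<in>?J. ?o q)"
          proof (cases "\<exists>v\<in>R. card v \<le> K \<and> adj \<alpha> A v")
            case True
            then obtain v where v: "v \<in> R" "card v \<le> K" "adj \<alpha> A v" by blast
            have vY: "v \<subseteq> ?Y" using R v by (auto simp: partition_on_def)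
            then obtain q where q: "q \<in> v" "q \<in> ?J" using adj_iff[OF A(1) vY] v by blast
            have "B = v" if "B \<in> R" "q \<in> B" for B
              using disjointD[of R B v] R v(1) that q by (auto simp: partition_on_def)
            then have "?o q = 1" using v by auto
            then have "1 \<le> ?o q" by simp
            also have "\<dots> \<le> (\<Sum>q\<in>?J. ?o q)" by (rule member_le_sum) (use q fin in auto)
            finally show ?thesis using True by (simp only: of_bool_eq)
          next
            case False
            have "0 \<le> (\<Sum>q\<in>?J. ?o q)" by (rule sum_nonneg) simp
            then show ?thesis using False by (simp only: of_bool_eq)
          qed
          then show "f A R \<le> of_bool (larger K R) + (\<Sum>q\<in>?J. ?o q)"
            using True by (simp add: f_def)
        qed
        also have "\<dots> = EP ?Y (\<lambda>R. of_bool (larger K R)) +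
          (\<Sum>q\<in>?J. EP ?Y (\<lambda>R. of_bool (\<forall>B\<in>R. q \<in> B \<longrightarrow> real (card B) < real K + 1)))"
          by (simp only: EP_add EP_sum)
        also have "\<dots> \<le> 1 / (real K + 1) + (\<Sum>q\<in>?J. (real K + 1) / (?N - real K))"
        proof (intro add_mono sum_mono)
          show "EP ?Y (\<lambda>R. of_bool (larger K R)) \<le> 1 / (real K + 1)" by (rule EP_larger_le[OF fY Yne])
          fix q assume q: "q \<in> ?J"
          have "EP ?Y (\<lambda>R. of_bool (\<forall>B\<in>R. q \<in> B \<longrightarrow> real (card B) < real K + 1)) \<le> (real K + 1) / real (card ?Y)"
            by (rule EP_block_size_less) (use fY q in auto)
          also have "\<dots> \<le> (real K + 1) / (?N - real K)"
            using YK by (intro divide_left_mono mult_pos_pos) auto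
          finally show "EP ?Y (\<lambda>R. of_bool (\<forall>B\<in>R. q \<in> B \<longrightarrow> real (card B) < real K + 1)) \<le> (real K + 1) / (?N - real K)" .
        qed
        also have "(\<Sum>q\<in>?J. (real K + 1) / (?N - real K)) = real (brk \<alpha> A) * ((real K + 1) / (?N - real K))"
          using brk_compl[OF A(1)] by simp
        also have "\<dots> \<le> real K * ((real K + 1) / (?N - real K))"
          using brk_le[OF fA] True YK by (intro mult_right_mono) auto
        finally show ?thesis using True by simp
      qed
    qed
    also have "\<dots> = (\<Sum>k = 1..card X. if k \<in> {..K} then ?t * (1 / real k) else 0)"
      by (rule sum.cong) auto
    also have "\<dots> = (\<Sum>k\<in>{1..card X} \<inter> {..K}. ?t * (1 / real k))"
      by (rule sum.inter_restrict[symmetric]) simp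
    also have "{1..card X} \<inter> {..K} = {1..K}" using K by auto
    also have "(\<Sum>k = 1..K. ?t * (1 / real k)) = ?t * harm K"
      by (simp only: harm_def sum_distrib_left inverse_eq_divide)
    finally show "EP X (\<lambda>\<pi>. \<Sum>A\<in>\<pi>. f A (\<pi> - {A})) \<le> ?t * harm K" .
  qed
  finally show ?thesis .
qed

text \<open>Exactly two vertices of degree one, attached to different vertices, already have distance
  at least three.\<close>

lemma EP_far_ge:
  assumes N4: "4 \<le> card X"
  shows "1 / 2 * ((real (card X) - 2) / (real (card X) - 1) * (1 / 3 * (1 / 2 - 2 / (real (card X) - 2))))
    \<le> EP X (\<lambda>\<pi>. of_bool (\<exists>u\<in>\<pi>. \<exists>v\<in>\<pi>. far \<alpha> \<pi> u v))"
proof -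
  let ?N = "real (card X)"
  let ?t = "1 / 3 * (1 / 2 - 2 / (?N - 2))"
  define f2 where "f2 = (\<lambda>A B R. of_bool (card A = 1 \<and> card B = 1 \<and> \<not> adj \<alpha> A B \<and> larger 1 R \<and>
     (\<forall>w\<in>R. \<not> (adj \<alpha> A w \<and> adj \<alpha> w B))) :: real)"
  define f where "f = (\<lambda>A R. \<Sum>B\<in>R. f2 A B (R - {B}))"
  have nn2: "0 \<le> f2 A B R" for A B R by (simp add: f2_def)
  have nn: "0 \<le> f A R" for A R unfolding f_def using nn2 by (intro sum_nonneg)
  \<comment> \<open>A nonzero term makes \<open>A0\<close> and \<open>B0\<close> the only blocks of
    size one, so at most the two orderings of this pair count. This is the origin of the factor
    \<open>1 / 2\<close> in the lower bound.\<close>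
  have upper: "(\<Sum>A\<in>\<pi>. f A (\<pi> - {A})) \<le> 2 * of_bool (\<exists>u\<in>\<pi>. \<exists>v\<in>\<pi>. far \<alpha> \<pi> u v)"
    if p: "partition_on X \<pi>" for \<pi>
  proof -
    have fp: "finite \<pi>" using finite_elements[OF fin p] .
    show ?thesis
    proof (cases "\<exists>A\<in>\<pi>. \<exists>B\<in>\<pi> - {A}. f2 A B (\<pi> - {A} - {B}) \<noteq> 0")
      case False
      then have "(\<Sum>A\<in>\<pi>. f A (\<pi> - {A})) = 0" unfolding f_def by (intro sum.neutral ballI) auto
      then show ?thesis by simp
    next
      case True
      then obtain A0 B0 where AB: "A0 \<in> \<pi>" "B0 \<in> \<pi>" "A0 \<noteq> B0" "f2 A0 B0 (\<pi> - {A0} - {B0}) \<noteq> 0" by blast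
      then have c: "card A0 = 1" "card B0 = 1" "\<not> adj \<alpha> A0 B0" "larger 1 (\<pi> - {A0} - {B0})"
        "\<forall>w\<in>\<pi> - {A0} - {B0}. \<not> (adj \<alpha> A0 w \<and> adj \<alpha> w B0)" unfolding f2_def by (auto split: if_splits)
      have "\<not> adj \<alpha> A0 A0"
      proof -
        obtain a where "A0 = {a}" using c(1) card_1_singletonE by blast
        moreover have "a \<in> X" using p AB(1) calculation by (auto simp: partition_on_def)
        ultimately show ?thesis using fpf unfolding adj_def by auto
      qed
      then have far: "far \<alpha> \<pi> A0 B0" unfolding far_def using c AB by blast
      have single: "C = A0 \<or> C = B0" if "C \<in> \<pi>" "card C = 1" for C
        using c(4) that by force
      have "f A (\<pi> - {A}) \<le> of_bool (A \<in> {A0, B0})" if A: "A \<in> \<pi>" for A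
      proof (cases "A \<in> {A0, B0}")
        case False
        then have "card A \<noteq> 1" using single A by blast
        then show ?thesis using False by (simp add: f_def f2_def)
      next
        case in2: True
        define B where "B = (if A = A0 then B0 else A0)"
        have "f A (\<pi> - {A}) \<le> (\<Sum>C\<in>\<pi> - {A}. if C = B then 1 else 0)"
          unfolding f_def
        proof (rule sum_mono)
          fix C assume C: "C \<in> \<pi> - {A}"
          show "f2 A C (\<pi> - {A} - {C}) \<le> (if C = B then 1 else 0)"
            using single[of C] C in2 unfolding f2_def B_def by (cases "card C = 1") auto
        qed
        also have "\<dots> \<le> 1" using fp by (simp add: sum.delta)
        finally show ?thesis using in2 by simp
      qed
      then have "(\<Sum>A\<in>\<pi>. f A (\<pi> - {A})) \<le> (\<Sum>A\<in>\<pi>. of_bool (A \<in> {A0, B0}))" by (rule sum_mono)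
      also have "\<dots> = (\<Sum>A\<in>\<pi>. if A \<in> {A0, B0} then 1 else 0)" by (rule sum.cong) auto
      also have "\<dots> = (\<Sum>A\<in>\<pi> \<inter> {A0, B0}. 1)" by (rule sum.inter_restrict[symmetric, OF fp])
      also have "\<dots> = 2" using AB by simp
      finally show ?thesis using far AB by auto
    qed
  qed
  have inner: "(?N - 2) / (?N - 1) * ?t \<le> EP (X - {a}) (f {a})" if a: "a \<in> X" for a
  proof -
    let ?Y = "X - {a}"
    have fY: "finite ?Y" using fin by simp
    have cY: "real (card ?Y) = ?N - 1" using a fin N4 by simp
    \<comment> \<open>Leaving out \<open>\<alpha> a\<close> keeps the two leaves from being adjacent
      to each other.\<close>
    let ?I = "(\<lambda>b. {b}) ` (X - {a, \<alpha> a})"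
    have cI: "real (card (X - {a, \<alpha> a})) = ?N - 2"
    proof -
      have "card (X - {a, \<alpha> a}) = card X - 2"
        using fin a closed[OF a] fpf[OF a] by (subst card_Diff_subset) (auto simp: numeral_2_eq_2)
      then show ?thesis using N4 by auto
    qed
    have "(?N - 2) / (?N - 1) * ?t = (\<Sum>b\<in>X - {a, \<alpha> a}. 1 / (?N - 1) * ?t)"
      using cI by simp
    also have "\<dots> \<le> (\<Sum>b\<in>X - {a, \<alpha> a}. wt ?Y {b} * EP (?Y - {b}) (f2 {a} {b}))"
    proof (rule sum_mono)
      fix b assume b: "b \<in> X - {a, \<alpha> a}"
      let ?Z = "?Y - {b}"
      have fZ: "finite ?Z" using fin by simp
      have cZ: "real (card ?Z) = ?N - 2" using a b fin N4 by simp
      have w: "wt ?Y {b} = 1 / (?N - 1)" using wt_singleton[OF fY, of b] b cY by simp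
      have ne: "\<alpha> b \<noteq> a" "\<alpha> a \<noteq> a" "\<alpha> b \<noteq> b" "\<alpha> a \<noteq> \<alpha> b" using a b fpf inv by auto metis
      have "?t = 1 / 3 * (1 / 2 - 2 / real (card ?Z))" using cZ by simp
      also have "\<dots> \<le> EP ?Z (\<lambda>R. of_bool (larger 1 R \<and> (\<forall>w\<in>R. \<not> (\<alpha> a \<in> w \<and> \<alpha> b \<in> w))))"
        by (rule EP_larger_separated_ge[OF fZ]) (use a b ne closed in auto)
      also have "\<dots> = EP ?Z (f2 {a} {b})"
      proof (rule EP_cong[OF fZ])
        fix R
        have "adj \<alpha> {a} w \<and> adj \<alpha> w {b} \<longleftrightarrow> \<alpha> a \<in> w \<and> \<alpha> b \<in> w" for w
          using adj_sym[of w "{b}"] unfolding adj_def by auto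
        moreover have "\<not> adj \<alpha> {a} {b}" using b by (auto simp: adj_def)
        ultimately show "of_bool (larger 1 R \<and> (\<forall>w\<in>R. \<not> (\<alpha> a \<in> w \<and> \<alpha> b \<in> w))) = f2 {a} {b} R"
          unfolding f2_def by simp
      qed
      finally have "?t \<le> EP ?Z (f2 {a} {b})" .
      then show "1 / (?N - 1) * ?t \<le> wt ?Y {b} * EP ?Z (f2 {a} {b})"
        unfolding w using N4 by (intro mult_left_mono) auto
    qed
    also have "\<dots> = (\<Sum>B\<in>?I. wt ?Y B * EP (?Y - B) (f2 {a} B))"
      by (subst sum.reindex) (auto simp: inj_on_def)
    also have "\<dots> \<le> (\<Sum>B\<in>Pow ?Y - {{}}. wt ?Y B * EP (?Y - B) (f2 {a} B))"
      by (rule sum_mono2) (use fY nn2 in \<open>auto intro!: mult_nonneg_nonneg wt_nonneg EP_nonneg\<close>)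
    also have "\<dots> = EP ?Y (f {a})" unfolding f_def by (rule EP_block_sum[OF fY, symmetric])
    finally show ?thesis .
  qed
  have "(?N - 2) / (?N - 1) * ?t = (\<Sum>a\<in>X. 1 / ?N * ((?N - 2) / (?N - 1) * ?t))"
    using N4 by simp
  also have "\<dots> \<le> (\<Sum>a\<in>X. wt X {a} * EP (X - {a}) (f {a}))"
  proof (rule sum_mono)
    fix a assume a: "a \<in> X"
    show "1 / ?N * ((?N - 2) / (?N - 1) * ?t) \<le> wt X {a} * EP (X - {a}) (f {a})"
      unfolding wt_singleton[OF fin a] by (intro mult_left_mono inner[OF a]) simp
  qed
  also have "\<dots> = (\<Sum>A\<in>(\<lambda>a. {a}) ` X. wt X A * EP (X - A) (f A))"
    by (subst sum.reindex) (auto simp: inj_on_def)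
  also have "\<dots> \<le> (\<Sum>A\<in>Pow X - {{}}. wt X A * EP (X - A) (f A))"
    by (rule sum_mono2) (use fin nn in \<open>auto intro!: mult_nonneg_nonneg wt_nonneg EP_nonneg\<close>)
  also have "\<dots> = EP X (\<lambda>\<pi>. \<Sum>A\<in>\<pi>. f A (\<pi> - {A}))" by (rule EP_block_sum[OF fin, symmetric])
  also have "\<dots> \<le> EP X (\<lambda>\<pi>. 2 * of_bool (\<exists>u\<in>\<pi>. \<exists>v\<in>\<pi>. far \<alpha> \<pi> u v))"
    by (rule EP_mono[OF fin upper])
  also have "\<dots> = 2 * EP X (\<lambda>\<pi>. of_bool (\<exists>u\<in>\<pi>. \<exists>v\<in>\<pi>. far \<alpha> \<pi> u v))" by (rule EP_cmult)
  finally show ?thesis by linarith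
qed

end

section \<open>Hubs and diameter\<close>

primrec near :: "('a \<Rightarrow> 'a) \<Rightarrow> 'a set set \<Rightarrow> nat \<Rightarrow> 'a set \<Rightarrow> 'a set \<Rightarrow> bool" where
  "near \<alpha> \<pi> 0 u v \<longleftrightarrow> u = v"
| "near \<alpha> \<pi> (Suc k) u v \<longleftrightarrow> u = v \<or> (\<exists>w\<in>\<pi>. adj \<alpha> u w \<and> near \<alpha> \<pi> k w v)"

definition diam_le :: "('a \<Rightarrow> 'a) \<Rightarrow> nat \<Rightarrow> 'a set set \<Rightarrow> bool" where
  "diam_le \<alpha> k \<pi> \<longleftrightarrow> (\<forall>u\<in>\<pi>. \<forall>v\<in>\<pi>. near \<alpha> \<pi> k u v)"

lemma near_Suc: "near \<alpha> \<pi> k u v \<Longrightarrow> near \<alpha> \<pi> (Suc k) u v"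
  by (induction k arbitrary: u) auto

lemma near_1: "v \<in> \<pi> \<Longrightarrow> near \<alpha> \<pi> 1 u v \<longleftrightarrow> u = v \<or> adj \<alpha> u v"
  by auto

lemma near_2: "v \<in> \<pi> \<Longrightarrow> near \<alpha> \<pi> 2 u v \<longleftrightarrow> \<not> far \<alpha> \<pi> u v"
  by (auto simp: numeral_2_eq_2 far_def)

lemma diam_le_2_iff: "diam_le \<alpha> 2 \<pi> \<longleftrightarrow> \<not> (\<exists>u\<in>\<pi>. \<exists>v\<in>\<pi>. far \<alpha> \<pi> u v)"
  unfolding diam_le_def using near_2 by blast

lemma diam_le_1_iff: "diam_le \<alpha> 1 \<pi> \<longleftrightarrow> (\<forall>u\<in>\<pi>. \<forall>v\<in>\<pi>. u = v \<or> adj \<alpha> u v)"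
  unfolding diam_le_def using near_1[of _ \<pi>] by simp

lemma diam_le_Suc: "diam_le \<alpha> k \<pi> \<Longrightarrow> diam_le \<alpha> (Suc k) \<pi>"
  unfolding diam_le_def using near_Suc by blast

definition tail_bound :: "nat \<Rightarrow> real" where
  "tail_bound K = (\<Sum>k. 12 * harm k / (real k)\<^sup>2) - (\<Sum>k\<le>K. 12 * harm k / (real k)\<^sup>2)"

text \<open>With \<open>L = N powr (3/4)\<close> the first term has order
  \<open>N powr (-1/4)\<close> and the second order \<open>N powr (-1/4) * ln N\<close>. Adjacency
  of hubs needs an exponent above \<open>2/3\<close>, domination one below 1.\<close>

definition hub_bound :: "nat \<Rightarrow> real" where
  "hub_bound N = 12 * (real N)\<^sup>2 / (real N powr (3/4)) ^ 3 +
     (real N powr (3/4) / (real N - 1) + 2 * (real N powr (3/4)) / real N * harm N)"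

lemma harm_le_ln:
  assumes "0 < n"
  shows "harm n \<le> ln (real n) + 1"
  using euler_mascheroni_sequence_decreasing[of 1 n] assms by (simp add: harm_expand)

lemma summable_harm_div_square: "summable (\<lambda>k. 12 * harm k / (real k)\<^sup>2)"
proof (rule summable_comparison_test_ev)
  show "\<forall>\<^sub>F k in sequentially. norm (12 * harm k / (real k)\<^sup>2) \<le> 12 * (ln (real k) + 1) / (real k)\<^sup>2"
  proof (rule eventually_mono[OF eventually_gt_at_top[of 0]])
    fix k :: nat assume "k > 0"
    then have "harm k \<le> ln (real k) + 1" by (rule harm_le_ln)
    then show "norm (12 * harm k / (real k)\<^sup>2) \<le> 12 * (ln (real k) + 1) / (real k)\<^sup>2"
      by (simp add: harm_nonneg divide_right_mono)
  qed
  show "summable (\<lambda>k. 12 * (ln (real k) + 1) / (real k)\<^sup>2)"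
  proof (rule summable_comparison_test_bigo)
    show "summable (\<lambda>k. norm (real k powr (-3/2)))"
      by (simp add: summable_real_powr_iff)
    show "(\<lambda>k. 12 * (ln (real k) + 1) / (real k)\<^sup>2) \<in> O(\<lambda>k. real k powr (-3/2))"
      by real_asymp
  qed
qed

lemma sum_le_tail_bound: "(\<Sum>k \<in> {K<..<N}. 12 * harm k / (real k)\<^sup>2) \<le> tail_bound K"
proof -
  let ?a = "\<lambda>k. 12 * harm k / (real k)\<^sup>2 :: real"
  have nn: "0 \<le> ?a k" for k by (simp add: harm_nonneg)
  have "(\<Sum>k\<le>K. ?a k) + (\<Sum>k \<in> {K<..<N}. ?a k) = (\<Sum>k \<in> {..K} \<union> {K<..<N}. ?a k)"
    by (rule sum.union_disjoint[symmetric]) auto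
  also have "\<dots> \<le> (\<Sum>k. ?a k)"
    by (rule sum_le_suminf[OF summable_harm_div_square]) (use nn in auto)
  finally show ?thesis unfolding tail_bound_def by linarith
qed

lemma tail_bound_tendsto: "tail_bound \<longlonglongrightarrow> 0"
proof -
  have "(\<lambda>K. (\<Sum>k\<le>K. 12 * harm k / (real k)\<^sup>2)) \<longlonglongrightarrow> (\<Sum>k. 12 * harm k / (real k)\<^sup>2 :: real)"
    by (rule summable_LIMSEQ'[OF summable_harm_div_square])
  from tendsto_diff[OF tendsto_const[of "\<Sum>k. 12 * harm k / (real k)\<^sup>2"] this]
  show ?thesis unfolding tail_bound_def[abs_def] by simp
qed

lemma hub_bound_tendsto: "hub_bound \<longlonglongrightarrow> 0"
proof (rule tendsto_sandwich)
  show "\<forall>\<^sub>F N in sequentially. 0 \<le> hub_bound N"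
    using eventually_ge_at_top[of 1]
    by eventually_elim (auto simp: hub_bound_def harm_nonneg intro!: add_nonneg_nonneg)
  show "\<forall>\<^sub>F N in sequentially. hub_bound N \<le> 12 * (real N)\<^sup>2 / (real N powr (3/4)) ^ 3 +
     (real N powr (3/4) / (real N - 1) + 2 * (real N powr (3/4)) / real N * (ln (real N) + 1))"
    using eventually_gt_at_top[of 0]
    by eventually_elim (unfold hub_bound_def, intro add_left_mono mult_left_mono harm_le_ln, auto)
  show "(\<lambda>N. 12 * (real N)\<^sup>2 / (real N powr (3/4)) ^ 3 +
     (real N powr (3/4) / (real N - 1) + 2 * (real N powr (3/4)) / real N * (ln (real N) + 1))) \<longlonglongrightarrow> 0"
    by real_asymp
qed auto

context pairing
begin

lemma far_sym: "far \<alpha> \<pi> u v \<longleftrightarrow> far \<alpha> \<pi> v u"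
  unfolding far_def using adj_sym by blast

text \<open>If \<open>u\<close> were a hub, then \<open>v\<close>, or a hub adjacent to
  \<open>v\<close>, would be \<open>u\<close> itself or adjacent to \<open>u\<close>, giving
  distance at most 2. So \<open>u\<close> is not a hub, and the hub that dominates it is a different
  block, whence an edge leaves \<open>u\<close>.\<close>

lemma far_hubs:
  assumes "partition_on X \<pi>" "hubs_adj \<alpha> L \<pi>" "hubs_dominate \<alpha> L \<pi>"
    and "u \<in> \<pi>" "v \<in> \<pi>" "far \<alpha> \<pi> u v"
  shows "real (card u) < L" "0 < brk \<alpha> u"
proof -
  show less: "real (card u) < L"
  proof (rule ccontr)
    assume u: "\<not> real (card u) < L"
    show False
    proof (cases "real (card v) < L")
      case True
      then obtain w where w: "w \<in> \<pi>" "L \<le> real (card w)" "adj \<alpha> v w"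
        using assms(3,5) unfolding hubs_dominate_def by blast
      then have "w = u \<or> adj \<alpha> u w" using assms(2,4) u unfolding hubs_adj_def by (metis not_le)
      then show False using assms(6) w adj_sym unfolding far_def by blast
    next
      case False
      then show False using assms(2,4,5,6) u unfolding hubs_adj_def far_def by (metis not_le)
    qed
  qed
  obtain w where w: "w \<in> \<pi>" "L \<le> real (card w)" "adj \<alpha> u w"
    using assms(3,4) less unfolding hubs_dominate_def by blast
  then have "w \<noteq> u" using less by auto
  then have "u \<inter> w = {}" using assms(1,4) w(1) disjointD[of \<pi> u w] by (auto simp: partition_on_def)
  then obtain x where x: "x \<in> {x \<in> u. \<alpha> x \<notin> u}" using w(3) unfolding adj_def by blast
  have "finite u" using assms(1,4) fin by (auto simp: partition_on_def intro: finite_subset)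
  then have "finite {x \<in> u. \<alpha> x \<notin> u}" by simp
  then show "0 < brk \<alpha> u" unfolding brk_def using x card_gt_0_iff by blast
qed

lemma far_pairI:
  assumes p: "partition_on X \<pi>" and h: "hubs_adj \<alpha> L \<pi>" "hubs_dominate \<alpha> L \<pi>"
    and "u \<in> \<pi>" "v \<in> \<pi>" "far \<alpha> \<pi> u v" "K < card u \<or> K < card v" "larger K0 \<pi>"
  shows "far_pair K0 K L \<pi>"
proof -
  note a = far_hubs[OF p h assms(4,5,6)]
  note b = far_hubs[OF p h assms(5,4) assms(6)[unfolded far_sym[of _ u]]]
  show ?thesis
  proof (cases "card u \<le> card v")
    case True
    then have "K < card v" using assms(7) by linarith
    then show ?thesis unfolding far_pair_def using assms a b True by blast
  next
    case False
    then have "K < card u" "card v \<le> card u" using assms(7) by linarith+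
    then show ?thesis unfolding far_pair_def using assms a b far_sym by blast
  qed
qed

lemma diam_le_3:
  assumes p: "partition_on X \<pi>" and h: "hubs_adj \<alpha> L \<pi>" "hubs_dominate \<alpha> L \<pi>"
  shows "diam_le \<alpha> 3 \<pi>"
  unfolding diam_le_def
proof (intro ballI)
  fix u v assume uv: "u \<in> \<pi>" "v \<in> \<pi>"
  have n3: "near \<alpha> \<pi> 3 u v \<longleftrightarrow> u = v \<or> (\<exists>w\<in>\<pi>. adj \<alpha> u w \<and> near \<alpha> \<pi> 2 w v)" by (simp add: numeral_3_eq_3 numeral_2_eq_2)
  show "near \<alpha> \<pi> 3 u v"
  proof (cases "far \<alpha> \<pi> u v")
    case False
    then have "near \<alpha> \<pi> 2 u v" using near_2[OF uv(2)] by blast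
    then have "near \<alpha> \<pi> (Suc 2) u v" by (rule near_Suc)
    then show ?thesis by (simp add: numeral_3_eq_3 numeral_2_eq_2)
  next
    case True
    have "real (card u) < L" "real (card v) < L"
      using far_hubs(1)[OF p h uv True] far_hubs(1)[OF p h uv(2,1) True[unfolded far_sym[of _ u]]] by auto
    then obtain a b where ab: "a \<in> \<pi>" "L \<le> real (card a)" "adj \<alpha> u a" "b \<in> \<pi>" "L \<le> real (card b)" "adj \<alpha> v b"
      using h(2) uv unfolding hubs_dominate_def by meson
    have "a = b \<or> adj \<alpha> a b" using h(1) ab unfolding hubs_adj_def by blast
    then have "near \<alpha> \<pi> 2 a v"
      unfolding near_2[OF uv(2)] far_def using ab adj_sym by blast
    then show ?thesis unfolding n3 using ab by blast
  qed
qed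

lemma EP_not_hubs:
  assumes L: "L = real (card X) powr (3/4)" "2 * L \<le> real (card X)" and N4: "4 \<le> card X"
  shows "EP X (\<lambda>\<pi>. of_bool (\<not> (hubs_adj \<alpha> L \<pi> \<and> hubs_dominate \<alpha> L \<pi>))) \<le> hub_bound (card X)"
proof -
  have L0: "0 < L" unfolding L(1) using N4 by simp
  have "EP X (\<lambda>\<pi>. of_bool (\<not> (hubs_adj \<alpha> L \<pi> \<and> hubs_dominate \<alpha> L \<pi>))) \<le>
    EP X (\<lambda>\<pi>. of_bool (\<not> hubs_adj \<alpha> L \<pi>) + of_bool (\<not> hubs_dominate \<alpha> L \<pi>))"
    by (rule EP_mono[OF fin]) auto
  also have "\<dots> \<le> hub_bound (card X)"
    unfolding EP_add hub_bound_def L(1)[symmetric]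
    by (intro add_mono EP_not_hubs_adj EP_not_hubs_dominate L0 L(2) N4)
  finally show ?thesis .
qed

lemma EP_far_pair_tail:
  assumes "0 < L" "2 * L \<le> real (card X)" "4 \<le> card X"
  shows "EP X (\<lambda>\<pi>. of_bool (far_pair K0 K L \<pi>)) \<le> 1 / (real K0 + 1) * tail_bound K"
  using EP_far_pair[OF assms, of K0 K]
    mult_left_mono[OF sum_le_tail_bound[of K "card X"], of "1 / (real K0 + 1)"] by simp

lemma EP_diam_le_3:
  assumes "2 * real (card X) powr (3/4) \<le> real (card X)" "4 \<le> card X"
  shows "1 - hub_bound (card X) \<le> EP X (\<lambda>\<pi>. of_bool (diam_le \<alpha> 3 \<pi>))"
proof -
  let ?L = "real (card X) powr (3/4)"
  have "1 = EP X (\<lambda>_. 1)" using fin by (simp add: EP_const)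
  also have "\<dots> \<le> EP X (\<lambda>\<pi>. of_bool (diam_le \<alpha> 3 \<pi>) + of_bool (\<not> (hubs_adj \<alpha> ?L \<pi> \<and> hubs_dominate \<alpha> ?L \<pi>)))"
    by (rule EP_mono[OF fin]) (use diam_le_3 in auto)
  also have "\<dots> \<le> EP X (\<lambda>\<pi>. of_bool (diam_le \<alpha> 3 \<pi>)) + hub_bound (card X)"
    unfolding EP_add by (intro add_left_mono EP_not_hubs) (use assms in auto)
  finally show ?thesis by simp
qed

lemma EP_diam_le_2_approx:
  assumes "2 * real (card X) powr (3/4) \<le> real (card X)" "4 \<le> card X"
  shows "\<bar>EP X (\<lambda>\<pi>. of_bool (diam_le \<alpha> 2 \<pi>)) - EP X (\<lambda>\<pi>. of_bool (small_close K \<pi>))\<bar> \<le>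
    hub_bound (card X) + tail_bound K"
proof -
  let ?L = "real (card X) powr (3/4)"
  have L0: "0 < ?L" using assms by simp
  have "EP X (\<lambda>\<pi>. of_bool (diam_le \<alpha> 2 \<pi>)) \<le> EP X (\<lambda>\<pi>. of_bool (small_close K \<pi>))"
    by (rule EP_mono[OF fin]) (auto simp: diam_le_2_iff small_close_def)
  moreover have "EP X (\<lambda>\<pi>. of_bool (small_close K \<pi>)) \<le> EP X (\<lambda>\<pi>. of_bool (diam_le \<alpha> 2 \<pi>) +
      (of_bool (\<not> (hubs_adj \<alpha> ?L \<pi> \<and> hubs_dominate \<alpha> ?L \<pi>)) + of_bool (far_pair 0 K ?L \<pi>)))"
  proof (rule EP_mono[OF fin])
    fix \<pi> assume p: "partition_on X \<pi>"
    \<comment> \<open>With \<open>K0 = 0\<close> this condition only says that blocks are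
      nonempty.\<close>
    have l0: "larger 0 \<pi>"
    proof
      fix A assume "A \<in> \<pi>"
      then have "A \<noteq> {}" "finite A" using p fin by (auto simp: partition_on_def intro: finite_subset)
      then show "0 < card A" by (simp add: card_gt_0_iff)
    qed
    have "diam_le \<alpha> 2 \<pi>" if "small_close K \<pi>" "hubs_adj \<alpha> ?L \<pi>" "hubs_dominate \<alpha> ?L \<pi>" "\<not> far_pair 0 K ?L \<pi>"
    proof (rule ccontr)
      assume "\<not> diam_le \<alpha> 2 \<pi>"
      then obtain u v where uv: "u \<in> \<pi>" "v \<in> \<pi>" "far \<alpha> \<pi> u v" unfolding diam_le_2_iff by blast
      then have "K < card u \<or> K < card v" using that(1) unfolding small_close_def by (meson not_le)
      then show False using far_pairI[OF p that(2,3) uv _ l0] that(4) by blast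
    qed
    then show "of_bool (small_close K \<pi>) \<le> of_bool (diam_le \<alpha> 2 \<pi>) +
      (of_bool (\<not> (hubs_adj \<alpha> ?L \<pi> \<and> hubs_dominate \<alpha> ?L \<pi>)) + (of_bool (far_pair 0 K ?L \<pi>) :: real))" by auto
  qed
  moreover have "\<dots> \<le> EP X (\<lambda>\<pi>. of_bool (diam_le \<alpha> 2 \<pi>)) + (hub_bound (card X) + 1 / (real 0 + 1) * tail_bound K)"
    unfolding EP_add by (intro add_left_mono add_mono EP_not_hubs EP_far_pair_tail L0) (use assms in auto)
  ultimately show ?thesis by (simp add: abs_le_iff)
qed

text \<open>When all degrees exceed \<open>K\<close>, every distant pair is an instance of
  \<open>far_pair K K\<close>, and the factor \<open>1 / (K + 1)\<close> of its bound is comparable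
  with the main term \<open>1 / (2 * K + 1)\<close>. A tail below \<open>1 / 2\<close> already makes
  the difference of these two positive.\<close>

lemma EP_diam_le_2_ge:
  assumes "2 * real (card X) powr (3/4) \<le> real (card X)" "4 \<le> card X" "K < card X"
  shows "1 / (2 * real K + 1) - hub_bound (card X) - 1 / (real K + 1) * tail_bound K \<le>
    EP X (\<lambda>\<pi>. of_bool (diam_le \<alpha> 2 \<pi>))"
proof -
  let ?L = "real (card X) powr (3/4)"
  have L0: "0 < ?L" using assms by simp
  have "1 / (2 * real K + 1) \<le> EP X (\<lambda>\<pi>. of_bool (larger K \<pi>))"
    by (rule EP_larger_ge[OF fin assms(3)])
  also have "\<dots> \<le> EP X (\<lambda>\<pi>. of_bool (diam_le \<alpha> 2 \<pi>) +
      (of_bool (\<not> (hubs_adj \<alpha> ?L \<pi> \<and> hubs_dominate \<alpha> ?L \<pi>)) + of_bool (far_pair K K ?L \<pi>)))"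
  proof (rule EP_mono[OF fin])
    fix \<pi> assume p: "partition_on X \<pi>"
    have "diam_le \<alpha> 2 \<pi>" if "larger K \<pi>" "hubs_adj \<alpha> ?L \<pi>" "hubs_dominate \<alpha> ?L \<pi>" "\<not> far_pair K K ?L \<pi>"
    proof (rule ccontr)
      assume "\<not> diam_le \<alpha> 2 \<pi>"
      then obtain u v where uv: "u \<in> \<pi>" "v \<in> \<pi>" "far \<alpha> \<pi> u v" unfolding diam_le_2_iff by blast
      then have "K < card u \<or> K < card v" using that(1) by blast
      then show False using far_pairI[OF p that(2,3) uv _ that(1)] that(4) by blast
    qed
    then show "of_bool (larger K \<pi>) \<le> of_bool (diam_le \<alpha> 2 \<pi>) +
      (of_bool (\<not> (hubs_adj \<alpha> ?L \<pi> \<and> hubs_dominate \<alpha> ?L \<pi>)) + (of_bool (far_pair K K ?L \<pi>) :: real))" by auto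
  qed
  also have "\<dots> \<le> EP X (\<lambda>\<pi>. of_bool (diam_le \<alpha> 2 \<pi>)) + (hub_bound (card X) + 1 / (real K + 1) * tail_bound K)"
    unfolding EP_add by (intro add_left_mono add_mono EP_not_hubs EP_far_pair_tail L0) (use assms in auto)
  finally show ?thesis by linarith
qed

end

section \<open>Distances in labeled maps\<close>

definition matchings :: "nat \<Rightarrow> (nat \<Rightarrow> nat) set" where
  "matchings n = {\<alpha>. \<alpha> permutes {1..2*n} \<and> \<alpha> \<circ> \<alpha> = id \<and> (\<forall>i\<in>{1..2*n}. \<alpha> i \<noteq> i)}"

lemma pairing_matching: "\<alpha> \<in> matchings n \<Longrightarrow> pairing {1..2*n} \<alpha>"
  by unfold_locales (auto simp: matchings_def fun_eq_iff permutes_in_image simp del: atLeastAtMost_iff)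

lemma finite_matchings: "finite (matchings n)"
  by (rule finite_subset[of _ "{p. p permutes {1..2*n}}"]) (auto simp: matchings_def finite_permutations)

lemma labeled_maps_subset: "labeled_maps n \<subseteq> matchings n \<times> {\<phi>. \<phi> permutes {1..2*n}}"
  by (auto simp: labeled_maps_def matchings_def)

lemma matchings_nonempty: "matchings n \<noteq> {}"
  using labeled_maps_nonempty[of n] labeled_maps_subset[of n] by auto

lemma orbit_eq_block:
  assumes "\<sigma> permutes X" "finite X" "u \<in> blocks \<sigma> X" "x \<in> u"
  shows "x \<in> X" "orbit \<sigma> x = u"
proof -
  have p: "partition_on X (blocks \<sigma> X)" by (rule partition_on_blocks[OF assms(1,2)])
  show x: "x \<in> X" using p assms(3,4) by (auto simp: partition_on_def)
  have "orbit \<sigma> x \<in> blocks \<sigma> X" "x \<in> orbit \<sigma> x"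
    using x self_in_orbit_permutes[OF assms(1,2)] by (auto simp: blocks_def)
  then show "orbit \<sigma> x = u" using partition_block_at[OF p x] assms(3,4) by metis
qed

locale map_pair =
  fixes n :: nat and \<alpha> \<phi> \<sigma> :: "nat \<Rightarrow> nat"
  assumes \<alpha>: "\<alpha> \<in> matchings n" and \<phi>: "\<phi> permutes {1..2*n}" and \<sigma>_eq: "\<sigma> = \<phi> \<circ> \<alpha>"
begin

abbreviation "X \<equiv> {1..2*n}"
abbreviation "\<pi> \<equiv> blocks \<sigma> X"
abbreviation "G \<equiv> map_graph n (\<alpha>, \<phi>)"

lemma \<alpha>_in: "i \<in> X \<Longrightarrow> \<alpha> i \<in> X"
  using \<alpha> permutes_in_image[of \<alpha> X i] by (simp add: matchings_def)

lemma \<sigma>: "\<sigma> permutes X"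
  unfolding \<sigma>_eq using \<alpha> \<phi> by (intro permutes_compose) (simp_all add: matchings_def)

lemma G_simps: "verts G = \<pi>" "arcs G = X" "tail G i = orbit \<sigma> i" "head G i = orbit \<sigma> (\<alpha> i)"
  by (simp_all only: map_graph_def blocks_def \<sigma>_eq prod.case pre_digraph.simps)

lemma wf_G: "wf_digraph G"
  by unfold_locales (use \<alpha>_in in \<open>auto simp: map_graph_def\<close>)

lemma near_iff_awalk:
  assumes "u \<in> \<pi>" "v \<in> \<pi>"
  shows "near \<alpha> \<pi> k u v \<longleftrightarrow> (\<exists>p. pre_digraph.awalk G u p v \<and> length p \<le> k)"
proof -
  interpret wf_digraph G by (rule wf_G)
  have self: "x \<in> orbit \<sigma> x" for x by (rule self_in_orbit_permutes[OF \<sigma>]) simp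
  show ?thesis using assms(1)
  proof (induction k arbitrary: u)
    case 0
    then show ?case by (auto simp: awalk_Nil_iff G_simps)
  next
    case (Suc k)
    have step: "(\<exists>w\<in>\<pi>. adj \<alpha> u w \<and> near \<alpha> \<pi> k w v) \<longleftrightarrow>
      (\<exists>e p. awalk u (e # p) v \<and> length p \<le> k)"
    proof
      assume "\<exists>w\<in>\<pi>. adj \<alpha> u w \<and> near \<alpha> \<pi> k w v"
      then obtain w x where w: "w \<in> \<pi>" "near \<alpha> \<pi> k w v" "x \<in> u" "\<alpha> x \<in> w" unfolding adj_def by blast
      obtain p where p: "awalk w p v" "length p \<le> k" using Suc.IH[OF w(1)] w(2) by blast
      have "x \<in> X" "orbit \<sigma> x = u" using orbit_eq_block[OF \<sigma> _ Suc.prems w(3)] by auto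
      moreover have "orbit \<sigma> (\<alpha> x) = w" using orbit_eq_block[OF \<sigma> _ w(1,4)] by auto
      ultimately have "awalk u (x # p) v" using p by (simp add: awalk_Cons_iff G_simps)
      then show "\<exists>e p. awalk u (e # p) v \<and> length p \<le> k" using p by blast
    next
      assume "\<exists>e p. awalk u (e # p) v \<and> length p \<le> k"
      then obtain e p where e: "e \<in> X" "u = orbit \<sigma> e" "awalk (orbit \<sigma> (\<alpha> e)) p v" "length p \<le> k"
        by (auto simp: awalk_Cons_iff G_simps)
      have w: "orbit \<sigma> (\<alpha> e) \<in> \<pi>" using \<alpha>_in[OF e(1)] unfolding blocks_def by blast
      have "adj \<alpha> u (orbit \<sigma> (\<alpha> e))" unfolding adj_def e(2) using self by blast
      then show "\<exists>w\<in>\<pi>. adj \<alpha> u w \<and> near \<alpha> \<pi> k w v" using w Suc.IH[OF w] e by blast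
    qed
    have "near \<alpha> \<pi> (Suc k) u v \<longleftrightarrow> awalk u [] v \<or> (\<exists>e p. awalk u (e # p) v \<and> length p \<le> k)"
      unfolding step[symmetric] using Suc.prems by (auto simp: awalk_Nil_iff G_simps)
    also have "\<dots> \<longleftrightarrow> (\<exists>p. awalk u p v \<and> length p \<le> Suc k)"
    proof
      assume "awalk u [] v \<or> (\<exists>e p. awalk u (e # p) v \<and> length p \<le> k)"
      then show "\<exists>p. awalk u p v \<and> length p \<le> Suc k"
        by (metis Suc_le_mono length_Cons list.size(3) zero_le)
    next
      assume "\<exists>p. awalk u p v \<and> length p \<le> Suc k"
      then obtain p where "awalk u p v" "length p \<le> Suc k" by blast
      then show "awalk u [] v \<or> (\<exists>e p. awalk u (e # p) v \<and> length p \<le> k)" by (cases p) auto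
    qed
    finally show ?case .
  qed
qed

text \<open>The distance is an infimum over walks in \<open>ereal\<close>. The second claim includes
  pairs without any connecting walk, since the infimum over the empty set is infinite.\<close>

lemma graph_dist_near:
  assumes "u \<in> \<pi>" "v \<in> \<pi>"
  shows "near \<alpha> \<pi> k u v \<Longrightarrow> graph_dist G u v \<le> ereal (real k)"
    and "\<not> near \<alpha> \<pi> k u v \<Longrightarrow> ereal (real (Suc k)) \<le> graph_dist G u v"
proof -
  interpret wf_digraph G by (rule wf_G)
  have cost: "awalk_cost (\<lambda>_. 1) p = real (length p)" for p :: "nat list" by (induction p) auto
  have dist: "graph_dist G u v = (INF p\<in>{p. awalk u p v}. ereal (real (length p)))"
    unfolding graph_dist_def \<mu>_def cost ..
  show "graph_dist G u v \<le> ereal (real k)" if "near \<alpha> \<pi> k u v"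
    using that unfolding near_iff_awalk[OF assms] dist by (auto intro!: INF_lower2)
  show "ereal (real (Suc k)) \<le> graph_dist G u v" if "\<not> near \<alpha> \<pi> k u v"
    unfolding dist
  proof (rule INF_greatest)
    fix p assume "p \<in> {p. awalk u p v}"
    then have "Suc k \<le> length p" using that unfolding near_iff_awalk[OF assms] by (auto simp: not_le Suc_le_eq)
    then show "ereal (real (Suc k)) \<le> ereal (real (length p))" by simp
  qed
qed

lemma graph_diameter_le: "diam_le \<alpha> k \<pi> \<Longrightarrow> graph_diameter G \<le> ereal (real k)"
  unfolding graph_diameter_def G_simps diam_le_def by (intro SUP_least graph_dist_near(1)) auto

lemma graph_diameter_ge: "\<not> diam_le \<alpha> k \<pi> \<Longrightarrow> ereal (real (Suc k)) \<le> graph_diameter G"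
proof -
  assume "\<not> diam_le \<alpha> k \<pi>"
  then obtain u v where uv: "u \<in> \<pi>" "v \<in> \<pi>" "\<not> near \<alpha> \<pi> k u v" unfolding diam_le_def by blast
  have "ereal (real (Suc k)) \<le> graph_dist G u v" by (rule graph_dist_near(2)[OF uv])
  also have "\<dots> \<le> (SUP v\<in>verts G. graph_dist G u v)" by (rule SUP_upper) (use uv in \<open>simp add: G_simps\<close>)
  also have "\<dots> \<le> graph_diameter G"
    unfolding graph_diameter_def by (rule SUP_upper) (use uv in \<open>simp add: G_simps\<close>)
  finally show ?thesis .
qed

lemma graph_diameter_eq_iff:
  "graph_diameter G = ereal (real (Suc k)) \<longleftrightarrow> diam_le \<alpha> (Suc k) \<pi> \<and> \<not> diam_le \<alpha> k \<pi>"
proof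
  assume e: "graph_diameter G = ereal (real (Suc k))"
  have "diam_le \<alpha> (Suc k) \<pi>"
  proof (rule ccontr)
    assume "\<not> diam_le \<alpha> (Suc k) \<pi>"
    from graph_diameter_ge[OF this] show False unfolding e by simp
  qed
  moreover have "\<not> diam_le \<alpha> k \<pi>"
  proof
    assume "diam_le \<alpha> k \<pi>"
    from graph_diameter_le[OF this] show False unfolding e by simp
  qed
  ultimately show "diam_le \<alpha> (Suc k) \<pi> \<and> \<not> diam_le \<alpha> k \<pi>" by blast
next
  assume "diam_le \<alpha> (Suc k) \<pi> \<and> \<not> diam_le \<alpha> k \<pi>"
  then show "graph_diameter G = ereal (real (Suc k))"
    using graph_diameter_le[of "Suc k"] graph_diameter_ge[of k] by (intro antisym) auto
qed

text \<open>Crossing an edge applies \<open>\<alpha>\<close>, and moving around a vertex applies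
  \<open>\<sigma> = \<phi> \<circ> \<alpha>\<close>, so a walk between two vertices turns into a
  group element that carries \<open>i\<close> to \<open>j\<close>.\<close>

lemma diam_le_imp_labeled_map:
  assumes "diam_le \<alpha> k \<pi>"
  shows "(\<alpha>, \<phi>) \<in> labeled_maps n"
proof -
  let ?H = "generate (sym_group (2*n)) {\<alpha>, \<phi>}"
  have st: "\<exists>g\<in>?H. g i = s j" if reach: "\<exists>g\<in>?H. g i = j" "s \<in> {\<alpha>, \<phi>}" for i j s
  proof -
    obtain g where g: "g \<in> ?H" "g i = j" using reach by blast
    have "s \<otimes>\<^bsub>sym_group (2*n)\<^esub> g \<in> ?H" by (rule generate.eng[OF generate.incl[OF reach(2)] g(1)])
    then show ?thesis using g by (intro bexI[of _ "s \<circ> g"]) (auto simp: sym_group_mult)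
  qed
  have orb: "\<exists>g\<in>?H. g i = y" if "y \<in> orbit \<sigma> x" "\<exists>g\<in>?H. g i = x" for i x y
    using that(1)
  proof (induction rule: orbit.induct)
    case base
    show ?case using st[OF st[OF that(2), of \<alpha>], of \<phi>] by (simp add: \<sigma>_eq)
  next
    case (step y)
    show ?case using st[OF st[OF step.IH, of \<alpha>], of \<phi>] by (simp add: \<sigma>_eq)
  qed
  have walk: "\<exists>g\<in>?H. g i = y" if "near \<alpha> \<pi> k u v" "u \<in> \<pi>" "\<And>x. x \<in> u \<Longrightarrow> \<exists>g\<in>?H. g i = x" "y \<in> v" for i k u v y
    using that
  proof (induction k arbitrary: u)
    case (Suc k)
    show ?case
    proof (cases "u = v")
      case False
      then obtain w x where w: "w \<in> \<pi>" "near \<alpha> \<pi> k w v" "x \<in> u" "\<alpha> x \<in> w"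
        using Suc.prems(1) unfolding near.simps adj_def by blast
      have "\<exists>g\<in>?H. g i = \<alpha> x" using st[OF Suc.prems(3)[OF w(3)], of \<alpha>] by simp
      moreover have "orbit \<sigma> (\<alpha> x) = w" using orbit_eq_block[OF \<sigma> _ w(1,4)] by auto
      ultimately have "\<exists>g\<in>?H. g i = z" if "z \<in> w" for z using orb[of z "\<alpha> x" i] that by simp
      then show ?thesis using Suc.IH[OF w(2,1)] Suc.prems(4) by blast
    qed (use Suc.prems in auto)
  qed auto
  have "\<exists>g\<in>?H. g i = j" if ij: "i \<in> X" "j \<in> X" for i j
  proof (rule walk)
    show "near \<alpha> \<pi> k (orbit \<sigma> i) (orbit \<sigma> j)"
      using assms ij unfolding diam_le_def blocks_def by blast
    show "orbit \<sigma> i \<in> \<pi>" using ij unfolding blocks_def by blast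
    show "j \<in> orbit \<sigma> j" by (rule self_in_orbit_permutes[OF \<sigma>]) simp
    have "id \<in> ?H" using generate.one[of "sym_group (2*n)"] by (simp add: sym_group_one)
    then have "\<exists>g\<in>?H. g i = i" by (intro bexI[of _ id]) auto
    then show "\<exists>g\<in>?H. g i = x" if "x \<in> orbit \<sigma> i" for x using orb[OF that] by blast
  qed
  then show ?thesis using \<alpha> \<phi> by (auto simp: labeled_maps_def matchings_def)
qed

end

text \<open>The pairs \<open>(\<alpha>, \<phi>)\<close> are uniform here, without the connectivity condition.\<close>

definition pair_prob :: "nat \<Rightarrow> ((nat \<Rightarrow> nat) \<Rightarrow> nat set set \<Rightarrow> bool) \<Rightarrow> real" where
  "pair_prob n F = (\<Sum>\<alpha>\<in>matchings n. EP {1..2*n} (\<lambda>\<pi>. of_bool (F \<alpha> \<pi>))) / card (matchings n)"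

text \<open>For fixed \<open>\<alpha>\<close>, composing on the right with \<open>\<alpha>\<close>
  permutes the set of permutations, so \<open>\<phi> \<circ> \<alpha>\<close> is uniform when
  \<open>\<phi>\<close> is.\<close>

lemma card_pairs:
  "real (card {(\<alpha>, \<phi>) \<in> matchings n \<times> {\<phi>. \<phi> permutes {1..2*n}}. F \<alpha> (blocks (\<phi> \<circ> \<alpha>) {1..2*n})}) =
    fact (2*n) * card (matchings n) * pair_prob n F"
proof -
  let ?X = "{1..2*n}"
  let ?S = "{\<phi>. \<phi> permutes ?X}"
  have finS: "finite ?S" by (simp add: finite_permutations)
  have "real (card {(\<alpha>, \<phi>) \<in> matchings n \<times> ?S. F \<alpha> (blocks (\<phi> \<circ> \<alpha>) ?X)}) =
    (\<Sum>z\<in>matchings n \<times> ?S. of_bool (case z of (\<alpha>, \<phi>) \<Rightarrow> F \<alpha> (blocks (\<phi> \<circ> \<alpha>) ?X)))"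
    using finS finite_matchings by (subst sum_of_bool_eq) (auto intro!: arg_cong[where f = card])
  also have "\<dots> = (\<Sum>\<alpha>\<in>matchings n. \<Sum>\<phi>\<in>?S. of_bool (F \<alpha> (blocks (\<phi> \<circ> \<alpha>) ?X)))"
    by (simp add: sum.cartesian_product case_prod_unfold)
  also have "\<dots> = (\<Sum>\<alpha>\<in>matchings n. fact (2*n) * EP ?X (\<lambda>\<pi>. of_bool (F \<alpha> \<pi>)))"
  proof (rule sum.cong)
    fix \<alpha> assume "\<alpha> \<in> matchings n"
    then have "\<alpha> permutes ?X" by (simp add: matchings_def)
    then have "(\<Sum>\<phi>\<in>?S. of_bool (F \<alpha> (blocks (\<phi> \<circ> \<alpha>) ?X))) = (\<Sum>\<sigma>\<in>?S. of_bool (F \<alpha> (blocks \<sigma> ?X)) :: real)"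
      by (rule sum_permutations_compose_right[symmetric])
    then show "(\<Sum>\<phi>\<in>?S. of_bool (F \<alpha> (blocks (\<phi> \<circ> \<alpha>) ?X))) = fact (2*n) * EP ?X (\<lambda>\<pi>. of_bool (F \<alpha> \<pi>))"
      unfolding EP_def by simp
  qed simp
  also have "\<dots> = fact (2*n) * card (matchings n) * pair_prob n F"
    unfolding pair_prob_def sum_distrib_left[symmetric] using matchings_nonempty finite_matchings by simp
  finally show ?thesis .
qed

lemma pair_prob_bounds:
  assumes "\<And>\<alpha>. pairing {1..2*n} \<alpha> \<Longrightarrow> l \<le> EP {1..2*n} (\<lambda>\<pi>. of_bool (F \<alpha> \<pi>))"
    and "\<And>\<alpha>. pairing {1..2*n} \<alpha> \<Longrightarrow> EP {1..2*n} (\<lambda>\<pi>. of_bool (F \<alpha> \<pi>)) \<le> u"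
  shows "l \<le> pair_prob n F" "pair_prob n F \<le> u"
proof -
  have pos: "real (card (matchings n)) > 0" using matchings_nonempty finite_matchings by (simp add: card_gt_0_iff)
  have "(\<Sum>\<alpha>\<in>matchings n. l) \<le> (\<Sum>\<alpha>\<in>matchings n. EP {1..2*n} (\<lambda>\<pi>. of_bool (F \<alpha> \<pi>)))"
    by (rule sum_mono) (use assms(1) pairing_matching in auto)
  then show "l \<le> pair_prob n F" unfolding pair_prob_def using pos by (simp add: le_divide_eq mult.commute)
  have "(\<Sum>\<alpha>\<in>matchings n. EP {1..2*n} (\<lambda>\<pi>. of_bool (F \<alpha> \<pi>))) \<le> (\<Sum>\<alpha>\<in>matchings n. u)"
    by (rule sum_mono) (use assms(2) pairing_matching in auto)
  then show "pair_prob n F \<le> u" unfolding pair_prob_def using pos by (simp add: divide_le_eq mult.commute)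
qed

lemma pair_prob_diff:
  assumes "\<And>\<alpha> \<pi>. F \<alpha> \<pi> \<Longrightarrow> F' \<alpha> \<pi>"
  shows "pair_prob n (\<lambda>\<alpha> \<pi>. F' \<alpha> \<pi> \<and> \<not> F \<alpha> \<pi>) = pair_prob n F' - pair_prob n F"
proof -
  have e: "of_bool (F' \<alpha> \<pi> \<and> \<not> F \<alpha> \<pi>) = (of_bool (F' \<alpha> \<pi>) - of_bool (F \<alpha> \<pi>) :: real)" for \<alpha> \<pi>
    using assms[of \<alpha> \<pi>] by auto
  show ?thesis unfolding pair_prob_def e EP_diff sum_subtractf diff_divide_distrib ..
qed

text \<open>A pair whose graph has diameter \<open>Suc k\<close> is automatically a labeled map.
  Conditioning on connectedness thus only divides by the fraction of pairs that are labeled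
  maps.\<close>

lemma prob_random_map_diameter:
  "measure_pmf.prob (random_map n) {M. graph_diameter (map_graph n M) = ereal (real (Suc k))} =
    (pair_prob n (\<lambda>\<alpha>. diam_le \<alpha> (Suc k)) - pair_prob n (\<lambda>\<alpha>. diam_le \<alpha> k)) /
    (card (labeled_maps n) / (fact (2*n) * card (matchings n)))"
proof -
  let ?P = "matchings n \<times> {\<phi>. \<phi> permutes {1..2*n}}"
  have "labeled_maps n \<inter> {M. graph_diameter (map_graph n M) = ereal (real (Suc k))} =
    {(\<alpha>, \<phi>) \<in> ?P. diam_le \<alpha> (Suc k) (blocks (\<phi> \<circ> \<alpha>) {1..2*n}) \<and> \<not> diam_le \<alpha> k (blocks (\<phi> \<circ> \<alpha>) {1..2*n})}"
  proof -
    have "M \<in> labeled_maps n \<and> graph_diameter (map_graph n M) = ereal (real (Suc k)) \<longleftrightarrow>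
      (case M of (\<alpha>, \<phi>) \<Rightarrow> diam_le \<alpha> (Suc k) (blocks (\<phi> \<circ> \<alpha>) {1..2*n}) \<and> \<not> diam_le \<alpha> k (blocks (\<phi> \<circ> \<alpha>) {1..2*n}))"
      if "M \<in> ?P" for M
    proof -
      obtain \<alpha> \<phi> where M: "M = (\<alpha>, \<phi>)" by (cases M)
      interpret map_pair n \<alpha> \<phi> "\<phi> \<circ> \<alpha>" by unfold_locales (use that M in auto)
      show ?thesis unfolding M using graph_diameter_eq_iff[of k] diam_le_imp_labeled_map[of "Suc k"] by auto
    qed
    then show ?thesis using labeled_maps_subset[of n] by blast
  qed
  then have "real (card (labeled_maps n \<inter> {M. graph_diameter (map_graph n M) = ereal (real (Suc k))})) =
    fact (2*n) * card (matchings n) * pair_prob n (\<lambda>\<alpha> \<pi>. diam_le \<alpha> (Suc k) \<pi> \<and> \<not> diam_le \<alpha> k \<pi>)"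
    using card_pairs[of n "\<lambda>\<alpha> \<pi>. diam_le \<alpha> (Suc k) \<pi> \<and> \<not> diam_le \<alpha> k \<pi>"] by simp
  also have "pair_prob n (\<lambda>\<alpha> \<pi>. diam_le \<alpha> (Suc k) \<pi> \<and> \<not> diam_le \<alpha> k \<pi>) =
    pair_prob n (\<lambda>\<alpha>. diam_le \<alpha> (Suc k)) - pair_prob n (\<lambda>\<alpha>. diam_le \<alpha> k)"
    by (rule pair_prob_diff) (rule diam_le_Suc)
  finally show ?thesis
    unfolding random_map_def measure_pmf_of_set[OF labeled_maps_nonempty finite_labeled_maps] by simp
qed

text \<open>For \<open>k = 3\<close> the lower bound tends to 1, so the fraction of connected pairs
  does as well.\<close>

lemma labeled_fraction_bounds:
  "pair_prob n (\<lambda>\<alpha>. diam_le \<alpha> k) \<le> card (labeled_maps n) / (fact (2*n) * card (matchings n))"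
  "card (labeled_maps n) / (fact (2*n) * card (matchings n)) \<le> 1"
proof -
  let ?P = "matchings n \<times> {\<phi>. \<phi> permutes {1..2*n}}"
  have finP: "finite ?P" using finite_matchings finite_permutations[of "{1..2*n}"] by simp
  have pos: "fact (2*n) * real (card (matchings n)) > 0"
    using matchings_nonempty finite_matchings by (simp add: card_gt_0_iff)
  have "{(\<alpha>, \<phi>) \<in> ?P. diam_le \<alpha> k (blocks (\<phi> \<circ> \<alpha>) {1..2*n})} \<subseteq> labeled_maps n"
    using map_pair.diam_le_imp_labeled_map[OF map_pair.intro[OF _ _ refl]] by blast
  then have "card {(\<alpha>, \<phi>) \<in> ?P. diam_le \<alpha> k (blocks (\<phi> \<circ> \<alpha>) {1..2*n})} \<le> card (labeled_maps n)"
    by (intro card_mono finite_labeled_maps)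
  then have "fact (2*n) * card (matchings n) * pair_prob n (\<lambda>\<alpha>. diam_le \<alpha> k) \<le> card (labeled_maps n)"
    unfolding card_pairs[of n "\<lambda>\<alpha>. diam_le \<alpha> k", symmetric] by simp
  then show "pair_prob n (\<lambda>\<alpha>. diam_le \<alpha> k) \<le> card (labeled_maps n) / (fact (2*n) * card (matchings n))"
    using pos by (simp add: le_divide_eq mult_ac)
  have "card (labeled_maps n) \<le> card ?P" by (intro card_mono finP labeled_maps_subset)
  also have "card ?P = card (matchings n) * fact (2*n)"
    using card_permutations[of "{1..2*n}" "2*n"] by (simp add: card_cartesian_product)
  finally have "real (card (labeled_maps n)) \<le> real (card (matchings n) * fact (2*n))" by (rule of_nat_mono)
  then show "card (labeled_maps n) / (fact (2*n) * card (matchings n)) \<le> 1"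
    using pos by (simp add: divide_le_eq mult_ac)
qed

section \<open>Convergence\<close>

definition small_limit :: "nat \<Rightarrow> real" where
  "small_limit K = (\<Sum>s. limit_coeff K ({..<s} :: nat set))"

lemma sum_limit_coeff_tendsto:
  "(\<lambda>N. \<Sum>s\<le>N. limit_coeff K ({..<s} :: nat set)) \<longlonglongrightarrow> small_limit K"
  unfolding small_limit_def
proof (rule summable_LIMSEQ')
  show "summable (\<lambda>s. limit_coeff K ({..<s} :: nat set))"
  proof (rule summable_comparison_test)
    show "\<exists>N. \<forall>s\<ge>N. norm (limit_coeff K ({..<s} :: nat set)) \<le> 4 ^ 2 ^ (K + 2) * (1 / 2) ^ s"
    proof (intro exI allI impI)
      fix s :: nat
      show "norm (limit_coeff K ({..<s} :: nat set)) \<le> 4 ^ 2 ^ (K + 2) * (1 / 2) ^ s"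
        using abs_limit_coeff_le[of "{..<s}" K] by (simp add: power_one_over)
    qed
    show "summable (\<lambda>s. 4 ^ 2 ^ (K + 2) * (1 / 2) ^ s :: real)"
      by (intro summable_mult summable_geometric) simp
  qed
qed

lemma eventually_hub_size: "\<forall>\<^sub>F n in sequentially. 2 * real (2 * n) powr (3/4) \<le> real (2 * n)"
  by real_asymp

lemma filterlim_double: "filterlim (\<lambda>n::nat. 2 * n) at_top sequentially"
  by (rule filterlim_subseq) (simp add: strict_mono_def)

lemma hub_bound_double: "(\<lambda>n. hub_bound (2 * n)) \<longlonglongrightarrow> 0"
  by (rule filterlim_compose[OF hub_bound_tendsto filterlim_double])

lemma pair_prob_diam_3_tendsto: "(\<lambda>n. pair_prob n (\<lambda>\<alpha>. diam_le \<alpha> 3)) \<longlonglongrightarrow> 1"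
proof (rule tendsto_sandwich)
  show "\<forall>\<^sub>F n in sequentially. 1 - hub_bound (2 * n) \<le> pair_prob n (\<lambda>\<alpha>. diam_le \<alpha> 3)"
    using eventually_hub_size eventually_ge_at_top[of 2]
  proof eventually_elim
    case (elim n)
    show ?case
      by (rule pair_prob_bounds(1)[where u = 1])
        (use elim pairing.EP_diam_le_3[of "{1..2*n}"] in \<open>auto intro: EP_le_const\<close>)
  qed
  show "\<forall>\<^sub>F n in sequentially. pair_prob n (\<lambda>\<alpha>. diam_le \<alpha> 3) \<le> 1"
    by (intro always_eventually allI pair_prob_bounds(2)[where l = 0])
      (auto intro: EP_le_const EP_nonneg)
  show "(\<lambda>n. 1 - hub_bound (2 * n)) \<longlonglongrightarrow> 1"
    using tendsto_diff[OF tendsto_const[of 1] hub_bound_double] by simp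
qed auto

text \<open>\<open>K\<close> is fixed first, so that the part of the bound free of \<open>n\<close>
  is below \<open>e\<close>; the remaining term vanishes as \<open>n\<close> grows.\<close>

lemma pair_prob_diam_1_tendsto: "(\<lambda>n. pair_prob n (\<lambda>\<alpha>. diam_le \<alpha> 1)) \<longlonglongrightarrow> 0"
proof (rule LIMSEQ_I)
  fix e :: real assume e: "e > 0"
  let ?b = "\<lambda>K n. 1 / (real K + 1) + (1 / (real K + 1) + real K * ((real K + 1) / (real (2 * n) - real K))) * harm K"
  have "(\<lambda>K. 1 / (real K + 1) + 1 / (real K + 1) * harm K) \<longlonglongrightarrow> (0::real)"
  proof (rule tendsto_sandwich)
    show "\<forall>\<^sub>F K in sequentially. 0 \<le> 1 / (real K + 1) + 1 / (real K + 1) * (harm K :: real)"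
      by (simp add: harm_nonneg)
    show "\<forall>\<^sub>F K in sequentially. 1 / (real K + 1) + 1 / (real K + 1) * harm K \<le>
        1 / (real K + 1) + 1 / (real K + 1) * (ln (real K) + 1)"
      using eventually_gt_at_top[of 0]
      by eventually_elim (intro add_left_mono mult_left_mono harm_le_ln, auto)
    show "(\<lambda>K. 1 / (real K + 1) + 1 / (real K + 1) * (ln (real K) + 1)) \<longlonglongrightarrow> 0" by real_asymp
  qed auto
  then have "\<forall>\<^sub>F K in sequentially. 1 / (real K + 1) + 1 / (real K + 1) * harm K < e"
    using e by (rule order_tendstoD(2))
  then obtain K where K: "1 / (real K + 1) + 1 / (real K + 1) * harm K < e"
    using eventually_happens' trivial_limit_sequentially by blast
  have "(\<lambda>n. real K * ((real K + 1) / (real (2 * n) - real K))) \<longlonglongrightarrow> 0" by real_asymp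
  then have "?b K \<longlonglongrightarrow> 1 / (real K + 1) + (1 / (real K + 1) + 0) * harm K"
    by (intro tendsto_intros)
  then have "\<forall>\<^sub>F n in sequentially. ?b K n < e"
    using K by (intro order_tendstoD(2)) auto
  moreover have "\<forall>\<^sub>F n in sequentially. K < n" by (rule eventually_gt_at_top)
  ultimately have "\<forall>\<^sub>F n in sequentially. norm (pair_prob n (\<lambda>\<alpha>. diam_le \<alpha> 1) - 0) < e"
  proof eventually_elim
    case (elim n)
    have "pair_prob n (\<lambda>\<alpha>. diam_le \<alpha> 1) \<le> ?b K n"
      by (rule pair_prob_bounds(2)[where l = 0])
        (use elim pairing.EP_complete_le[of "{1..2*n}" _ K] in \<open>auto simp: diam_le_1_iff intro: EP_nonneg simp del: One_nat_def\<close>)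
    moreover have "0 \<le> pair_prob n (\<lambda>\<alpha>. diam_le \<alpha> 1)"
      by (rule pair_prob_bounds(1)[where u = 1]) (auto intro: EP_nonneg EP_le_const)
    ultimately show ?case using elim by simp
  qed
  then show "\<exists>no. \<forall>n\<ge>no. norm (pair_prob n (\<lambda>\<alpha>. diam_le \<alpha> 1) - 0) < e"
    by (simp add: eventually_sequentially)
qed

text \<open>The error splits into a part depending on \<open>K\<close> alone and a part
  \<open>e n\<close> that tends to 0 for fixed \<open>K\<close>; the sequence \<open>e\<close> may
  depend on \<open>K\<close>.\<close>

lemma pair_prob_diam_2_approx:
  obtains e where "e \<longlonglongrightarrow> 0"
    "\<forall>\<^sub>F n in sequentially. \<bar>pair_prob n (\<lambda>\<alpha>. diam_le \<alpha> 2) - small_limit K\<bar> \<le> tail_bound K + e n"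
proof
  let ?S = "\<lambda>N. \<Sum>s\<le>N. limit_coeff K ({..<s} :: nat set)"
  let ?D = "4 ^ 2 ^ (K + 2) :: real"
  let ?e = "\<lambda>n. hub_bound (2 * n) + 12 * ?D / (real (2 * n) - 1) + \<bar>?S (2 * n) - small_limit K\<bar>"
  show "?e \<longlonglongrightarrow> 0"
  proof -
    have "(\<lambda>n. ?S (2 * n)) \<longlonglongrightarrow> small_limit K"
      by (rule filterlim_compose[OF sum_limit_coeff_tendsto filterlim_double])
    then have "(\<lambda>n. \<bar>?S (2 * n) - small_limit K\<bar>) \<longlonglongrightarrow> 0"
      by (intro tendsto_rabs_zero) (simp add: LIM_zero_iff)
    moreover have "(\<lambda>n. c / (real (2 * n) - 1)) \<longlonglongrightarrow> 0" for c :: real by real_asymp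
    ultimately have "?e \<longlonglongrightarrow> 0 + 0 + 0" by (intro tendsto_add hub_bound_double)
    then show ?thesis by simp
  qed
  show "\<forall>\<^sub>F n in sequentially. \<bar>pair_prob n (\<lambda>\<alpha>. diam_le \<alpha> 2) - small_limit K\<bar> \<le> tail_bound K + ?e n"
    using eventually_hub_size eventually_ge_at_top[of 2]
  proof eventually_elim
    case (elim n)
    have "\<bar>EP {1..2*n} (\<lambda>\<pi>. of_bool (diam_le \<alpha> 2 \<pi>)) - small_limit K\<bar> \<le> tail_bound K + ?e n"
      if "pairing {1..2*n} \<alpha>" for \<alpha>
    proof -
      interpret pairing "{1..2*n}" \<alpha> by fact
      have "\<bar>EP {1..2*n} (\<lambda>\<pi>. of_bool (diam_le \<alpha> 2 \<pi>)) - EP {1..2*n} (\<lambda>\<pi>. of_bool (small_close K \<pi>))\<bar>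
          \<le> hub_bound (2 * n) + tail_bound K"
        using EP_diam_le_2_approx[of K] elim by simp
      moreover have "\<bar>EP {1..2*n} (\<lambda>\<pi>. of_bool (small_close K \<pi>)) - ?S (2 * n)\<bar> \<le> 12 * ?D / (real (2 * n) - 1)"
        using EP_small_close_approx[of K] elim by simp
      ultimately show ?thesis by linarith
    qed
    then have "small_limit K - (tail_bound K + ?e n) \<le> EP {1..2*n} (\<lambda>\<pi>. of_bool (diam_le \<alpha> 2 \<pi>))"
      "EP {1..2*n} (\<lambda>\<pi>. of_bool (diam_le \<alpha> 2 \<pi>)) \<le> small_limit K + (tail_bound K + ?e n)"
      if "pairing {1..2*n} \<alpha>" for \<alpha>
      using that by (fastforce simp: abs_le_iff)+
    from pair_prob_bounds[where F = "\<lambda>\<alpha>. diam_le \<alpha> 2", OF this] show ?case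
      by (simp add: abs_le_iff)
  qed
qed

text \<open>\<open>small_limit K\<close> approximates late terms up to about
  \<open>tail_bound K\<close>, so two late terms differ by little once \<open>K\<close> is large.
  Existence of the limit follows by completeness, without an explicit value.\<close>

lemma pair_prob_diam_2_tendsto:
  obtains p where "0 < p" "p < 1" "(\<lambda>n. pair_prob n (\<lambda>\<alpha>. diam_le \<alpha> 2)) \<longlonglongrightarrow> p"
proof -
  let ?a = "\<lambda>n. pair_prob n (\<lambda>\<alpha>. diam_le \<alpha> 2)"
  have "Cauchy ?a"
  proof (rule metric_CauchyI)
    fix r :: real assume r: "r > 0"
    have "\<forall>\<^sub>F K in sequentially. tail_bound K < r / 4"
      using tail_bound_tendsto r by (intro order_tendstoD(2)) auto
    then obtain K where K: "tail_bound K < r / 4"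
      using eventually_happens' trivial_limit_sequentially by blast
    obtain e where e: "e \<longlonglongrightarrow> 0" "\<forall>\<^sub>F n in sequentially. \<bar>?a n - small_limit K\<bar> \<le> tail_bound K + e n"
      using pair_prob_diam_2_approx[of K] by blast
    have "\<forall>\<^sub>F n in sequentially. e n < r / 4" using e(1) r by (intro order_tendstoD(2)) auto
    then have "\<forall>\<^sub>F n in sequentially. \<bar>?a n - small_limit K\<bar> < r / 2"
      using e(2) by eventually_elim (use K in linarith)
    then obtain M where M: "\<And>n. n \<ge> M \<Longrightarrow> \<bar>?a n - small_limit K\<bar> < r / 2"
      by (auto simp: eventually_sequentially)
    show "\<exists>M. \<forall>m\<ge>M. \<forall>n\<ge>M. dist (?a m) (?a n) < r"
    proof (intro exI allI impI)
      fix m n assume "M \<le> m" "M \<le> n"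
      then show "dist (?a m) (?a n) < r" using M[of m] M[of n] unfolding dist_real_def by linarith
    qed
  qed
  then obtain p where p: "?a \<longlonglongrightarrow> p" using Cauchy_convergent convergent_def by blast
  have "0 < p"
  proof -
    have "\<forall>\<^sub>F K in sequentially. tail_bound K < 1 / 4"
      using tail_bound_tendsto by (intro order_tendstoD(2)) auto
    then obtain K where K: "tail_bound K < 1 / 4"
      using eventually_happens' trivial_limit_sequentially by blast
    let ?l = "\<lambda>n. 1 / (2 * real K + 1) - hub_bound (2 * n) - 1 / (real K + 1) * tail_bound K"
    have "?l \<longlonglongrightarrow> 1 / (2 * real K + 1) - 0 - 1 / (real K + 1) * tail_bound K"
      by (intro tendsto_intros hub_bound_double)
    moreover have "\<forall>\<^sub>F n in sequentially. ?l n \<le> ?a n"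
      using eventually_hub_size eventually_ge_at_top[of 2] eventually_gt_at_top[of K]
    proof eventually_elim
      case (elim n)
      show ?case
        by (rule pair_prob_bounds(1)[where u = 1])
          (use elim pairing.EP_diam_le_2_ge[of "{1..2*n}" _ K] in \<open>auto intro: EP_le_const\<close>)
    qed
    ultimately have "1 / (2 * real K + 1) - 0 - 1 / (real K + 1) * tail_bound K \<le> p"
      using p by (intro tendsto_le[OF trivial_limit_sequentially p])
    moreover have "1 / (real K + 1) * tail_bound K \<le> 1 / (real K + 1) * (1 / 4)"
      using K by (intro mult_left_mono) auto
    \<comment> \<open>Equivalent to \<open>2 * K + 1 < 4 * (K + 1)\<close>; this is why a tail below
      \<open>1 / 4\<close> was requested.\<close>
    moreover have "1 / (real K + 1) * (1 / 4) < 1 / (2 * real K + 1)" by (simp add: field_simps)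
    ultimately show ?thesis by linarith
  qed
  moreover have "p < 1"
  proof -
    let ?u = "\<lambda>n. 1 - 1 / 2 * ((real (2 * n) - 2) / (real (2 * n) - 1) * (1 / 3 * (1 / 2 - 2 / (real (2 * n) - 2))))"
    \<comment> \<open>The limit is \<open>1 - 1/2 * 1/3 * 1/2\<close>, from the constants of
      \<open>EP_far_ge\<close>.\<close>
    have "?u \<longlonglongrightarrow> 11 / 12" by real_asymp
    moreover have "\<forall>\<^sub>F n in sequentially. ?a n \<le> ?u n"
      using eventually_ge_at_top[of 2]
    proof eventually_elim
      case (elim n)
      have "EP {1..2*n} (\<lambda>\<pi>. of_bool (diam_le \<alpha> 2 \<pi>)) \<le> ?u n" if "pairing {1..2*n} \<alpha>" for \<alpha>
      proof -
        interpret pairing "{1..2*n}" \<alpha> by fact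
        have "EP {1..2*n} (\<lambda>\<pi>. of_bool (diam_le \<alpha> 2 \<pi>)) =
            EP {1..2*n} (\<lambda>\<pi>. 1 - of_bool (\<exists>u\<in>\<pi>. \<exists>v\<in>\<pi>. far \<alpha> \<pi> u v))"
          by (rule EP_cong) (auto simp: diam_le_2_iff)
        also have "\<dots> = 1 - EP {1..2*n} (\<lambda>\<pi>. of_bool (\<exists>u\<in>\<pi>. \<exists>v\<in>\<pi>. far \<alpha> \<pi> u v))"
          by (simp add: EP_diff EP_const)
        also have "\<dots> \<le> ?u n" using EP_far_ge elim by simp
        finally show ?thesis .
      qed
      then show ?case
        by (intro pair_prob_bounds(2)[where l = 0]) (auto intro: EP_nonneg)
    qed
    ultimately have "p \<le> 11 / 12" using p by (intro tendsto_le[OF trivial_limit_sequentially _ p])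
    then show ?thesis by simp
  qed
  ultimately show ?thesis using p that by blast
qed

theorem corollary2:
  shows "\<exists>\<xi>::real. 0 < \<xi> \<and> \<xi> < 1 \<and>
    ((\<lambda>n. measure_pmf.prob (random_map n) {M. graph_diameter (map_graph n M) = 3})
      \<longlonglongrightarrow> \<xi>) \<and>
    ((\<lambda>n. measure_pmf.prob (random_map n) {M. graph_diameter (map_graph n M) = 2})
      \<longlonglongrightarrow> 1 - \<xi>)"
proof -
  obtain p where p: "0 < p" "p < 1" "(\<lambda>n. pair_prob n (\<lambda>\<alpha>. diam_le \<alpha> 2)) \<longlonglongrightarrow> p"
    by (rule pair_prob_diam_2_tendsto)
  define c where "c = (\<lambda>n. card (labeled_maps n) / (fact (2*n) * card (matchings n)) :: real)"
  have c: "c \<longlonglongrightarrow> 1"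
    by (rule tendsto_sandwich[OF _ _ pair_prob_diam_3_tendsto tendsto_const])
      (use labeled_fraction_bounds in \<open>auto simp: c_def\<close>)
  have prob: "measure_pmf.prob (random_map n) {M. graph_diameter (map_graph n M) = ereal (real (Suc k))} =
    (pair_prob n (\<lambda>\<alpha>. diam_le \<alpha> (Suc k)) - pair_prob n (\<lambda>\<alpha>. diam_le \<alpha> k)) / c n" for n k
    unfolding c_def by (rule prob_random_map_diameter)
  have "(\<lambda>n. (pair_prob n (\<lambda>\<alpha>. diam_le \<alpha> 3) - pair_prob n (\<lambda>\<alpha>. diam_le \<alpha> 2)) / c n) \<longlonglongrightarrow> (1 - p) / 1"
    by (intro tendsto_intros pair_prob_diam_3_tendsto p(3) c) simp
  moreover have "(\<lambda>n. (pair_prob n (\<lambda>\<alpha>. diam_le \<alpha> 2) - pair_prob n (\<lambda>\<alpha>. diam_le \<alpha> 1)) / c n) \<longlonglongrightarrow> (p - 0) / 1"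
    by (intro tendsto_intros pair_prob_diam_1_tendsto p(3) c) simp
  moreover have "ereal (real (Suc 2)) = 3" "ereal (real (Suc 1)) = 2" "Suc 2 = 3" "Suc 1 = 2" by simp_all
  ultimately show ?thesis
    using prob[of _ 2] prob[of _ 1] p(1,2) by (intro exI[of _ "1 - p"]) (simp del: One_nat_def)
qed

end
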